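(* Let $R$ be a commutative ring with unit, let $\delta\in R$, and let $n$ be any positive integer. Let $\mathrm{TL}_n(\delta)$ be the Temperley-Lieb algebra over $R$, and let $I_0\le \mathrm{TL}_n(\delta)$ be the two-sided ideal which is free as an $R$-module on the Temperley-Lieb $n$-diagrams with no left-to-right connections. Then $$\mathrm{Tor}^{\mathrm{TL}_n(\delta)/I_0}_q(\mathbf{1},\mathbf{1})=0$$ for all $q>0$.
   Context: A Brauer $n$-diagram is a graph on two columns (left and right) of $n$ nodes each, in which each node is connected to exactly one other node by an edge. A Temperley-Lieb $n$-diagram is a Brauer $n$-diagram which is planar, i.e. its edges can be drawn without crossings in the strip between the two columns. A left-to-right connection is an edge joining a left node to a right node. The Temperley-Lieb algebra $\mathrm{TL}_n(\delta)$ is the free $R$-module on the Temperley-Lieb $n$-diagrams, with the bilinear multiplication given on diagrams $x,y$ as follows: identify the right nodes of $x$ with the left nodes of $y$; the product $xy$ is $\delta^a$ times the diagram in which two outer nodes are joined exactly when they are connected by a path in the concatenated graph, where $a$ is the number of closed loops (consisting entirely of middle nodes) in the concatenated graph. The trivial module $\mathbf{1}$ (both as a left and as a right module) is a single copy of $R$, on which diagrams with no left-to-left or right-to-right edges (here only the identity diagram) act as multiplication by $1$ and all other diagrams act as multiplication by $0$. Since $I_0$ is in general required to act as zero on $\mathbf{1}$ and does so for $n\geq 1$, $\mathbf{1}$ is also a left and right module over $\mathrm{TL}_n(\delta)/I_0$. *)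

theory Defs
  imports "HOL-Algebra.Algebra"
begin

section \<open>Tor over a (not necessarily commutative) ring\<close>

text \<open>
  The library locale \<open>module\<close> is restricted to commutative rings of scalars; only its record type is
  reused here, and of that record only the additive part and \<open>smult\<close>.  For a left module, \<open>a \<odot> x\<close> is
  the left action of \<open>a\<close> on \<open>x\<close>.  For a right module, the right action \<open>x \<cdot> a\<close> is stored
  (scalar first, as the record type dictates) as \<open>a \<odot> x\<close>.
\<close>

locale left_module = A?: ring A + M?: abelian_group M
  for A :: "('a, 'i) ring_scheme" (structure) and M :: "('a, 'b, 'j) module_scheme" (structure) +
  assumes smult_closed: "\<lbrakk>a \<in> carrier A; x \<in> carrier M\<rbrakk> \<Longrightarrow> a \<odot>\<^bsub>M\<^esub> x \<in> carrier M"
    and smult_l_distr: "\<lbrakk>a \<in> carrier A; b \<in> carrier A; x \<in> carrier M\<rbrakk>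
      \<Longrightarrow> (a \<oplus>\<^bsub>A\<^esub> b) \<odot>\<^bsub>M\<^esub> x = a \<odot>\<^bsub>M\<^esub> x \<oplus>\<^bsub>M\<^esub> b \<odot>\<^bsub>M\<^esub> x"
    and smult_r_distr: "\<lbrakk>a \<in> carrier A; x \<in> carrier M; y \<in> carrier M\<rbrakk>
      \<Longrightarrow> a \<odot>\<^bsub>M\<^esub> (x \<oplus>\<^bsub>M\<^esub> y) = a \<odot>\<^bsub>M\<^esub> x \<oplus>\<^bsub>M\<^esub> a \<odot>\<^bsub>M\<^esub> y"
    and smult_assoc: "\<lbrakk>a \<in> carrier A; b \<in> carrier A; x \<in> carrier M\<rbrakk>
      \<Longrightarrow> (a \<otimes>\<^bsub>A\<^esub> b) \<odot>\<^bsub>M\<^esub> x = a \<odot>\<^bsub>M\<^esub> (b \<odot>\<^bsub>M\<^esub> x)"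
    and smult_one: "x \<in> carrier M \<Longrightarrow> \<one>\<^bsub>A\<^esub> \<odot>\<^bsub>M\<^esub> x = x"

subsection \<open>Tensor products\<close>

definition tensor_relations ::
    "('a, 'i) ring_scheme \<Rightarrow> ('a, 'x, 'j) module_scheme \<Rightarrow> ('a, 'y, 'k) module_scheme
      \<Rightarrow> (('x \<times> 'y) \<Rightarrow>\<^sub>0 int) set" where
  "tensor_relations A M N =
     {frag_of (x \<oplus>\<^bsub>M\<^esub> x', y) - frag_of (x, y) - frag_of (x', y) | x x' y.
        x \<in> carrier M \<and> x' \<in> carrier M \<and> y \<in> carrier N}
   \<union> {frag_of (x, y \<oplus>\<^bsub>N\<^esub> y') - frag_of (x, y) - frag_of (x, y') | x y y'.
        x \<in> carrier M \<and> y \<in> carrier N \<and> y' \<in> carrier N}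
   \<union> {frag_of (a \<odot>\<^bsub>M\<^esub> x, y) - frag_of (x, a \<odot>\<^bsub>N\<^esub> y) | a x y.
        a \<in> carrier A \<and> x \<in> carrier M \<and> y \<in> carrier N}"

definition tensor_kernel ::
    "('a, 'i) ring_scheme \<Rightarrow> ('a, 'x, 'j) module_scheme \<Rightarrow> ('a, 'y, 'k) module_scheme
      \<Rightarrow> (('x \<times> 'y) \<Rightarrow>\<^sub>0 int) set" where
  "tensor_kernel A M N =
     generate (free_Abelian_group (carrier M \<times> carrier N)) (tensor_relations A M N)"

text \<open>The abelian group \<open>M \<otimes>\<^sub>A N\<close>, for \<open>M\<close> a right and \<open>N\<close> a left \<open>A\<close>-module (in multiplicative notation,
  as all groups in the library).\<close>

definition tensor ::
    "('a, 'i) ring_scheme \<Rightarrow> ('a, 'x, 'j) module_scheme \<Rightarrow> ('a, 'y, 'k) module_scheme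
      \<Rightarrow> (('x \<times> 'y) \<Rightarrow>\<^sub>0 int) set monoid" where
  "tensor A M N = free_Abelian_group (carrier M \<times> carrier N) Mod tensor_kernel A M N"

text \<open>The map \<open>id \<otimes> f : M \<otimes>\<^sub>A N \<rightarrow> M \<otimes>\<^sub>A N'\<close> induced by \<open>f : N \<rightarrow> N'\<close>; on a coset, apply \<open>id \<times> f\<close> to any
  representative.\<close>

definition tensor_map ::
    "('a, 'i) ring_scheme \<Rightarrow> ('a, 'x, 'j) module_scheme \<Rightarrow> ('a, 'z, 'l) module_scheme
      \<Rightarrow> ('y \<Rightarrow> 'z) \<Rightarrow> (('x \<times> 'y) \<Rightarrow>\<^sub>0 int) set \<Rightarrow> (('x \<times> 'z) \<Rightarrow>\<^sub>0 int) set" where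
  "tensor_map A M N' f K =
     the_elem ((\<lambda>c. r_coset (free_Abelian_group (carrier M \<times> carrier N')) (tensor_kernel A M N')
                      (frag_extend (\<lambda>(x, y). frag_of (x, f y)) c)) ` K)"

subsection \<open>Homology of a chain complex of abelian groups\<close>

text \<open>The differential \<open>d q\<close> goes from \<open>C (q + 1)\<close> to \<open>C q\<close>.\<close>

fun homology :: "(nat \<Rightarrow> 'c monoid) \<Rightarrow> (nat \<Rightarrow> 'c \<Rightarrow> 'c) \<Rightarrow> nat \<Rightarrow> 'c set monoid" where
  "homology C d 0 = C 0 Mod (d 0 ` carrier (C 1))"
| "homology C d (Suc q) =
     (C (Suc q))\<lparr>carrier := kernel (C (Suc q)) (C q) (d q)\<rparr>
       Mod (d (Suc q) ` carrier (C (Suc (Suc q))))"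

subsection \<open>Free modules and the standard free resolution\<close>

text \<open>The free left \<open>A\<close>-module on the set \<open>S\<close>; the fields \<open>mult\<close> and \<open>one\<close> are irrelevant.\<close>

definition free_module :: "('a, 'i) ring_scheme \<Rightarrow> 'g set \<Rightarrow> ('a, 'g \<Rightarrow> 'a) module" where
  "free_module A S =
     \<lparr>carrier = {f. f \<in> S \<rightarrow> carrier A \<and> (\<forall>g. g \<notin> S \<longrightarrow> f g = \<zero>\<^bsub>A\<^esub>) \<and> finite {g. f g \<noteq> \<zero>\<^bsub>A\<^esub>}},
      monoid.mult = undefined, one = undefined,
      ring.zero = (\<lambda>_. \<zero>\<^bsub>A\<^esub>), add = (\<lambda>f h g. f g \<oplus>\<^bsub>A\<^esub> h g),
      smult = (\<lambda>a f g. a \<otimes>\<^bsub>A\<^esub> f g)\<rparr>"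

text \<open>The \<open>A\<close>-linear map from a free module to \<open>M\<close> with values \<open>\<phi>\<close> on the basis.\<close>

definition linear_extension ::
    "('a, 'i) ring_scheme \<Rightarrow> ('a, 'b, 'j) module_scheme \<Rightarrow> ('g \<Rightarrow> 'b) \<Rightarrow> ('g \<Rightarrow> 'a) \<Rightarrow> 'b" where
  "linear_extension A M \<phi> f = (\<Oplus>\<^bsub>M\<^esub>g\<in>{g. f g \<noteq> \<zero>\<^bsub>A\<^esub>}. f g \<odot>\<^bsub>M\<^esub> \<phi> g)"

text \<open>
  The standard free resolution \<open>\<dots> \<rightarrow> F\<^sub>1 \<rightarrow> F\<^sub>0 \<rightarrow> N\<close>: here \<open>F\<^sub>0\<close> is free on the elements of \<open>N\<close>, and
  \<open>F\<^sub>q\<^sub>+\<^sub>1\<close> is free on (names for) all elements of the kernel of the map out of \<open>F\<^sub>q\<close>.  So that all degrees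
  have the same type, an element of \<open>F\<^sub>q\<close> is named by a list \<open>[(a\<^sub>1, g\<^sub>1), \<dots>, (a\<^sub>k, g\<^sub>k)]\<close> with
  \<open>a\<^sub>1 g\<^sub>1 + \<dots> + a\<^sub>k g\<^sub>k\<close> equal to it; several names for one element do no harm.
\<close>

datatype ('a, 'n) gen = Gen 'n | Rel "('a \<times> ('a, 'n) gen) list"

primrec formal_sum :: "('a, 'i) ring_scheme \<Rightarrow> ('a \<times> 'g) list \<Rightarrow> 'g \<Rightarrow> 'a" where
  "formal_sum A [] = (\<lambda>_. \<zero>\<^bsub>A\<^esub>)"
| "formal_sum A (p # l) =
     (\<lambda>g. if g = snd p then fst p \<oplus>\<^bsub>A\<^esub> formal_sum A l g else formal_sum A l g)"

definition res_aug ::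
    "('a, 'i) ring_scheme \<Rightarrow> ('a, 'n, 'j) module_scheme \<Rightarrow> (('a, 'n) gen \<Rightarrow> 'a) \<Rightarrow> 'n" where
  "res_aug A N = linear_extension A N (\<lambda>g. case g of Gen x \<Rightarrow> x | Rel _ \<Rightarrow> \<zero>\<^bsub>N\<^esub>)"

fun res_gens :: "('a, 'i) ring_scheme \<Rightarrow> ('a, 'n, 'j) module_scheme \<Rightarrow> nat \<Rightarrow> ('a, 'n) gen set" where
  "res_gens A N 0 = Gen ` carrier N"
| "res_gens A N (Suc 0) =
     Rel ` {l. set l \<subseteq> carrier A \<times> res_gens A N 0 \<and> res_aug A N (formal_sum A l) = \<zero>\<^bsub>N\<^esub>}"
| "res_gens A N (Suc (Suc q)) =
     Rel ` {l. set l \<subseteq> carrier A \<times> res_gens A N (Suc q) \<and>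
               linear_extension A (free_module A (res_gens A N q))
                 (\<lambda>g. case g of Gen _ \<Rightarrow> (\<lambda>_. \<zero>\<^bsub>A\<^esub>) | Rel l' \<Rightarrow> formal_sum A l')
                 (formal_sum A l) = (\<lambda>_. \<zero>\<^bsub>A\<^esub>)}"

definition res_module ::
    "('a, 'i) ring_scheme \<Rightarrow> ('a, 'n, 'j) module_scheme \<Rightarrow> nat \<Rightarrow> ('a, ('a, 'n) gen \<Rightarrow> 'a) module" where
  "res_module A N q = free_module A (res_gens A N q)"

definition res_diff ::
    "('a, 'i) ring_scheme \<Rightarrow> ('a, 'n, 'j) module_scheme \<Rightarrow> nat
      \<Rightarrow> (('a, 'n) gen \<Rightarrow> 'a) \<Rightarrow> (('a, 'n) gen \<Rightarrow> 'a)" where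
  "res_diff A N q = linear_extension A (res_module A N q)
     (\<lambda>g. case g of Gen _ \<Rightarrow> (\<lambda>_. \<zero>\<^bsub>A\<^esub>) | Rel l \<Rightarrow> formal_sum A l)"

subsubsection \<open>The standard resolution is a free resolution\<close>

definition left_module_hom ::
    "('a, 'i) ring_scheme \<Rightarrow> ('a, 'b, 'j) module_scheme \<Rightarrow> ('a, 'c, 'k) module_scheme
      \<Rightarrow> ('b \<Rightarrow> 'c) \<Rightarrow> bool" where
  "left_module_hom A M N h \<longleftrightarrow> h \<in> carrier M \<rightarrow> carrier N \<and>
     (\<forall>x\<in>carrier M. \<forall>y\<in>carrier M. h (x \<oplus>\<^bsub>M\<^esub> y) = h x \<oplus>\<^bsub>N\<^esub> h y) \<and>
     (\<forall>a\<in>carrier A. \<forall>x\<in>carrier M. h (a \<odot>\<^bsub>M\<^esub> x) = a \<odot>\<^bsub>N\<^esub> h x)"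

lemma free_module_simps [simp]:
  "f \<in> carrier (free_module A S) \<longleftrightarrow> f \<in> S \<rightarrow> carrier A \<and> (\<forall>g. g \<notin> S \<longrightarrow> f g = \<zero>\<^bsub>A\<^esub>) \<and> finite {g. f g \<noteq> \<zero>\<^bsub>A\<^esub>}"
  "\<zero>\<^bsub>free_module A S\<^esub> = (\<lambda>_. \<zero>\<^bsub>A\<^esub>)"
  "f \<oplus>\<^bsub>free_module A S\<^esub> h = (\<lambda>g. f g \<oplus>\<^bsub>A\<^esub> h g)"
  "a \<odot>\<^bsub>free_module A S\<^esub> f = (\<lambda>g. a \<otimes>\<^bsub>A\<^esub> f g)"
  by (auto simp: free_module_def)

lemma free_module_val:
  assumes "ring A" "f \<in> carrier (free_module A S)" shows "f g \<in> carrier A"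
proof -
  interpret ring A by fact
  show ?thesis using assms(2) by (cases "g \<in> S") auto
qed

lemma (in ring) free_module_left_module: "left_module R (free_module R S)"
proof -
  have ab: "abelian_group (free_module R S)"
  proof (rule abelian_groupI)
    fix x y assume x: "x \<in> carrier (free_module R S)" and y: "y \<in> carrier (free_module R S)"
    have "{g. x g \<oplus> y g \<noteq> \<zero>} \<subseteq> {g. x g \<noteq> \<zero>} \<union> {g. y g \<noteq> \<zero>}" by auto
    then show "x \<oplus>\<^bsub>free_module R S\<^esub> y \<in> carrier (free_module R S)"
      using x y by (auto intro: finite_subset)
    show "x \<oplus>\<^bsub>free_module R S\<^esub> y = y \<oplus>\<^bsub>free_module R S\<^esub> x"
      using free_module_val[OF ring_axioms x] free_module_val[OF ring_axioms y]
      by (auto simp: fun_eq_iff intro: a_comm)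
  next
    fix x y z assume "x \<in> carrier (free_module R S)" "y \<in> carrier (free_module R S)"
      "z \<in> carrier (free_module R S)"
    note v = this[THEN free_module_val[OF ring_axioms]]
    show "x \<oplus>\<^bsub>free_module R S\<^esub> y \<oplus>\<^bsub>free_module R S\<^esub> z =
       x \<oplus>\<^bsub>free_module R S\<^esub> (y \<oplus>\<^bsub>free_module R S\<^esub> z)"
      using v by (auto simp: fun_eq_iff intro: a_assoc)
  next
    fix x assume x: "x \<in> carrier (free_module R S)"
    note v = free_module_val[OF ring_axioms x]
    show "\<zero>\<^bsub>free_module R S\<^esub> \<oplus>\<^bsub>free_module R S\<^esub> x = x" using v by auto
    have "(\<lambda>g. \<ominus> x g) \<in> carrier (free_module R S)"
    proof -
      have "{g. \<ominus> x g \<noteq> \<zero>} \<subseteq> {g. x g \<noteq> \<zero>}" by auto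
      then show ?thesis using x by (auto intro: finite_subset)
    qed
    moreover have "(\<lambda>g. \<ominus> x g) \<oplus>\<^bsub>free_module R S\<^esub> x = \<zero>\<^bsub>free_module R S\<^esub>"
      using v by (auto simp: l_neg)
    ultimately show "\<exists>y\<in>carrier (free_module R S). y \<oplus>\<^bsub>free_module R S\<^esub> x = \<zero>\<^bsub>free_module R S\<^esub>"
      by blast
  qed auto
  have sm: "a \<odot>\<^bsub>free_module R S\<^esub> x \<in> carrier (free_module R S)"
    if "a \<in> carrier R" "x \<in> carrier (free_module R S)" for a x
  proof -
    have "{g. a \<otimes> x g \<noteq> \<zero>} \<subseteq> {g. x g \<noteq> \<zero>}" using that by auto
    then show ?thesis using that by (auto intro: finite_subset)
  qed
  show ?thesis
    by (intro left_module.intro left_module_axioms.intro ring_axioms ab sm)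
      (simp_all del: free_module_simps(1) add: fun_eq_iff l_distr r_distr m_assoc
        free_module_val[OF ring_axioms])
qed

context left_module
begin

lemma smult_zero: "x \<in> carrier M \<Longrightarrow> \<zero>\<^bsub>A\<^esub> \<odot>\<^bsub>M\<^esub> x = \<zero>\<^bsub>M\<^esub>"
  using smult_l_distr[of "\<zero>\<^bsub>A\<^esub>" "\<zero>\<^bsub>A\<^esub>" x] smult_closed[of "\<zero>\<^bsub>A\<^esub>" x]
  by (metis A.zero_closed A.l_zero M.add.r_cancel_one')

lemma smult_finsum:
  "\<lbrakk>finite T; a \<in> carrier A; \<And>g. g \<in> T \<Longrightarrow> F g \<in> carrier M\<rbrakk>
    \<Longrightarrow> a \<odot>\<^bsub>M\<^esub> (\<Oplus>\<^bsub>M\<^esub>g\<in>T. F g) = (\<Oplus>\<^bsub>M\<^esub>g\<in>T. a \<odot>\<^bsub>M\<^esub> F g)"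
proof (induction T rule: finite_induct)
  case empty
  then show ?case
    using smult_r_distr[of a "\<zero>\<^bsub>M\<^esub>" "\<zero>\<^bsub>M\<^esub>"] smult_closed[of a "\<zero>\<^bsub>M\<^esub>"]
    by (metis M.add.r_cancel_one' M.finsum_empty M.l_zero M.zero_closed)
next
  case (insert g T)
  have "a \<odot>\<^bsub>M\<^esub> (F g \<oplus>\<^bsub>M\<^esub> (\<Oplus>\<^bsub>M\<^esub>g\<in>T. F g)) = a \<odot>\<^bsub>M\<^esub> F g \<oplus>\<^bsub>M\<^esub> a \<odot>\<^bsub>M\<^esub> (\<Oplus>\<^bsub>M\<^esub>g\<in>T. F g)"
    using insert.prems by (intro smult_r_distr M.finsum_closed) auto
  then show ?case
    using insert by (simp add: Pi_def smult_closed)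
qed

lemma linear_extension_superset:
  assumes f: "f \<in> carrier (free_module A S)" and \<phi>: "\<phi> \<in> S \<rightarrow> carrier M"
    and T: "finite T" "{g. f g \<noteq> \<zero>\<^bsub>A\<^esub>} \<subseteq> T" "T \<subseteq> S"
  shows "linear_extension A M \<phi> f = (\<Oplus>\<^bsub>M\<^esub>g\<in>T. f g \<odot>\<^bsub>M\<^esub> \<phi> g)"
  unfolding linear_extension_def
  using T \<phi> free_module_val[OF A.ring_axioms f]
  by (intro M.add.finprod_mono_neutral_cong_left) (auto simp: smult_zero smult_closed Pi_iff subset_eq)

lemma linear_extension_hom:
  assumes \<phi>: "\<phi> \<in> S \<rightarrow> carrier M"
  shows "left_module_hom A (free_module A S) M (linear_extension A M \<phi>)"
  unfolding left_module_hom_def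
proof (intro conjI ballI)
  interpret F: left_module A "free_module A S" by (rule A.free_module_left_module)
  show "linear_extension A M \<phi> \<in> carrier (free_module A S) \<rightarrow> carrier M"
  proof
    fix f assume f: "f \<in> carrier (free_module A S)"
    then have "{g. f g \<noteq> \<zero>\<^bsub>A\<^esub>} \<subseteq> S" by auto
    then show "linear_extension A M \<phi> f \<in> carrier M"
      unfolding linear_extension_def using \<phi> free_module_val[OF A.ring_axioms f]
      by (intro M.finsum_closed) (auto intro!: smult_closed)
  qed
  {
    fix f h assume f: "f \<in> carrier (free_module A S)" and h: "h \<in> carrier (free_module A S)"
    define T where "T = {g. f g \<noteq> \<zero>\<^bsub>A\<^esub>} \<union> {g. h g \<noteq> \<zero>\<^bsub>A\<^esub>}"
    have T: "finite T" "T \<subseteq> S" using f h by (auto simp: T_def)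
    have vf: "\<And>g. f g \<in> carrier A" and vh: "\<And>g. h g \<in> carrier A"
      using free_module_val[OF A.ring_axioms] f h by metis+
    have p: "\<And>g. g \<in> T \<Longrightarrow> \<phi> g \<in> carrier M" using T \<phi> by auto
    have fh: "f \<oplus>\<^bsub>free_module A S\<^esub> h \<in> carrier (free_module A S)" using f h by (rule F.add.m_closed)
    have "linear_extension A M \<phi> (f \<oplus>\<^bsub>free_module A S\<^esub> h) = (\<Oplus>\<^bsub>M\<^esub>g\<in>T. (f g \<oplus>\<^bsub>A\<^esub> h g) \<odot>\<^bsub>M\<^esub> \<phi> g)"
      by (subst linear_extension_superset[OF fh \<phi> T(1) _ T(2)]) (auto simp: T_def)
    also have "\<dots> = (\<Oplus>\<^bsub>M\<^esub>g\<in>T. f g \<odot>\<^bsub>M\<^esub> \<phi> g \<oplus>\<^bsub>M\<^esub> h g \<odot>\<^bsub>M\<^esub> \<phi> g)"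
      using p vf vh by (intro M.finsum_cong') (auto simp: smult_l_distr smult_closed)
    also have "\<dots> = (\<Oplus>\<^bsub>M\<^esub>g\<in>T. f g \<odot>\<^bsub>M\<^esub> \<phi> g) \<oplus>\<^bsub>M\<^esub> (\<Oplus>\<^bsub>M\<^esub>g\<in>T. h g \<odot>\<^bsub>M\<^esub> \<phi> g)"
      using p vf vh by (intro M.finsum_addf) (auto simp: smult_closed)
    also have "\<dots> = linear_extension A M \<phi> f \<oplus>\<^bsub>M\<^esub> linear_extension A M \<phi> h"
      using linear_extension_superset[OF f \<phi> T(1) _ T(2)] linear_extension_superset[OF h \<phi> T(1) _ T(2)]
      by (auto simp: T_def)
    finally show "linear_extension A M \<phi> (f \<oplus>\<^bsub>free_module A S\<^esub> h) =
      linear_extension A M \<phi> f \<oplus>\<^bsub>M\<^esub> linear_extension A M \<phi> h" .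
  }
  {
    fix a f assume a: "a \<in> carrier A" and f: "f \<in> carrier (free_module A S)"
    define T where "T = {g. f g \<noteq> \<zero>\<^bsub>A\<^esub>}"
    have T: "finite T" "T \<subseteq> S" using f by (auto simp: T_def)
    have vf: "\<And>g. f g \<in> carrier A" using free_module_val[OF A.ring_axioms] f by metis
    have p: "\<And>g. g \<in> T \<Longrightarrow> \<phi> g \<in> carrier M" using T \<phi> by auto
    have af: "a \<odot>\<^bsub>free_module A S\<^esub> f \<in> carrier (free_module A S)" using a f by (rule F.smult_closed)
    have "linear_extension A M \<phi> (a \<odot>\<^bsub>free_module A S\<^esub> f) = (\<Oplus>\<^bsub>M\<^esub>g\<in>T. (a \<otimes>\<^bsub>A\<^esub> f g) \<odot>\<^bsub>M\<^esub> \<phi> g)"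
      using a by (subst linear_extension_superset[OF af \<phi> T(1) _ T(2)]) (auto simp: T_def)
    also have "\<dots> = (\<Oplus>\<^bsub>M\<^esub>g\<in>T. a \<odot>\<^bsub>M\<^esub> (f g \<odot>\<^bsub>M\<^esub> \<phi> g))"
      using p vf a by (intro M.finsum_cong') (auto simp: smult_assoc smult_closed)
    also have "\<dots> = a \<odot>\<^bsub>M\<^esub> (\<Oplus>\<^bsub>M\<^esub>g\<in>T. f g \<odot>\<^bsub>M\<^esub> \<phi> g)"
      using p vf a T by (intro smult_finsum[symmetric]) (auto simp: smult_closed)
    also have "\<dots> = a \<odot>\<^bsub>M\<^esub> linear_extension A M \<phi> f"
      by (simp add: linear_extension_def T_def)
    finally show "linear_extension A M \<phi> (a \<odot>\<^bsub>free_module A S\<^esub> f) =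
      a \<odot>\<^bsub>M\<^esub> linear_extension A M \<phi> f" .
  }
qed

lemma linear_extension_basis:
  assumes "g \<in> S" "\<phi> \<in> S \<rightarrow> carrier M"
  defines "\<delta>g \<equiv> (\<lambda>g'. if g' = g then \<one>\<^bsub>A\<^esub> else \<zero>\<^bsub>A\<^esub>)"
  shows "\<delta>g \<in> carrier (free_module A S)" "linear_extension A M \<phi> \<delta>g = \<phi> g"
proof -
  have s: "{g'. \<delta>g g' \<noteq> \<zero>\<^bsub>A\<^esub>} \<subseteq> {g}" by (auto simp: \<delta>g_def)
  then show d: "\<delta>g \<in> carrier (free_module A S)"
    using assms(1) by (auto simp: \<delta>g_def intro: finite_subset)
  have "\<phi> g \<in> carrier M" using assms by auto
  then show "linear_extension A M \<phi> \<delta>g = \<phi> g"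
    using linear_extension_superset[OF d assms(2), of "{g}"] s assms(1)
    by (simp add: \<delta>g_def smult_one)
qed

lemma linear_extension_trivial:
  assumes "f \<in> carrier (free_module A S)" "\<And>g. g \<in> S \<Longrightarrow> \<phi> g = \<zero>\<^bsub>M\<^esub>"
  shows "linear_extension A M \<phi> f = \<zero>\<^bsub>M\<^esub>"
proof -
  have z: "a \<odot>\<^bsub>M\<^esub> \<zero>\<^bsub>M\<^esub> = \<zero>\<^bsub>M\<^esub>" if "a \<in> carrier A" for a
    using smult_finsum[of "{}" a] that by simp
  have "(\<Oplus>\<^bsub>M\<^esub>g\<in>{g. f g \<noteq> \<zero>\<^bsub>A\<^esub>}. f g \<odot>\<^bsub>M\<^esub> \<phi> g) = (\<Oplus>\<^bsub>M\<^esub>g\<in>{g. f g \<noteq> \<zero>\<^bsub>A\<^esub>}. \<zero>\<^bsub>M\<^esub>)"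
  proof (intro M.finsum_cong' refl)
    fix g assume "g \<in> {g. f g \<noteq> \<zero>\<^bsub>A\<^esub>}"
    then have "g \<in> S" using assms(1) by auto
    then show "f g \<odot>\<^bsub>M\<^esub> \<phi> g = \<zero>\<^bsub>M\<^esub>"
      using assms(2) z free_module_val[OF A.ring_axioms assms(1)] by simp
  qed auto
  then show ?thesis by (simp add: linear_extension_def)
qed

end

lemma left_module_hom_linear_extension:
  assumes N: "left_module A N" and P: "left_module A P" and h: "left_module_hom A N P h"
    and f: "f \<in> carrier (free_module A S)" and \<phi>: "\<phi> \<in> S \<rightarrow> carrier N"
  shows "h (linear_extension A N \<phi> f) = linear_extension A P (h \<circ> \<phi>) f"
proof -
  interpret N: left_module A N by fact
  interpret P: left_module A P by fact
  have hc: "\<And>x. x \<in> carrier N \<Longrightarrow> h x \<in> carrier P"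
    and ha: "\<And>x y. \<lbrakk>x \<in> carrier N; y \<in> carrier N\<rbrakk> \<Longrightarrow> h (x \<oplus>\<^bsub>N\<^esub> y) = h x \<oplus>\<^bsub>P\<^esub> h y"
    and hs: "\<And>a x. \<lbrakk>a \<in> carrier A; x \<in> carrier N\<rbrakk> \<Longrightarrow> h (a \<odot>\<^bsub>N\<^esub> x) = a \<odot>\<^bsub>P\<^esub> h x"
    using h by (auto simp: left_module_hom_def)
  have h0: "h \<zero>\<^bsub>N\<^esub> = \<zero>\<^bsub>P\<^esub>"
    using ha[of "\<zero>\<^bsub>N\<^esub>" "\<zero>\<^bsub>N\<^esub>"] hc[of "\<zero>\<^bsub>N\<^esub>"] by (metis N.M.l_zero N.M.zero_closed P.M.add.r_cancel_one')
  have v: "\<And>g. f g \<in> carrier A" using free_module_val[OF N.A.ring_axioms f] .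
  have "h (\<Oplus>\<^bsub>N\<^esub>g\<in>T. f g \<odot>\<^bsub>N\<^esub> \<phi> g) = (\<Oplus>\<^bsub>P\<^esub>g\<in>T. f g \<odot>\<^bsub>P\<^esub> h (\<phi> g))" if "finite T" "T \<subseteq> S" for T
    using that
  proof (induction T rule: finite_induct)
    case empty
    then show ?case by (simp add: h0)
  next
    case (insert g T)
    have c: "\<And>g. g \<in> S \<Longrightarrow> f g \<odot>\<^bsub>N\<^esub> \<phi> g \<in> carrier N" "\<And>g. g \<in> S \<Longrightarrow> f g \<odot>\<^bsub>P\<^esub> h (\<phi> g) \<in> carrier P"
      using \<phi> v hc by (auto intro!: N.smult_closed P.smult_closed)
    have gT: "g \<in> S" "T \<subseteq> S" using insert.prems by auto
    have "h (\<Oplus>\<^bsub>N\<^esub>g\<in>insert g T. f g \<odot>\<^bsub>N\<^esub> \<phi> g) = h (f g \<odot>\<^bsub>N\<^esub> \<phi> g \<oplus>\<^bsub>N\<^esub> (\<Oplus>\<^bsub>N\<^esub>g\<in>T. f g \<odot>\<^bsub>N\<^esub> \<phi> g))"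
      using insert.hyps gT c by (subst N.M.finsum_insert) auto
    also have "\<dots> = h (f g \<odot>\<^bsub>N\<^esub> \<phi> g) \<oplus>\<^bsub>P\<^esub> h (\<Oplus>\<^bsub>N\<^esub>g\<in>T. f g \<odot>\<^bsub>N\<^esub> \<phi> g)"
      using gT c by (intro ha N.M.finsum_closed) auto
    also have "\<dots> = f g \<odot>\<^bsub>P\<^esub> h (\<phi> g) \<oplus>\<^bsub>P\<^esub> (\<Oplus>\<^bsub>P\<^esub>g\<in>T. f g \<odot>\<^bsub>P\<^esub> h (\<phi> g))"
      using insert.IH gT v \<phi> by (auto simp: hs Pi_iff)
    also have "\<dots> = (\<Oplus>\<^bsub>P\<^esub>g\<in>insert g T. f g \<odot>\<^bsub>P\<^esub> h (\<phi> g))"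
      using insert.hyps gT c by (subst P.M.finsum_insert) auto
    finally show ?case .
  qed
  moreover have "finite {g. f g \<noteq> \<zero>\<^bsub>A\<^esub>}" "{g. f g \<noteq> \<zero>\<^bsub>A\<^esub>} \<subseteq> S" using f by auto
  ultimately show ?thesis by (simp add: linear_extension_def)
qed

lemma (in ring) formal_sum_closed:
  "set l \<subseteq> carrier R \<times> S \<Longrightarrow> formal_sum R l \<in> carrier (free_module R S)"
proof (induction l)
  case (Cons p l)
  then have IH: "formal_sum R l \<in> carrier (free_module R S)" by auto
  have "{g. formal_sum R (p # l) g \<noteq> \<zero>} \<subseteq> insert (snd p) {g. formal_sum R l g \<noteq> \<zero>}" by auto
  moreover have "finite {g. formal_sum R l g \<noteq> \<zero>}" using IH by simp
  ultimately have "finite {g. formal_sum R (p # l) g \<noteq> \<zero>}" by (meson finite_insert finite_subset)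
  then show ?case using IH Cons.prems free_module_val[OF ring_axioms IH] by auto
qed auto

lemma (in ring) formal_sum_surj:
  assumes "f \<in> carrier (free_module R S)"
  shows "\<exists>l. set l \<subseteq> carrier R \<times> S \<and> formal_sum R l = f"
proof -
  have "\<exists>l. set l \<subseteq> carrier R \<times> S \<and> formal_sum R l = (\<lambda>g. if g \<in> T then f g else \<zero>)"
    if "finite T" "T \<subseteq> S" for T
    using that
  proof (induction T rule: finite_induct)
    case empty
    then show ?case by (intro exI[of _ "[]"]) auto
  next
    case (insert g T)
    then obtain l where l: "set l \<subseteq> carrier R \<times> S"
      "formal_sum R l = (\<lambda>g. if g \<in> T then f g else \<zero>)" by auto
    have "f g \<in> carrier R" using free_module_val[OF ring_axioms assms] .
    then show ?case using l insert
      by (intro exI[of _ "(f g, g) # l"]) auto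
  qed
  moreover have "finite {g. f g \<noteq> \<zero>}" "{g. f g \<noteq> \<zero>} \<subseteq> S" using assms by auto
  moreover have "(\<lambda>g. if g \<in> {g. f g \<noteq> \<zero>} then f g else \<zero>) = f" by auto
  ultimately show ?thesis by metis
qed

context left_module
begin

lemma res_module_left_module: "left_module A (res_module A M q)"
  unfolding res_module_def by (rule A.free_module_left_module)

lemma res_gens_SucD:
  assumes "g \<in> res_gens A M (Suc q)"
  obtains l where "g = Rel l" "set l \<subseteq> carrier A \<times> res_gens A M q"
  using assms by (cases q) auto

lemma res_diff_basis:
  "(\<lambda>g. case g of Gen _ \<Rightarrow> (\<lambda>_. \<zero>\<^bsub>A\<^esub>) | Rel l \<Rightarrow> formal_sum A l)
    \<in> res_gens A M (Suc q) \<rightarrow> carrier (res_module A M q)"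
  by (auto elim!: res_gens_SucD simp: res_module_def simp del: free_module_simps
      intro!: A.formal_sum_closed)

theorem standard_resolution:
  shows "left_module A (res_module A M q)"
    and "left_module_hom A (res_module A M 0) M (res_aug A M)"
    and "left_module_hom A (res_module A M (Suc q)) (res_module A M q) (res_diff A M q)"
    and "res_aug A M ` carrier (res_module A M 0) = carrier M"
    and "res_diff A M 0 ` carrier (res_module A M 1)
           = {f \<in> carrier (res_module A M 0). res_aug A M f = \<zero>\<^bsub>M\<^esub>}"
    and "res_diff A M (Suc q) ` carrier (res_module A M (Suc (Suc q)))
           = {f \<in> carrier (res_module A M (Suc q)). res_diff A M q f = \<zero>\<^bsub>res_module A M q\<^esub>}"
proof -
  show 1: "left_module A (res_module A M q)" for q by (rule res_module_left_module)
  let ?e = "\<lambda>g::('a, 'b) gen. case g of Gen x \<Rightarrow> x | Rel _ \<Rightarrow> \<zero>\<^bsub>M\<^esub>"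
  let ?b = "\<lambda>g::('a, 'b) gen. case g of Gen _ \<Rightarrow> (\<lambda>_. \<zero>\<^bsub>A\<^esub>) | Rel l \<Rightarrow> formal_sum A l"
  have e: "?e \<in> res_gens A M 0 \<rightarrow> carrier M" by auto
  show 2: "left_module_hom A (res_module A M 0) M (res_aug A M)"
    unfolding res_module_def res_aug_def using e by (rule linear_extension_hom)
  show 3: "left_module_hom A (res_module A M (Suc q)) (res_module A M q) (res_diff A M q)" for q
    unfolding res_module_def[of _ _ "Suc q"] res_diff_def
    using res_diff_basis by (rule left_module.linear_extension_hom[OF 1])
  show "res_aug A M ` carrier (res_module A M 0) = carrier M"
  proof
    show "res_aug A M ` carrier (res_module A M 0) \<subseteq> carrier M"
      using 2 by (auto simp: left_module_hom_def)
    show "carrier M \<subseteq> res_aug A M ` carrier (res_module A M 0)"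
    proof
      fix x assume "x \<in> carrier M"
      then have "Gen x \<in> res_gens A M 0" by auto
      from linear_extension_basis[OF this e] show "x \<in> res_aug A M ` carrier (res_module A M 0)"
        unfolding res_module_def res_aug_def by (metis (no_types, lifting) gen.simps(5) image_eqI)
    qed
  qed
  have exact: "res_diff A M q ` carrier (res_module A M (Suc q))
      = {f \<in> carrier (res_module A M q). h f = \<zero>\<^bsub>P\<^esub>}"
    if P: "left_module A P" and h: "left_module_hom A (res_module A M q) P h"
      and gens: "res_gens A M (Suc q) = Rel ` {l. set l \<subseteq> carrier A \<times> res_gens A M q
                  \<and> h (formal_sum A l) = \<zero>\<^bsub>P\<^esub>}"
    for q and h and P :: "('a, 'z, 'y) module_scheme"
  proof (intro subset_antisym subsetI)
    fix f assume "f \<in> res_diff A M q ` carrier (res_module A M (Suc q))"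
    then obtain k where k: "k \<in> carrier (free_module A (res_gens A M (Suc q)))" "f = res_diff A M q k"
      by (auto simp: res_module_def)
    have "f \<in> carrier (res_module A M q)"
      using 3[of q] k by (auto simp: left_module_hom_def res_module_def simp del: free_module_simps)
    moreover have "h f = linear_extension A P (h \<circ> ?b) k"
      unfolding k(2) res_diff_def
      by (rule left_module_hom_linear_extension[OF 1 P h k(1) res_diff_basis])
    moreover have "\<dots> = \<zero>\<^bsub>P\<^esub>"
      by (rule left_module.linear_extension_trivial[OF P k(1)]) (auto simp: gens)
    ultimately show "f \<in> {f \<in> carrier (res_module A M q). h f = \<zero>\<^bsub>P\<^esub>}" by simp
  next
    fix f assume "f \<in> {f \<in> carrier (res_module A M q). h f = \<zero>\<^bsub>P\<^esub>}"
    then have f: "f \<in> carrier (free_module A (res_gens A M q))" "h f = \<zero>\<^bsub>P\<^esub>"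
      by (auto simp: res_module_def)
    obtain l where l: "set l \<subseteq> carrier A \<times> res_gens A M q" "formal_sum A l = f"
      using A.formal_sum_surj[OF f(1)] by auto
    then have "Rel l \<in> res_gens A M (Suc q)" using f(2) gens by auto
    from left_module.linear_extension_basis[OF 1 this res_diff_basis] l(2)
    show "f \<in> res_diff A M q ` carrier (res_module A M (Suc q))"
      unfolding res_diff_def res_module_def[of _ _ "Suc q"]
      by (metis (no_types, lifting) gen.simps(6) image_eqI)
  qed
  show "res_diff A M 0 ` carrier (res_module A M 1)
      = {f \<in> carrier (res_module A M 0). res_aug A M f = \<zero>\<^bsub>M\<^esub>}"
    using exact[OF left_module_axioms 2] by simp
  show "res_diff A M (Suc q) ` carrier (res_module A M (Suc (Suc q)))
      = {f \<in> carrier (res_module A M (Suc q)). res_diff A M q f = \<zero>\<^bsub>res_module A M q\<^esub>}"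
    by (rule exact[OF 1 3]) (simp add: res_diff_def res_module_def)
qed

end

subsection \<open>Tor\<close>

text \<open>\<open>Tor\<^sup>A\<^sub>q(M, N)\<close>, the homology of \<open>M \<otimes>\<^sub>A F\<close> for the standard free resolution \<open>F\<close> of \<open>N\<close>;
  theorem \<open>left_module.standard_resolution\<close> above verifies that \<open>F\<close> is one.\<close>

definition Tor ::
    "('a, 'i) ring_scheme \<Rightarrow> ('a, 'm, 'j) module_scheme \<Rightarrow> ('a, 'n, 'k) module_scheme \<Rightarrow> nat
      \<Rightarrow> ('m \<times> (('a, 'n) gen \<Rightarrow> 'a) \<Rightarrow>\<^sub>0 int) set set monoid" where
  "Tor A M N = homology (\<lambda>q. tensor A M (res_module A N q))
                        (\<lambda>q. tensor_map A M (res_module A N q) (res_diff A N q))"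

section \<open>Temperley-Lieb diagrams\<close>

datatype node = Lft nat | Rgt nat

definition nodes :: "nat \<Rightarrow> node set" where
  "nodes n = Lft ` {..<n} \<union> Rgt ` {..<n}"

text \<open>A diagram is represented by its set of edges, an edge by its set of end points.\<close>

type_synonym diagram = "node set set"

definition Brauer :: "nat \<Rightarrow> diagram set" where
  "Brauer n = {E. (\<forall>e\<in>E. e \<subseteq> nodes n \<and> card e = 2) \<and> (\<forall>v\<in>nodes n. \<exists>!e. e \<in> E \<and> v \<in> e)}"

text \<open>The position of a node when walking around the boundary of the strip: down the left column, then
  up the right column.  Edges can be drawn in the strip without crossings iff no two of them have end
  points that interleave in this order.\<close>

fun boundary_pos :: "nat \<Rightarrow> node \<Rightarrow> nat" where
  "boundary_pos n (Lft i) = i"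
| "boundary_pos n (Rgt i) = 2 * n - 1 - i"

definition crossing :: "nat \<Rightarrow> node set \<Rightarrow> node set \<Rightarrow> bool" where
  "crossing n e e' \<longleftrightarrow> (\<exists>a b c d. e = {a, b} \<and> e' = {c, d} \<and>
     boundary_pos n a < boundary_pos n c \<and> boundary_pos n c < boundary_pos n b \<and>
     boundary_pos n b < boundary_pos n d)"

definition planar :: "nat \<Rightarrow> diagram \<Rightarrow> bool" where
  "planar n E \<longleftrightarrow> \<not> (\<exists>e\<in>E. \<exists>e'\<in>E. crossing n e e')"

definition TL_diagrams :: "nat \<Rightarrow> diagram set" where
  "TL_diagrams n = {E \<in> Brauer n. planar n E}"

definition id_diagram :: "nat \<Rightarrow> diagram" where
  "id_diagram n = {{Lft i, Rgt i} | i. i < n}"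

text \<open>An edge \<open>{Lft i, Rgt j}\<close> is a left-to-right connection.\<close>

definition has_lr :: "diagram \<Rightarrow> bool" where
  "has_lr E \<longleftrightarrow> (\<exists>i j. {Lft i, Rgt j} \<in> E)"

definition has_ll_or_rr :: "diagram \<Rightarrow> bool" where
  "has_ll_or_rr E \<longleftrightarrow> (\<exists>i j. {Lft i, Lft j} \<in> E \<or> {Rgt i, Rgt j} \<in> E)"

subsection \<open>Concatenation\<close>

datatype gnode = GLeft nat | GMid nat | GRight nat

fun in_first :: "node \<Rightarrow> gnode" where
  "in_first (Lft i) = GLeft i"
| "in_first (Rgt i) = GMid i"

fun in_second :: "node \<Rightarrow> gnode" where
  "in_second (Lft i) = GMid i"
| "in_second (Rgt i) = GRight i"

fun outer :: "node \<Rightarrow> gnode" where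
  "outer (Lft i) = GLeft i"
| "outer (Rgt i) = GRight i"

text \<open>The connectivity relation of the concatenated graph.\<close>

definition connected_rel :: "diagram \<Rightarrow> diagram \<Rightarrow> gnode rel" where
  "connected_rel x y =
     {(u, v). {u, v} \<in> ((`) in_first) ` x \<union> ((`) in_second) ` y}\<^sup>*"

definition comp_diagram :: "nat \<Rightarrow> diagram \<Rightarrow> diagram \<Rightarrow> diagram" where
  "comp_diagram n x y = {{u, v} | u v. u \<in> nodes n \<and> v \<in> nodes n \<and> u \<noteq> v \<and>
     (outer u, outer v) \<in> connected_rel x y}"

text \<open>Every middle node lies on two edges (counted with multiplicity), so closed loops are the same as
  connected components consisting of middle nodes only.\<close>

definition loops :: "nat \<Rightarrow> diagram \<Rightarrow> diagram \<Rightarrow> nat" where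
  "loops n x y = card {C. (\<exists>i<n. C = connected_rel x y `` {GMid i}) \<and> C \<subseteq> range GMid}"

section \<open>The Temperley-Lieb algebra, the ideal spanned by the diagrams without left-to-right
  connections, and the trivial module\<close>

text \<open>Elements are the coefficient functions of formal \<open>R\<close>-linear combinations of diagrams.\<close>

definition TL :: "('r, 's) ring_scheme \<Rightarrow> 'r \<Rightarrow> nat \<Rightarrow> (diagram \<Rightarrow> 'r) ring" where
  "TL R \<delta> n =
     \<lparr>carrier = {f. f \<in> TL_diagrams n \<rightarrow> carrier R \<and> (\<forall>d. d \<notin> TL_diagrams n \<longrightarrow> f d = \<zero>\<^bsub>R\<^esub>)},
      monoid.mult = (\<lambda>f g d. \<Oplus>\<^bsub>R\<^esub>x\<in>TL_diagrams n. \<Oplus>\<^bsub>R\<^esub>y\<in>TL_diagrams n.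
                if comp_diagram n x y = d
                then \<delta> [^]\<^bsub>R\<^esub> loops n x y \<otimes>\<^bsub>R\<^esub> (f x \<otimes>\<^bsub>R\<^esub> g y) else \<zero>\<^bsub>R\<^esub>),
      one = (\<lambda>d. if d = id_diagram n then \<one>\<^bsub>R\<^esub> else \<zero>\<^bsub>R\<^esub>),
      ring.zero = (\<lambda>_. \<zero>\<^bsub>R\<^esub>), add = (\<lambda>f g d. f d \<oplus>\<^bsub>R\<^esub> g d)\<rparr>"

definition TL_I0 :: "('r, 's) ring_scheme \<Rightarrow> 'r \<Rightarrow> nat \<Rightarrow> (diagram \<Rightarrow> 'r) set" where
  "TL_I0 R \<delta> n = {f \<in> carrier (TL R \<delta> n). \<forall>d. has_lr d \<longrightarrow> f d = \<zero>\<^bsub>R\<^esub>}"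

text \<open>The scalar by which an element of \<open>TL\<^sub>n(\<delta>)\<close> acts on the trivial module, and the trivial module over
  \<open>TL\<^sub>n(\<delta>)/I\<^sub>0\<close>, on which a coset acts through any representative (this is independent of the
  representative for \<open>n \<ge> 1\<close>).  As \<open>R\<close> is commutative, the same record is the trivial left module and the
  trivial right module.\<close>

definition triv_scalar :: "('r, 's) ring_scheme \<Rightarrow> nat \<Rightarrow> (diagram \<Rightarrow> 'r) \<Rightarrow> 'r" where
  "triv_scalar R n f =
     (\<Oplus>\<^bsub>R\<^esub>d\<in>TL_diagrams n. f d \<otimes>\<^bsub>R\<^esub> (if has_ll_or_rr d then \<zero>\<^bsub>R\<^esub> else \<one>\<^bsub>R\<^esub>))"

definition triv_module :: "('r, 's) ring_scheme \<Rightarrow> nat \<Rightarrow> ((diagram \<Rightarrow> 'r) set, 'r) module" where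
  "triv_module R n =
     \<lparr>carrier = carrier R, monoid.mult = monoid.mult R, one = one R, ring.zero = ring.zero R, add = add R,
      smult = (\<lambda>K r. the_elem (triv_scalar R n ` K) \<otimes>\<^bsub>R\<^esub> r)\<rparr>"

end

theory Submission
  imports Defs
begin

text \<open>
  Write \<open>A = TL\<^sub>n(\<delta>) / I\<^sub>0\<close>, let \<open>I\<close> be the kernel of \<open>A \<rightarrow> \<^bold>1\<close> and \<open>F\<close> the standard free resolution.
  As \<open>\<^bold>1 \<otimes>\<^sub>A F = F / I F\<close>, it suffices that the subcomplex \<open>I F\<close> is acyclic.  A diagram other than the
  identity has an edge joining adjacent left nodes, so \<open>I\<close> is the sum of the right ideals \<open>J\<^sub>i\<close> spanned
  by the diagrams with a left edge \<open>{i, i + 1}\<close>, and by Mayer-Vietoris it suffices that \<open>J F\<close> is acyclic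
  for each intersection \<open>J\<close> of some of the \<open>J\<^sub>i\<close>.  If \<open>J\<close> is not zero, then some left node is free of the
  edges that define \<open>J\<close>; this leaves room to produce them one at a time by left multiplication with
  diagrams \<open>e\<close> that fix \<open>J\<close> pointwise.  Multiplying a preimage in \<open>F\<close> of a cycle in \<open>J F\<close> by these \<open>e\<close>
  moves it into \<open>J F\<close>.
\<close>

section \<open>Acyclic right ideals\<close>

text \<open>The obvious element \<open>e\<close> fails: the generator with a cup at \<open>i\<close>
  on both sides squares to \<delta> times itself, and \<delta> need not be invertible. The product
  of two adjacent generators is idempotent for every \<delta>, but it occupies three consecutive
  nodes, so a spare node next to the cup is required. When the prescribed cups use up the whole left
  column there is none; but then no diagram in \<open>J\<close> has a left-to-right connection, and
  \<open>J\<close> vanishes modulo \<open>I\<^sub>0\<close>. This is what dividing by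
  \<open>I\<^sub>0\<close> achieves. The Mayer-Vietoris induction needs intersections to distribute
  over sums, which fails for right ideals in general. Here every ideal is spanned by a set of basis
  diagrams, so sums and intersections of ideals are unions and intersections of sets. Acyclicity is
  taken relative to the augmentation in degree 0.\<close>

context left_module
begin

text \<open>As \<open>res_module A M q\<close> is free, for a right ideal \<open>U\<close> this is
  the degree \<open>q\<close> part of \<open>U F\<close>, and at the same time a model of
  \<open>U \<otimes> F\<close> that avoids tensor products.\<close>

definition coeff_part :: "'a set \<Rightarrow> nat \<Rightarrow> (('a, 'b) gen \<Rightarrow> 'a) set" where
  "coeff_part U q = {f \<in> carrier (res_module A M q). \<forall>g. f g \<in> U}"

definition res_cycle :: "nat \<Rightarrow> (('a, 'b) gen \<Rightarrow> 'a) \<Rightarrow> bool" where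
  "res_cycle q f \<longleftrightarrow> (case q of 0 \<Rightarrow> res_aug A M f = \<zero>\<^bsub>M\<^esub> | Suc p \<Rightarrow> res_diff A M p f = (\<lambda>_. \<zero>\<^bsub>A\<^esub>))"

text \<open>Degree 0 is measured against the augmentation, so \<open>carrier A\<close> is acyclic
  merely because \<open>F\<close> resolves \<open>M\<close>. If \<open>U\<close> annihilates
  \<open>M\<close>, every element of degree 0 is a cycle (\<open>res_cycle_0_coeff_part\<close>) and
  the complex \<open>U F\<close> is exact.\<close>

definition acyclic_on :: "'a set \<Rightarrow> bool" where
  "acyclic_on U \<longleftrightarrow>
     (\<forall>q. \<forall>f\<in>coeff_part U q. res_cycle q f \<longrightarrow> f \<in> res_diff A M q ` coeff_part U (Suc q))"

lemma res_diff_image: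
  "res_diff A M q ` carrier (res_module A M (Suc q)) = {f \<in> carrier (res_module A M q). res_cycle q f}"
  using standard_resolution(5) standard_resolution(6)
  by (cases q) (auto simp: res_cycle_def res_module_def simp del: free_module_simps(1,3,4))

lemma res_diff_closed: "f \<in> carrier (res_module A M (Suc q)) \<Longrightarrow> res_diff A M q f \<in> carrier (res_module A M q)"
  and res_cycle_diff: "f \<in> carrier (res_module A M (Suc q)) \<Longrightarrow> res_cycle q (res_diff A M q f)"
  using res_diff_image by blast+

lemma res_module_abelian_group: "abelian_group (res_module A M q)"
  using res_module_left_module left_module.axioms(2) by blast

lemma res_add [simp]: "f \<oplus>\<^bsub>res_module A M q\<^esub> h = (\<lambda>g. f g \<oplus>\<^bsub>A\<^esub> h g)"
  by (simp add: res_module_def)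

lemma res_smult [simp]: "a \<odot>\<^bsub>res_module A M q\<^esub> f = (\<lambda>g. a \<otimes>\<^bsub>A\<^esub> f g)"
  by (simp add: res_module_def)

lemma res_val: "f \<in> carrier (res_module A M q) \<Longrightarrow> f g \<in> carrier A"
  using free_module_val[OF A.ring_axioms] by (auto simp: res_module_def simp del: free_module_simps)

lemma res_diff_add:
  "\<lbrakk>f \<in> carrier (res_module A M (Suc q)); h \<in> carrier (res_module A M (Suc q))\<rbrakk>
    \<Longrightarrow> res_diff A M q (\<lambda>g. f g \<oplus>\<^bsub>A\<^esub> h g) = (\<lambda>g. res_diff A M q f g \<oplus>\<^bsub>A\<^esub> res_diff A M q h g)"
  using standard_resolution(3)[of q] unfolding left_module_hom_def by simp

lemma res_diff_smult:
  "\<lbrakk>a \<in> carrier A; f \<in> carrier (res_module A M (Suc q))\<rbrakk>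
    \<Longrightarrow> res_diff A M q (\<lambda>g. a \<otimes>\<^bsub>A\<^esub> f g) = (\<lambda>g. a \<otimes>\<^bsub>A\<^esub> res_diff A M q f g)"
  using standard_resolution(3)[of q] unfolding left_module_hom_def by simp

lemma res_add_closed:
  "\<lbrakk>f \<in> carrier (res_module A M q); h \<in> carrier (res_module A M q)\<rbrakk>
    \<Longrightarrow> (\<lambda>g. f g \<oplus>\<^bsub>A\<^esub> h g) \<in> carrier (res_module A M q)"
  using abelian_groupE(1)[OF res_module_abelian_group, of f q h] by simp

lemma res_smult_closed:
  "\<lbrakk>a \<in> carrier A; f \<in> carrier (res_module A M q)\<rbrakk> \<Longrightarrow> (\<lambda>g. a \<otimes>\<^bsub>A\<^esub> f g) \<in> carrier (res_module A M q)"
  using left_module.smult_closed[OF res_module_left_module, of a f q] by simp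

lemma res_minus_closed:
  assumes "f \<in> carrier (res_module A M q)"
  shows "(\<lambda>g. \<ominus>\<^bsub>A\<^esub> f g) \<in> carrier (res_module A M q)"
proof -
  have "(\<lambda>g. \<ominus>\<^bsub>A\<^esub> f g) = (\<lambda>g. (\<ominus>\<^bsub>A\<^esub> \<one>\<^bsub>A\<^esub>) \<otimes>\<^bsub>A\<^esub> f g)"
    using res_val[OF assms] by (auto simp: A.l_minus)
  then show ?thesis using res_smult_closed[OF _ assms, of "\<ominus>\<^bsub>A\<^esub> \<one>\<^bsub>A\<^esub>"] by simp
qed

lemma res_diff_minus:
  assumes "f \<in> carrier (res_module A M (Suc q))"
  shows "res_diff A M q (\<lambda>g. \<ominus>\<^bsub>A\<^esub> f g) = (\<lambda>g. \<ominus>\<^bsub>A\<^esub> res_diff A M q f g)"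
proof -
  have "(\<lambda>g. \<ominus>\<^bsub>A\<^esub> f g) = (\<lambda>g. (\<ominus>\<^bsub>A\<^esub> \<one>\<^bsub>A\<^esub>) \<otimes>\<^bsub>A\<^esub> f g)"
    using res_val[OF assms] by (auto simp: A.l_minus)
  then show ?thesis
    using res_diff_smult[OF _ assms, of "\<ominus>\<^bsub>A\<^esub> \<one>\<^bsub>A\<^esub>"] res_val[OF res_diff_closed[OF assms]]
    by (simp add: A.l_minus)
qed

lemma finsum_in_subset:
  assumes "\<zero>\<^bsub>M\<^esub> \<in> W" "\<And>x y. x \<in> W \<Longrightarrow> y \<in> W \<Longrightarrow> x \<oplus>\<^bsub>M\<^esub> y \<in> W" "W \<subseteq> carrier M" "F \<in> T \<rightarrow> W"
  shows "finsum M F T \<in> W"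
proof (cases "finite T")
  case True
  then show ?thesis using assms(4)
  proof (induction T rule: finite_induct)
    case (insert t T)
    then have "F \<in> T \<rightarrow> carrier M" "F t \<in> carrier M" using assms(3) by auto
    with insert assms(2) show ?case by simp
  qed (use assms in simp)
qed (use assms in \<open>simp add: finsum_def finprod_def\<close>)

section \<open>Right ideals and the subcomplexes they define\<close>

definition right_ideal :: "'a set \<Rightarrow> bool" where
  "right_ideal U \<longleftrightarrow> additive_subgroup U A \<and> (\<forall>u\<in>U. \<forall>a\<in>carrier A. u \<otimes>\<^bsub>A\<^esub> a \<in> U)"

lemma right_idealD:
  assumes "right_ideal U"
  shows "U \<subseteq> carrier A" "\<zero>\<^bsub>A\<^esub> \<in> U" "\<lbrakk>u \<in> U; v \<in> U\<rbrakk> \<Longrightarrow> u \<oplus>\<^bsub>A\<^esub> v \<in> U" "u \<in> U \<Longrightarrow> \<ominus>\<^bsub>A\<^esub> u \<in> U"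
    "\<lbrakk>u \<in> U; a \<in> carrier A\<rbrakk> \<Longrightarrow> u \<otimes>\<^bsub>A\<^esub> a \<in> U"
proof -
  interpret U: additive_subgroup U A using assms by (simp add: right_ideal_def)
  show "U \<subseteq> carrier A" "\<zero>\<^bsub>A\<^esub> \<in> U" "\<lbrakk>u \<in> U; v \<in> U\<rbrakk> \<Longrightarrow> u \<oplus>\<^bsub>A\<^esub> v \<in> U"
    using U.a_subset U.zero_closed U.a_closed by auto
  show "u \<in> U \<Longrightarrow> \<ominus>\<^bsub>A\<^esub> u \<in> U" using U.a_inv_closed by simp
  show "\<lbrakk>u \<in> U; a \<in> carrier A\<rbrakk> \<Longrightarrow> u \<otimes>\<^bsub>A\<^esub> a \<in> U" using assms by (simp add: right_ideal_def)
qed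

lemma right_idealI:
  assumes "U \<subseteq> carrier A" "\<zero>\<^bsub>A\<^esub> \<in> U" "\<And>u v. \<lbrakk>u \<in> U; v \<in> U\<rbrakk> \<Longrightarrow> u \<oplus>\<^bsub>A\<^esub> v \<in> U" "\<And>u. u \<in> U \<Longrightarrow> \<ominus>\<^bsub>A\<^esub> u \<in> U"
    "\<And>u a. \<lbrakk>u \<in> U; a \<in> carrier A\<rbrakk> \<Longrightarrow> u \<otimes>\<^bsub>A\<^esub> a \<in> U"
  shows "right_ideal U"
  unfolding right_ideal_def additive_subgroup_def
  using assms by (auto intro!: A.add.subgroupI simp: a_inv_def)

lemma coeff_partD:
  assumes "f \<in> coeff_part U q"
  shows "f \<in> carrier (res_module A M q)" "f g \<in> U"
  using assms by (auto simp: coeff_part_def)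

text \<open>By left linearity the coefficients of the boundary are sums of products with a
  coefficient \<open>f g\<close> on the left and a coefficient of the boundary of the generator
  \<open>g\<close> on the right; a right ideal absorbs the latter.\<close>

lemma res_diff_coeff_part:
  assumes U: "right_ideal U" and f: "f \<in> coeff_part U (Suc q)"
  shows "res_diff A M q f \<in> coeff_part U q"
proof -
  interpret F: left_module A "res_module A M q" by (rule res_module_left_module)
  note fc = coeff_partD[OF f]
  have "linear_extension A (res_module A M q) \<phi> f \<in> coeff_part U q"
    if \<phi>: "\<phi> \<in> res_gens A M (Suc q) \<rightarrow> carrier (res_module A M q)" for \<phi>
    unfolding linear_extension_def
  proof (rule F.finsum_in_subset)
    show "\<zero>\<^bsub>res_module A M q\<^esub> \<in> coeff_part U q"
      using right_idealD(2)[OF U] F.M.zero_closed by (auto simp: coeff_part_def res_module_def)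
    show "x \<oplus>\<^bsub>res_module A M q\<^esub> y \<in> coeff_part U q" if "x \<in> coeff_part U q" "y \<in> coeff_part U q" for x y
      using that right_idealD(3)[OF U] F.M.add.m_closed[of x y] by (auto simp: coeff_part_def)
    show "coeff_part U q \<subseteq> carrier (res_module A M q)" by (auto simp: coeff_part_def)
    show "(\<lambda>g. f g \<odot>\<^bsub>res_module A M q\<^esub> \<phi> g) \<in> {g. f g \<noteq> \<zero>\<^bsub>A\<^esub>} \<rightarrow> coeff_part U q"
    proof
      fix g assume "g \<in> {g. f g \<noteq> \<zero>\<^bsub>A\<^esub>}"
      then have "g \<in> res_gens A M (Suc q)" using fc(1) by (auto simp: res_module_def)
      then have p: "\<phi> g \<in> carrier (res_module A M q)" using \<phi> by auto
      then show "f g \<odot>\<^bsub>res_module A M q\<^esub> \<phi> g \<in> coeff_part U q"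
        using F.smult_closed[OF res_val[OF fc(1)] p] right_idealD(5)[OF U fc(2)] res_val[OF p]
        by (auto simp: coeff_part_def)
    qed
  qed
  from this[OF res_diff_basis] show ?thesis by (simp add: res_diff_def)
qed

lemma acyclic_on_carrier: "acyclic_on (carrier A)"
proof -
  have "coeff_part (carrier A) q = carrier (res_module A M q)" for q
    using res_val by (auto simp: coeff_part_def)
  then show ?thesis using res_diff_image by (auto simp: acyclic_on_def)
qed

lemma acyclic_on_zero: "acyclic_on {\<zero>\<^bsub>A\<^esub>}"
  unfolding acyclic_on_def
proof (intro allI ballI impI)
  fix q f assume "f \<in> coeff_part {\<zero>\<^bsub>A\<^esub>} q"
  then have f: "f = (\<lambda>_. \<zero>\<^bsub>A\<^esub>)" by (auto simp: coeff_part_def)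
  have "(\<lambda>_. \<zero>\<^bsub>A\<^esub>) \<in> carrier (res_module A M (Suc q))" by (auto simp: res_module_def)
  moreover from this have "res_diff A M q (\<lambda>_. \<zero>\<^bsub>A\<^esub>) = (\<lambda>_. \<zero>\<^bsub>A\<^esub>)"
    using res_diff_smult[of "\<zero>\<^bsub>A\<^esub>" "\<lambda>_. \<zero>\<^bsub>A\<^esub>" q] res_val[OF res_diff_closed] by simp
  ultimately show "f \<in> res_diff A M q ` coeff_part {\<zero>\<^bsub>A\<^esub>} (Suc q)"
    unfolding f by (intro image_eqI[of _ _ "\<lambda>_. \<zero>\<^bsub>A\<^esub>"]) (auto simp: coeff_part_def)
qed

text \<open>Left multiplication by \<open>e\<close> commutes with the differential and acts
  coefficientwise. It moves a preimage \<open>h\<close> from \<open>U\<close> into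
  \<open>U'\<close>, and the boundary \<open>f\<close> of \<open>h\<close> stays the same because
  \<open>e\<close> fixes \<open>U'\<close>.\<close>

lemma acyclic_on_retract:
  assumes U: "acyclic_on U" and "U' \<subseteq> U" "e \<in> carrier A"
    and e: "\<And>u. u \<in> U \<Longrightarrow> e \<otimes>\<^bsub>A\<^esub> u \<in> U'" "\<And>u. u \<in> U' \<Longrightarrow> e \<otimes>\<^bsub>A\<^esub> u = u"
  shows "acyclic_on U'"
  unfolding acyclic_on_def
proof (intro allI ballI impI)
  fix q f assume f: "f \<in> coeff_part U' q" and "res_cycle q f"
  moreover have "f \<in> coeff_part U q" using f assms(2) by (auto simp: coeff_part_def)
  ultimately obtain h where h: "h \<in> coeff_part U (Suc q)" "f = res_diff A M q h"
    using U by (auto simp: acyclic_on_def)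
  have "(\<lambda>g. e \<otimes>\<^bsub>A\<^esub> h g) \<in> coeff_part U' (Suc q)"
    using h(1) e(1) res_smult_closed[OF assms(3)] by (auto simp: coeff_part_def)
  moreover have "res_diff A M q (\<lambda>g. e \<otimes>\<^bsub>A\<^esub> h g) = f"
    using res_diff_smult[OF assms(3) coeff_partD(1)[OF h(1)]] h(2) e(2) coeff_partD(2)[OF f]
    by auto
  ultimately show "f \<in> res_diff A M q ` coeff_part U' (Suc q)" by blast
qed

lemma res_cycle_0_coeff_part:
  assumes "\<And>u x. \<lbrakk>u \<in> U; x \<in> carrier M\<rbrakk> \<Longrightarrow> u \<odot>\<^bsub>M\<^esub> x = \<zero>\<^bsub>M\<^esub>" "f \<in> coeff_part U 0"
  shows "res_cycle 0 f"
proof -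
  note fc = coeff_partD[OF assms(2)]
  have "res_aug A M f = (\<Oplus>\<^bsub>M\<^esub>g\<in>{g. f g \<noteq> \<zero>\<^bsub>A\<^esub>}. \<zero>\<^bsub>M\<^esub>)"
    unfolding res_aug_def linear_extension_def
  proof (intro M.finsum_cong' refl)
    fix g assume "g \<in> {g. f g \<noteq> \<zero>\<^bsub>A\<^esub>}"
    then have "g \<in> Gen ` carrier M" using fc(1) by (auto simp: res_module_def)
    then show "f g \<odot>\<^bsub>M\<^esub> (case g of Gen x \<Rightarrow> x | Rel _ \<Rightarrow> \<zero>\<^bsub>M\<^esub>) = \<zero>\<^bsub>M\<^esub>"
      using assms(1) fc(2) by auto
  qed auto
  then show ?thesis by (simp add: res_cycle_def)
qed

text \<open>The Mayer-Vietoris argument.  In degree \<open>0\<close> the augmentation has to vanish on both parts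
  separately, hence the hypotheses on the action.\<close>

lemma acyclic_on_sum:
  assumes U: "acyclic_on U" "right_ideal U" "\<And>u x. \<lbrakk>u \<in> U; x \<in> carrier M\<rbrakk> \<Longrightarrow> u \<odot>\<^bsub>M\<^esub> x = \<zero>\<^bsub>M\<^esub>"
    and V: "acyclic_on V" "right_ideal V" "\<And>u x. \<lbrakk>u \<in> V; x \<in> carrier M\<rbrakk> \<Longrightarrow> u \<odot>\<^bsub>M\<^esub> x = \<zero>\<^bsub>M\<^esub>"
    and UV: "acyclic_on (U \<inter> V)"
    and W: "U \<subseteq> W" "V \<subseteq> W" "\<And>u v. \<lbrakk>u \<in> W; v \<in> W\<rbrakk> \<Longrightarrow> u \<oplus>\<^bsub>A\<^esub> v \<in> W"
      "\<And>w. w \<in> W \<Longrightarrow> \<exists>u\<in>U. \<exists>v\<in>V. w = u \<oplus>\<^bsub>A\<^esub> v"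
  shows "acyclic_on W"
  unfolding acyclic_on_def
proof (intro allI ballI impI)
  fix q f assume f: "f \<in> coeff_part W q" and cf: "res_cycle q f"
  note fc = coeff_partD[OF f]
  \<comment> \<open>The last clause keeps the supports of \<open>u\<close> and \<open>v\<close>
    inside that of \<open>f\<close>, so that both parts are again elements of the free
    module.\<close>
  have "\<forall>g. \<exists>u v. u \<in> U \<and> v \<in> V \<and> f g = u \<oplus>\<^bsub>A\<^esub> v \<and> (f g = \<zero>\<^bsub>A\<^esub> \<longrightarrow> u = \<zero>\<^bsub>A\<^esub> \<and> v = \<zero>\<^bsub>A\<^esub>)"
  proof
    fix g
    show "\<exists>u v. u \<in> U \<and> v \<in> V \<and> f g = u \<oplus>\<^bsub>A\<^esub> v \<and> (f g = \<zero>\<^bsub>A\<^esub> \<longrightarrow> u = \<zero>\<^bsub>A\<^esub> \<and> v = \<zero>\<^bsub>A\<^esub>)"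
    proof (cases "f g = \<zero>\<^bsub>A\<^esub>")
      case True
      then show ?thesis
        using right_idealD(2)[OF U(2)] right_idealD(2)[OF V(2)] by (intro exI[of _ "\<zero>\<^bsub>A\<^esub>"]) simp
    next
      case False
      then show ?thesis using W(4)[OF fc(2)[of g]] by blast
    qed
  qed
  then obtain u v where uv: "\<And>g. u g \<in> U" "\<And>g. v g \<in> V" "\<And>g. f g = u g \<oplus>\<^bsub>A\<^esub> v g"
    "\<And>g. f g = \<zero>\<^bsub>A\<^esub> \<Longrightarrow> u g = \<zero>\<^bsub>A\<^esub>" "\<And>g. f g = \<zero>\<^bsub>A\<^esub> \<Longrightarrow> v g = \<zero>\<^bsub>A\<^esub>" by metis
  have uA: "\<And>g. u g \<in> carrier A" and vA: "\<And>g. v g \<in> carrier A"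
    using uv right_idealD(1)[OF U(2)] right_idealD(1)[OF V(2)] by blast+
  have fin: "finite {g. f g \<noteq> \<zero>\<^bsub>A\<^esub>}" using fc(1) by (simp add: res_module_def)
  have "{g. u g \<noteq> \<zero>\<^bsub>A\<^esub>} \<subseteq> {g. f g \<noteq> \<zero>\<^bsub>A\<^esub>}" "{g. v g \<noteq> \<zero>\<^bsub>A\<^esub>} \<subseteq> {g. f g \<noteq> \<zero>\<^bsub>A\<^esub>}"
    using uv(4,5) by auto
  then have finu: "finite {g. u g \<noteq> \<zero>\<^bsub>A\<^esub>}" "finite {g. v g \<noteq> \<zero>\<^bsub>A\<^esub>}" using fin finite_subset by blast+
  have u: "u \<in> coeff_part U q" and v: "v \<in> coeff_part V q"
  proof -
    have "f g = \<zero>\<^bsub>A\<^esub>" if "g \<notin> res_gens A M q" for g using fc(1) that by (simp add: res_module_def)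
    then show "u \<in> coeff_part U q" "v \<in> coeff_part V q"
      unfolding coeff_part_def res_module_def free_module_simps mem_Collect_eq
      using uv(1,2,4,5) uA vA finu by blast+
  qed
  note uc = coeff_partD[OF u] and vc = coeff_partD[OF v]
  \<comment> \<open>The two parts of a cycle need not be cycles. But the boundary of
    \<open>u\<close> is minus that of \<open>v\<close>, hence a cycle over
    \<open>U \<inter> V\<close>; it bounds some \<open>w\<close> there, and \<open>w\<close>
    corrects both parts without changing their sum.\<close>
  have "\<exists>w\<in>coeff_part (U \<inter> V) q. res_cycle q (\<lambda>g. u g \<oplus>\<^bsub>A\<^esub> \<ominus>\<^bsub>A\<^esub> w g) \<and> res_cycle q (\<lambda>g. v g \<oplus>\<^bsub>A\<^esub> w g)"
  proof (cases q)
    case 0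
    have "(\<lambda>_. \<zero>\<^bsub>A\<^esub>) \<in> coeff_part (U \<inter> V) q"
      using right_idealD(2)[OF U(2)] right_idealD(2)[OF V(2)] by (simp add: coeff_part_def res_module_def)
    moreover have "(\<lambda>g. u g \<oplus>\<^bsub>A\<^esub> \<ominus>\<^bsub>A\<^esub> \<zero>\<^bsub>A\<^esub>) = u" "(\<lambda>g. v g \<oplus>\<^bsub>A\<^esub> \<zero>\<^bsub>A\<^esub>) = v"
      using uA vA by auto
    moreover have "res_cycle q u" "res_cycle q v"
      using res_cycle_0_coeff_part[OF U(3), where f = u] res_cycle_0_coeff_part[OF V(3), where f = v] u v 0 by auto
    ultimately show ?thesis by (intro bexI[of _ "\<lambda>_. \<zero>\<^bsub>A\<^esub>"]) auto
  next
    case (Suc p)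
    let ?d = "res_diff A M p"
    have du: "?d u \<in> coeff_part U p" and dv: "?d v \<in> coeff_part V p"
      using res_diff_coeff_part[OF U(2)] res_diff_coeff_part[OF V(2)] u v Suc by auto
    have sum: "?d u g \<oplus>\<^bsub>A\<^esub> ?d v g = \<zero>\<^bsub>A\<^esub>" for g
    proof -
      have "f = (\<lambda>g. u g \<oplus>\<^bsub>A\<^esub> v g)" using uv(3) by auto
      then have "?d f = (\<lambda>g. ?d u g \<oplus>\<^bsub>A\<^esub> ?d v g)"
        using res_diff_add[of u p v] uc(1) vc(1) Suc by simp
      then show ?thesis using cf Suc by (auto simp: res_cycle_def fun_eq_iff)
    qed
    have "?d u g = \<ominus>\<^bsub>A\<^esub> ?d v g" for g
      using sum[of g] res_val[OF coeff_partD(1)[OF du]] res_val[OF coeff_partD(1)[OF dv]]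
      by (metis A.minus_equality)
    then have "?d u \<in> coeff_part (U \<inter> V) p"
      using du coeff_partD(2)[OF dv] right_idealD(4)[OF V(2)] by (auto simp: coeff_part_def)
    moreover have "res_cycle p (?d u)" using res_cycle_diff uc(1) Suc by auto
    ultimately obtain w where w: "w \<in> coeff_part (U \<inter> V) q" "?d u = ?d w"
      using UV Suc by (auto simp: acyclic_on_def)
    note wc = coeff_partD(1)[OF w(1)]
    have "?d (\<lambda>g. u g \<oplus>\<^bsub>A\<^esub> \<ominus>\<^bsub>A\<^esub> w g) = (\<lambda>_. \<zero>\<^bsub>A\<^esub>)"
      using res_diff_add[of u p "\<lambda>g. \<ominus>\<^bsub>A\<^esub> w g"] res_diff_minus[of w p] res_minus_closed[of w q]
        uc(1) wc Suc w(2) res_val[OF res_diff_closed, of w p] by (auto simp: A.r_neg)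
    moreover have "?d (\<lambda>g. v g \<oplus>\<^bsub>A\<^esub> w g) = (\<lambda>_. \<zero>\<^bsub>A\<^esub>)"
      using res_diff_add[of v p w] vc(1) wc Suc w(2) sum
        res_val[OF coeff_partD(1)[OF du]] res_val[OF coeff_partD(1)[OF dv]]
      by (auto simp: A.a_comm)
    ultimately show ?thesis using w(1) Suc by (auto simp: res_cycle_def)
  qed
  then obtain w where w: "w \<in> coeff_part (U \<inter> V) q"
    and cu: "res_cycle q (\<lambda>g. u g \<oplus>\<^bsub>A\<^esub> \<ominus>\<^bsub>A\<^esub> w g)" and cv: "res_cycle q (\<lambda>g. v g \<oplus>\<^bsub>A\<^esub> w g)" by blast
  note wc = coeff_partD[OF w]
  have wA: "\<And>g. w g \<in> carrier A" using wc(1) res_val by blast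
  have "(\<lambda>g. u g \<oplus>\<^bsub>A\<^esub> \<ominus>\<^bsub>A\<^esub> w g) \<in> coeff_part U q"
    using res_add_closed[OF uc(1) res_minus_closed[OF wc(1)]] right_idealD(3,4)[OF U(2)] uv(1) wc(2)
    by (auto simp: coeff_part_def)
  then obtain u' where u': "u' \<in> coeff_part U (Suc q)" "(\<lambda>g. u g \<oplus>\<^bsub>A\<^esub> \<ominus>\<^bsub>A\<^esub> w g) = res_diff A M q u'"
    using U(1) cu by (auto simp: acyclic_on_def)
  have "(\<lambda>g. v g \<oplus>\<^bsub>A\<^esub> w g) \<in> coeff_part V q"
    using res_add_closed[OF vc(1) wc(1)] right_idealD(3)[OF V(2)] uv(2) wc(2)
    by (auto simp: coeff_part_def)
  then obtain v' where v': "v' \<in> coeff_part V (Suc q)" "(\<lambda>g. v g \<oplus>\<^bsub>A\<^esub> w g) = res_diff A M q v'"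
    using V(1) cv by (auto simp: acyclic_on_def)
  have "f = (\<lambda>g. (u g \<oplus>\<^bsub>A\<^esub> \<ominus>\<^bsub>A\<^esub> w g) \<oplus>\<^bsub>A\<^esub> (v g \<oplus>\<^bsub>A\<^esub> w g))"
  proof
    fix g
    have "(u g \<oplus>\<^bsub>A\<^esub> \<ominus>\<^bsub>A\<^esub> w g) \<oplus>\<^bsub>A\<^esub> (v g \<oplus>\<^bsub>A\<^esub> w g) = (u g \<oplus>\<^bsub>A\<^esub> v g) \<oplus>\<^bsub>A\<^esub> (w g \<oplus>\<^bsub>A\<^esub> \<ominus>\<^bsub>A\<^esub> w g)"
      using uA[of g] vA[of g] wA[of g] A.a_ac by (simp add: A.a_ac)
    then show "f g = (u g \<oplus>\<^bsub>A\<^esub> \<ominus>\<^bsub>A\<^esub> w g) \<oplus>\<^bsub>A\<^esub> (v g \<oplus>\<^bsub>A\<^esub> w g)"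
      using uA[of g] vA[of g] wA[of g] uv(3)[of g] by (simp add: A.r_neg)
  qed
  also have "\<dots> = (\<lambda>g. res_diff A M q u' g \<oplus>\<^bsub>A\<^esub> res_diff A M q v' g)"
    by (simp only: u'(2)[symmetric] v'(2)[symmetric])
  also have "\<dots> = res_diff A M q (\<lambda>g. u' g \<oplus>\<^bsub>A\<^esub> v' g)"
    by (rule res_diff_add[symmetric, OF coeff_partD(1)[OF u'(1)] coeff_partD(1)[OF v'(1)]])
  finally have "f = res_diff A M q (\<lambda>g. u' g \<oplus>\<^bsub>A\<^esub> v' g)" .
  moreover have "(\<lambda>g. u' g \<oplus>\<^bsub>A\<^esub> v' g) \<in> coeff_part W (Suc q)"
    using res_add_closed[OF coeff_partD(1)[OF u'(1)] coeff_partD(1)[OF v'(1)]]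
      coeff_partD(2)[OF u'(1)] coeff_partD(2)[OF v'(1)] W(1-3)
    unfolding coeff_part_def by blast
  ultimately show "f \<in> res_diff A M q ` coeff_part W (Suc q)" by blast
qed

text \<open>Exactness of \<open>F / U F\<close> in positive degrees, in terms of elements:
  \<open>f\<close> represents a cycle of the quotient. Some \<open>y\<close> over \<open>U\<close>
  has the same boundary as \<open>f\<close>, and the cycle that remains after subtracting
  \<open>y\<close> bounds in \<open>F\<close>.\<close>

lemma acyclic_on_split:
  assumes U: "acyclic_on U"
    and f: "f \<in> carrier (res_module A M (Suc q))" "\<And>g. res_diff A M q f g \<in> U"
  obtains y z where "y \<in> coeff_part U (Suc q)" "z \<in> carrier (res_module A M (Suc (Suc q)))"
    "f = (\<lambda>g. y g \<oplus>\<^bsub>A\<^esub> res_diff A M (Suc q) z g)"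
proof -
  let ?d = "res_diff A M q"
  have "?d f \<in> coeff_part U q" using f res_diff_closed by (auto simp: coeff_part_def)
  then obtain y where y: "y \<in> coeff_part U (Suc q)" "?d f = ?d y"
    using U res_cycle_diff[OF f(1)] by (auto simp: acyclic_on_def)
  note yc = coeff_partD(1)[OF y(1)]
  have c: "(\<lambda>g. \<ominus>\<^bsub>A\<^esub> y g \<oplus>\<^bsub>A\<^esub> f g) \<in> carrier (res_module A M (Suc q))"
    using res_add_closed res_minus_closed yc f(1) by blast
  moreover have "?d (\<lambda>g. \<ominus>\<^bsub>A\<^esub> y g \<oplus>\<^bsub>A\<^esub> f g) = (\<lambda>_. \<zero>\<^bsub>A\<^esub>)"
    using res_diff_add[OF res_minus_closed[OF yc] f(1)] res_diff_minus[OF yc] y(2)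
      res_val[OF res_diff_closed[OF yc]] by (simp add: A.l_neg)
  ultimately have "(\<lambda>g. \<ominus>\<^bsub>A\<^esub> y g \<oplus>\<^bsub>A\<^esub> f g) \<in> res_diff A M (Suc q) ` carrier (res_module A M (Suc (Suc q)))"
    unfolding res_diff_image by (simp add: res_cycle_def)
  then obtain z where z: "z \<in> carrier (res_module A M (Suc (Suc q)))"
    "(\<lambda>g. \<ominus>\<^bsub>A\<^esub> y g \<oplus>\<^bsub>A\<^esub> f g) = res_diff A M (Suc q) z" by blast
  have "f = (\<lambda>g. y g \<oplus>\<^bsub>A\<^esub> (\<ominus>\<^bsub>A\<^esub> y g \<oplus>\<^bsub>A\<^esub> f g))"
    using res_val[OF yc] res_val[OF f(1)] by (simp add: A.r_neg A.a_assoc[symmetric])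
  then show thesis using that[OF y(1) z(1)] z(2) by metis
qed

end

section \<open>Tensor products with the standard resolution\<close>

locale tensor_pair = M: abelian_group M + N: abelian_group N
  for A :: "('a, 'i) ring_scheme" and M :: "('a, 'x, 'j) module_scheme" and N :: "('a, 'y, 'k) module_scheme" +
  assumes M_smult: "\<lbrakk>a \<in> carrier A; x \<in> carrier M\<rbrakk> \<Longrightarrow> a \<odot>\<^bsub>M\<^esub> x \<in> carrier M"
    and N_smult: "\<lbrakk>a \<in> carrier A; y \<in> carrier N\<rbrakk> \<Longrightarrow> a \<odot>\<^bsub>N\<^esub> y \<in> carrier N"
begin

abbreviation "FG \<equiv> free_Abelian_group (carrier M \<times> carrier N)"
abbreviation "TK \<equiv> tensor_kernel A M N"

sublocale FG: comm_group FG by (rule abelian_free_Abelian_group)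

lemma FG_diff: "\<lbrakk>a \<in> carrier FG; b \<in> carrier FG\<rbrakk> \<Longrightarrow> a - b \<in> carrier FG"
  using keys_diff[of a b] by auto

lemma FG_0: "0 \<in> carrier FG"
  by simp

lemma FG_frag_of: "\<lbrakk>x \<in> carrier M; y \<in> carrier N\<rbrakk> \<Longrightarrow> frag_of (x, y) \<in> carrier FG"
  by simp

lemma tensor_relations_subset: "tensor_relations A M N \<subseteq> carrier FG"
  unfolding tensor_relations_def
  by (auto simp del: carrier_free_Abelian_group_iff intro!: FG_diff FG_frag_of M_smult N_smult)

lemma TK_subgroup: "subgroup TK FG"
  unfolding tensor_kernel_def by (rule FG.generate_is_subgroup[OF tensor_relations_subset])

lemma TK_carrier: "c \<in> TK \<Longrightarrow> c \<in> carrier FG"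
  using subgroup.mem_carrier[OF TK_subgroup] .

lemma TK_0: "0 \<in> TK"
  using subgroup.one_closed[OF TK_subgroup] by simp

lemma TK_add: "\<lbrakk>a \<in> TK; b \<in> TK\<rbrakk> \<Longrightarrow> a + b \<in> TK"
  using subgroup.m_closed[OF TK_subgroup] by simp

lemma TK_uminus: "a \<in> TK \<Longrightarrow> - a \<in> TK"
  using subgroup.m_inv_closed[OF TK_subgroup, of a] TK_carrier[of a] by simp

lemma TK_diff: "\<lbrakk>a \<in> TK; b \<in> TK\<rbrakk> \<Longrightarrow> a - b \<in> TK"
  using TK_add[OF _ TK_uminus, of a b] by simp

lemma TK_rel: "c \<in> tensor_relations A M N \<Longrightarrow> c \<in> TK"
  unfolding tensor_kernel_def by (rule generate.incl)

lemma TK_normal: "TK \<lhd> FG"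
  using TK_subgroup FG.subgroup_imp_normal by blast

abbreviation cls where "cls c \<equiv> r_coset FG TK c"

lemma cls_eq: "cls c = {k + c | k. k \<in> TK}"
  by (auto simp: r_coset_def)

lemma cls_eq_iff: "cls c = cls c' \<longleftrightarrow> c - c' \<in> TK"
proof
  assume "cls c = cls c'"
  then have "0 + c \<in> {k + c' | k. k \<in> TK}" using TK_0 by (auto simp: cls_eq)
  then show "c - c' \<in> TK" by auto
next
  assume *: "c - c' \<in> TK"
  have "k + c \<in> cls c'" if "k \<in> TK" for k
    using TK_add[OF that *] by (auto simp: cls_eq intro!: exI[of _ "k + (c - c')"])
  moreover have "k + c' \<in> cls c" if "k \<in> TK" for k
    using TK_diff[OF that *] by (auto simp: cls_eq intro!: exI[of _ "k - (c - c')"])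
  ultimately show "cls c = cls c'" by (auto simp: cls_eq)
qed

lemma cls_TK: "cls 0 = TK"
  by (simp add: cls_eq)

lemma cls_TK_iff: "cls c = TK \<longleftrightarrow> c \<in> TK"
  using cls_eq_iff[of c 0] cls_TK by simp

lemma group_tensor: "group (tensor A M N)"
  unfolding tensor_def by (rule normal.factorgroup_is_group[OF TK_normal])

lemma carrier_tensor: "carrier (tensor A M N) = cls ` carrier FG"
  by (simp add: tensor_def carrier_FactGroup)

lemma one_tensor: "\<one>\<^bsub>tensor A M N\<^esub> = TK"
  by (simp add: tensor_def)

lemma mult_tensor: "\<lbrakk>c \<in> carrier FG; c' \<in> carrier FG\<rbrakk> \<Longrightarrow> cls c \<otimes>\<^bsub>tensor A M N\<^esub> cls c' = cls (c + c')"
  using normal.rcos_sum[OF TK_normal, of c c'] by (simp add: tensor_def)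

lemma TK_add_left:
  "\<lbrakk>x \<in> carrier M; x' \<in> carrier M; y \<in> carrier N\<rbrakk>
    \<Longrightarrow> frag_of (x \<oplus>\<^bsub>M\<^esub> x', y) - frag_of (x, y) - frag_of (x', y) \<in> TK"
  by (rule TK_rel) (unfold tensor_relations_def, blast)

lemma TK_add_right:
  "\<lbrakk>x \<in> carrier M; y \<in> carrier N; y' \<in> carrier N\<rbrakk>
    \<Longrightarrow> frag_of (x, y \<oplus>\<^bsub>N\<^esub> y') - frag_of (x, y) - frag_of (x, y') \<in> TK"
  by (rule TK_rel) (unfold tensor_relations_def, blast)

lemma TK_smult:
  "\<lbrakk>a \<in> carrier A; x \<in> carrier M; y \<in> carrier N\<rbrakk>
    \<Longrightarrow> frag_of (a \<odot>\<^bsub>M\<^esub> x, y) - frag_of (x, a \<odot>\<^bsub>N\<^esub> y) \<in> TK"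
  by (rule TK_rel) (unfold tensor_relations_def, blast)

lemma TK_zero_left:
  assumes "y \<in> carrier N" shows "frag_of (\<zero>\<^bsub>M\<^esub>, y) \<in> TK"
  using TK_uminus[OF TK_add_left[of "\<zero>\<^bsub>M\<^esub>" "\<zero>\<^bsub>M\<^esub>" y]] assms by simp

lemma TK_zero_right:
  assumes "x \<in> carrier M" shows "frag_of (x, \<zero>\<^bsub>N\<^esub>) \<in> TK"
  using TK_uminus[OF TK_add_right[of x "\<zero>\<^bsub>N\<^esub>" "\<zero>\<^bsub>N\<^esub>"]] assms by simp

text \<open>The universal property of the tensor product: the kernel of \<open>h\<close> is a
  subgroup that contains the defining relations. It yields induced maps (\<open>ext_TK\<close>) and,
  through functionals, shows that a tensor is not zero (\<open>aug_zero_of_TK\<close>).\<close>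

lemma TK_subset_ker:
  assumes h: "h \<in> hom FG (G :: ('z, 'w) monoid_scheme)" and G: "group G"
    and rel: "\<And>c. c \<in> tensor_relations A M N \<Longrightarrow> h c = \<one>\<^bsub>G\<^esub>"
    and c: "c \<in> TK"
  shows "h c = \<one>\<^bsub>G\<^esub>"
proof -
  interpret h: group_hom FG G h
    using h G FG.group_axioms by (simp add: group_hom_def group_hom_axioms_def)
  have "subgroup (kernel FG G h) FG" by (rule h.subgroup_kernel)
  moreover have "tensor_relations A M N \<subseteq> kernel FG G h"
    using rel tensor_relations_subset by (auto simp: kernel_def simp del: carrier_free_Abelian_group_iff)
  ultimately have "TK \<subseteq> kernel FG G h"
    unfolding tensor_kernel_def by (rule FG.generate_subgroup_incl[rotated])
  then show ?thesis using c by (auto simp: kernel_def)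
qed

end

locale tensor_pair_map = dom: tensor_pair A M N + cod: tensor_pair A M N'
  for A :: "('a, 'i) ring_scheme" and M :: "('a, 'x, 'j) module_scheme"
    and N :: "('a, 'y, 'k) module_scheme" and N' :: "('a, 'z, 'l) module_scheme" +
  fixes h assumes h: "left_module_hom A N N' h"
begin

abbreviation "ext \<equiv> frag_extend (\<lambda>(x, y). frag_of (x, h y))"

lemma ext_closed: "c \<in> carrier dom.FG \<Longrightarrow> ext c \<in> carrier cod.FG"
proof -
  assume "c \<in> carrier dom.FG"
  then have "Poly_Mapping.keys c \<subseteq> carrier M \<times> carrier N" by simp
  then show "ext c \<in> carrier cod.FG"
    using h by (induction c rule: frag_induction)
      (auto simp: frag_extend_diff left_module_hom_def simp del: carrier_free_Abelian_group_iff
        intro!: cod.FG_diff cod.FG_frag_of cod.FG_0)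
qed

lemma ext_TK: assumes "c \<in> dom.TK" shows "ext c \<in> cod.TK"
proof -
  have "(\<lambda>c. cod.cls (ext c)) c = \<one>\<^bsub>tensor A M N'\<^esub>"
  proof (rule dom.TK_subset_ker[OF _ cod.group_tensor _ assms])
    show "(\<lambda>c. cod.cls (ext c)) \<in> hom dom.FG (tensor A M N')"
      using ext_closed
      by (auto simp: hom_def cod.carrier_tensor cod.mult_tensor frag_extend_add
          simp del: carrier_free_Abelian_group_iff)
    have hN: "\<And>y. y \<in> carrier N \<Longrightarrow> h y \<in> carrier N'"
      and ha: "\<And>y y'. \<lbrakk>y \<in> carrier N; y' \<in> carrier N\<rbrakk> \<Longrightarrow> h (y \<oplus>\<^bsub>N\<^esub> y') = h y \<oplus>\<^bsub>N'\<^esub> h y'"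
      and hs: "\<And>a y. \<lbrakk>a \<in> carrier A; y \<in> carrier N\<rbrakk> \<Longrightarrow> h (a \<odot>\<^bsub>N\<^esub> y) = a \<odot>\<^bsub>N'\<^esub> h y"
      using h by (auto simp: left_module_hom_def)
    show "cod.cls (ext c) = \<one>\<^bsub>tensor A M N'\<^esub>" if "c \<in> tensor_relations A M N" for c
      unfolding cod.one_tensor cod.cls_TK_iff
      using that unfolding tensor_relations_def
      by (auto simp: frag_extend_diff ha hs hN intro!: cod.TK_add_left cod.TK_add_right cod.TK_smult)
  qed
  then show ?thesis by (simp add: cod.one_tensor cod.cls_TK_iff)
qed

text \<open>The \<open>the_elem\<close> in \<open>tensor_map\<close> is meaningful because, by
  \<open>ext_TK\<close>, all representatives of a coset have images in one coset.\<close>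

lemma tensor_map_cls: "tensor_map A M N' h (dom.cls c) = cod.cls (ext c)"
proof -
  have "cod.cls (ext (k + c)) = cod.cls (ext c)" if "k \<in> dom.TK" for k
    using ext_TK[OF that] by (simp add: cod.cls_eq_iff frag_extend_add)
  then have "cod.cls (ext x) = cod.cls (ext c)" if "x \<in> dom.cls c" for x
    using that unfolding dom.cls_eq by blast
  moreover have "c \<in> dom.cls c"
    unfolding dom.cls_eq using dom.TK_0 by (auto intro!: exI[of _ 0])
  ultimately have "(\<lambda>c. cod.cls (ext c)) ` dom.cls c = {cod.cls (ext c)}" by blast
  then show ?thesis by (simp add: tensor_map_def)
qed

lemma tensor_map_hom: "tensor_map A M N' h \<in> hom (tensor A M N) (tensor A M N')"
  unfolding hom_def
  by (auto simp: dom.carrier_tensor cod.carrier_tensor tensor_map_cls dom.mult_tensor cod.mult_tensor ext_closed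
      frag_extend_add simp del: carrier_free_Abelian_group_iff)

end

lemma (in group) trivial_factor_group_self: "trivial_group (G Mod carrier G)"
proof -
  have "carrier G \<lhd> G" by (auto simp: normal_inv_iff subgroup_self)
  then have "group (G Mod carrier G)" by (rule normal.factorgroup_is_group)
  moreover have "carrier (G Mod carrier G) = {carrier G}"
    using coset_join2[OF _ subgroup_self] one_closed by (auto simp: carrier_FactGroup)
  ultimately show ?thesis by (simp add: trivial_group_def)
qed

section \<open>The trivial module tensored with the resolution\<close>

locale augmented_ring = left_module A T + R: cring R
  for A :: "('a, 'i) ring_scheme" and T :: "('a, 'b, 'j) module_scheme" and R :: "('b, 's) ring_scheme" +
  fixes \<epsilon> :: "'a \<Rightarrow> 'b"
  assumes aug_hom: "\<epsilon> \<in> ring_hom A R" and aug_surj: "\<epsilon> ` carrier A = carrier R"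
    and T_carrier: "carrier T = carrier R" and T_zero: "\<zero>\<^bsub>T\<^esub> = \<zero>\<^bsub>R\<^esub>"
    and T_add: "\<And>x y. x \<oplus>\<^bsub>T\<^esub> y = x \<oplus>\<^bsub>R\<^esub> y" and T_smult: "\<And>a x. a \<odot>\<^bsub>T\<^esub> x = \<epsilon> a \<otimes>\<^bsub>R\<^esub> x"
begin

abbreviation "F \<equiv> res_module A T"
abbreviation "aug_ideal \<equiv> {a \<in> carrier A. \<epsilon> a = \<zero>\<^bsub>R\<^esub>}"

lemma tensor_pair: "tensor_pair A T (F q)"
proof -
  interpret F: left_module A "F q" by (rule res_module_left_module)
  show ?thesis by unfold_locales (auto simp: smult_closed intro!: F.smult_closed simp del: res_smult)
qed

sublocale tp: tensor_pair A T "F q" for q by (rule tensor_pair)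

lemma tensor_pair_map: "tensor_pair_map A T (F (Suc q)) (F q) (res_diff A T q)"
  using tensor_pair standard_resolution(3) by (simp add: tensor_pair_map_def tensor_pair_map_axioms_def)

sublocale tm: tensor_pair_map A T "F (Suc q)" "F q" "res_diff A T q" for q by (rule tensor_pair_map)

lemma aug_add: "\<lbrakk>a \<in> carrier A; b \<in> carrier A\<rbrakk> \<Longrightarrow> \<epsilon> (a \<oplus>\<^bsub>A\<^esub> b) = \<epsilon> a \<oplus>\<^bsub>R\<^esub> \<epsilon> b"
  and aug_mult: "\<lbrakk>a \<in> carrier A; b \<in> carrier A\<rbrakk> \<Longrightarrow> \<epsilon> (a \<otimes>\<^bsub>A\<^esub> b) = \<epsilon> a \<otimes>\<^bsub>R\<^esub> \<epsilon> b"
  and aug_closed: "a \<in> carrier A \<Longrightarrow> \<epsilon> a \<in> carrier R"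
  using ring_hom_add[OF aug_hom] ring_hom_mult[OF aug_hom]
    ring_hom_closed[OF aug_hom] by auto

text \<open>A representative of \<open>1 \<otimes> f\<close>. Every class has this form
  (\<open>tensor_representative\<close>), and it is zero exactly when all coefficients of
  \<open>f\<close> lie in \<open>aug_ideal\<close> (\<open>aug_zero_of_TK\<close>,
  \<open>TK_of_aug_zero\<close>): together this is the isomorphism of \<open>T \<otimes> F\<close>
  with \<open>F / I F\<close>.\<close>

abbreviation one_tensor ("\<eta>") where "\<eta> f \<equiv> frag_of (\<one>\<^bsub>R\<^esub>, f)"

lemma one_T: "\<one>\<^bsub>R\<^esub> \<in> carrier T" by (simp add: T_carrier)

lemma TK_eta_add:
  assumes "f \<in> carrier (F q)" "h \<in> carrier (F q)"
  shows "\<eta> (\<lambda>g. f g \<oplus>\<^bsub>A\<^esub> h g) - \<eta> f - \<eta> h \<in> tp.TK q"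
  using tp.TK_add_right[OF one_T assms] by simp

text \<open>A generator \<open>r \<otimes> f\<close> equals \<open>1 \<otimes> a f\<close> for any
  \<open>a\<close> with \<open>\<epsilon> a = r\<close>, and tensors with first factor 1 are closed
  under differences.\<close>

lemma tensor_representative:
  assumes "c \<in> carrier (tp.FG q)"
  shows "\<exists>f\<in>carrier (F q). c - \<eta> f \<in> tp.TK q"
proof -
  have "Poly_Mapping.keys c \<subseteq> carrier T \<times> carrier (F q)" using assms by simp
  then show ?thesis
  proof (induction c rule: frag_induction)
    case zero
    show ?case
      using tp.TK_uminus[OF tp.TK_zero_right[OF one_T, of q]]
      by (intro bexI[of _ "\<zero>\<^bsub>F q\<^esub>"]) (auto intro: tp.N.zero_closed)
  next
    case (one p)
    then obtain r f where p: "p = (r, f)" "r \<in> carrier R" "f \<in> carrier (F q)" by (auto simp: T_carrier)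
    obtain a where a: "a \<in> carrier A" "\<epsilon> a = r" using aug_surj p(2) by (metis imageE)
    have "frag_of (a \<odot>\<^bsub>T\<^esub> \<one>\<^bsub>R\<^esub>, f) - \<eta> (a \<odot>\<^bsub>F q\<^esub> f) \<in> tp.TK q"
      by (rule tp.TK_smult[OF a(1) one_T p(3)])
    then show ?case
      using p a tp.N_smult[OF a(1) p(3)] by (auto simp: T_smult)
  next
    case (diff a b)
    then obtain f h where f: "f \<in> carrier (F q)" "a - \<eta> f \<in> tp.TK q"
      and h: "h \<in> carrier (F q)" "b - \<eta> h \<in> tp.TK q" by blast
    let ?k = "\<lambda>g. f g \<oplus>\<^bsub>A\<^esub> \<ominus>\<^bsub>A\<^esub> h g"
    have k: "?k \<in> carrier (F q)" using f h res_add_closed res_minus_closed by blast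
    have "(\<lambda>g. ?k g \<oplus>\<^bsub>A\<^esub> h g) = f"
      using res_val[OF f(1)] res_val[OF h(1)] by (simp add: A.a_assoc A.l_neg)
    then have "\<eta> f - \<eta> ?k - \<eta> h \<in> tp.TK q" using TK_eta_add[OF k h(1)] by (simp only:)
    then have "(a - \<eta> f) - (b - \<eta> h) + (\<eta> f - \<eta> ?k - \<eta> h) \<in> tp.TK q"
      using tp.TK_add tp.TK_diff f(2) h(2) by blast
    then have "a - b - \<eta> ?k \<in> tp.TK q" by simp
    then show ?case using k by (rule bexI[where x = ?k])
  qed
qed

lemma aug_zero_of_TK:
  assumes f: "f \<in> carrier (F q)" and TK: "\<eta> f \<in> tp.TK q"
  shows "\<epsilon> (f g) = \<zero>\<^bsub>R\<^esub>"
proof -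
  have G: "group (add_monoid R)" by (rule R.a_group)
  let ?S = "carrier T \<times> carrier (F q)"
  have "(\<lambda>(r, f). r \<otimes>\<^bsub>R\<^esub> \<epsilon> (f g)) ` ?S \<subseteq> carrier (add_monoid R)"
    using res_val aug_closed by (auto simp: T_carrier)
  then obtain h where h: "h \<in> hom (tp.FG q) (add_monoid R)"
    "\<And>x. x \<in> ?S \<Longrightarrow> h (frag_of x) = (\<lambda>(r, f). r \<otimes>\<^bsub>R\<^esub> \<epsilon> (f g)) x"
    using comm_group.free_Abelian_group_universal[OF R.a_comm_group] by blast
  interpret h: group_hom "tp.FG q" "add_monoid R" h
    using h(1) tp.FG.group_axioms[of q] G by (simp add: group_hom_def group_hom_axioms_def)
  have hd: "h (c - c') = h c \<ominus>\<^bsub>R\<^esub> h c'" if "c \<in> carrier (tp.FG q)" "c' \<in> carrier (tp.FG q)" for c c'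
    using h.hom_mult[OF that(1) tp.FG.inv_closed[OF that(2)]] h.hom_inv[OF that(2)] that
    by (simp add: a_minus_def a_inv_def)
  have hd3: "h (b - c - d) = h b \<ominus>\<^bsub>R\<^esub> h c \<ominus>\<^bsub>R\<^esub> h d"
    if "b \<in> carrier (tp.FG q)" "c \<in> carrier (tp.FG q)" "d \<in> carrier (tp.FG q)" for b c d
    using hd[OF tp.FG_diff[OF that(1,2)] that(3)] hd[OF that(1,2)] by simp
  have hv: "h (frag_of (r, f)) = r \<otimes>\<^bsub>R\<^esub> \<epsilon> (f g)" if "r \<in> carrier R" "f \<in> carrier (F q)" for r f
    using h(2) that by (simp add: T_carrier)
  have "h (\<eta> f) = \<one>\<^bsub>add_monoid R\<^esub>"
  proof (rule tp.TK_subset_ker[OF h(1) G _ TK])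
    fix c assume c: "c \<in> tensor_relations A T (F q)"
    then show "h c = \<one>\<^bsub>add_monoid R\<^esub>"
      unfolding tensor_relations_def
    proof (elim UnE CollectE exE conjE)
      fix x x' y assume "c = frag_of (x \<oplus>\<^bsub>T\<^esub> x', y) - frag_of (x, y) - frag_of (x', y)"
        and xy: "x \<in> carrier T" "x' \<in> carrier T" "y \<in> carrier (F q)"
      moreover have "\<epsilon> (y g) \<in> carrier R" using xy res_val aug_closed by blast
      moreover have "(x \<oplus>\<^bsub>R\<^esub> x') \<otimes>\<^bsub>R\<^esub> e \<ominus>\<^bsub>R\<^esub> x \<otimes>\<^bsub>R\<^esub> e \<ominus>\<^bsub>R\<^esub> x' \<otimes>\<^bsub>R\<^esub> e = \<zero>\<^bsub>R\<^esub>" if "e \<in> carrier R" for e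
        using xy that unfolding T_carrier by algebra
      ultimately show ?thesis
        by (simp add: hd3 hv T_carrier T_add del: carrier_free_Abelian_group_iff)
    next
      fix x y y' assume "c = frag_of (x, y \<oplus>\<^bsub>F q\<^esub> y') - frag_of (x, y) - frag_of (x, y')"
        and xy: "x \<in> carrier T" "y \<in> carrier (F q)" "y' \<in> carrier (F q)"
      moreover have "\<epsilon> (y g) \<in> carrier R" "\<epsilon> (y' g) \<in> carrier R" "\<epsilon> (y g \<oplus>\<^bsub>A\<^esub> y' g) = \<epsilon> (y g) \<oplus>\<^bsub>R\<^esub> \<epsilon> (y' g)"
        using xy res_val aug_closed aug_add by blast+
      moreover have "x \<otimes>\<^bsub>R\<^esub> (e \<oplus>\<^bsub>R\<^esub> e') \<ominus>\<^bsub>R\<^esub> x \<otimes>\<^bsub>R\<^esub> e \<ominus>\<^bsub>R\<^esub> x \<otimes>\<^bsub>R\<^esub> e' = \<zero>\<^bsub>R\<^esub>"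
        if "e \<in> carrier R" "e' \<in> carrier R" for e e'
        using xy that unfolding T_carrier by algebra
      ultimately show ?thesis
        by (simp add: hd3 hv res_add_closed T_carrier del: carrier_free_Abelian_group_iff)
    next
      fix a x y assume "c = frag_of (a \<odot>\<^bsub>T\<^esub> x, y) - frag_of (x, a \<odot>\<^bsub>F q\<^esub> y)"
        and xy: "a \<in> carrier A" "x \<in> carrier T" "y \<in> carrier (F q)"
      moreover have "\<epsilon> (y g) \<in> carrier R" "\<epsilon> (a \<otimes>\<^bsub>A\<^esub> y g) = \<epsilon> a \<otimes>\<^bsub>R\<^esub> \<epsilon> (y g)"
        using xy res_val aug_closed aug_mult by blast+
      moreover have "(\<epsilon> a \<otimes>\<^bsub>R\<^esub> x) \<otimes>\<^bsub>R\<^esub> e \<ominus>\<^bsub>R\<^esub> x \<otimes>\<^bsub>R\<^esub> (\<epsilon> a \<otimes>\<^bsub>R\<^esub> e) = \<zero>\<^bsub>R\<^esub>" if "e \<in> carrier R" for e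
      proof -
        have "x \<in> carrier R" "\<epsilon> a \<in> carrier R" using xy aug_closed by (auto simp: T_carrier)
        with that show ?thesis by algebra
      qed
      ultimately show ?thesis
        by (simp add: hd hv res_smult_closed T_carrier T_smult aug_closed del: carrier_free_Abelian_group_iff)
    qed
  qed
  then show ?thesis using hv[OF R.one_closed f] aug_closed[OF res_val[OF f]] by simp
qed

text \<open>Split \<open>f\<close> into its finitely many terms \<open>f g\<close> times the
  generator \<open>g\<close>; moving the coefficient to the left factor turns each of them into
  \<open>\<epsilon> (f g) \<otimes> g\<close>, which is zero.\<close>

lemma TK_of_aug_zero:
  assumes f: "f \<in> carrier (F q)" and z: "\<And>g. \<epsilon> (f g) = \<zero>\<^bsub>R\<^esub>"
  shows "\<eta> f \<in> tp.TK q"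
proof -
  have fin: "finite {g. f g \<noteq> \<zero>\<^bsub>A\<^esub>}" and sub: "{g. f g \<noteq> \<zero>\<^bsub>A\<^esub>} \<subseteq> res_gens A T q"
    using f by (auto simp: res_module_def)
  have fA: "\<And>g. f g \<in> carrier A" using res_val f by blast
  have single: "\<eta> (\<lambda>g'. if g' = g then f g else \<zero>\<^bsub>A\<^esub>) \<in> tp.TK q" if "g \<in> res_gens A T q" for g
  proof -
    let ?b = "\<lambda>g'. if g' = g then \<one>\<^bsub>A\<^esub> else \<zero>\<^bsub>A\<^esub>"
    have b: "?b \<in> carrier (F q)" using that by (auto simp: res_module_def intro: finite_subset[of _ "{g}"])
    have eq: "f g \<odot>\<^bsub>F q\<^esub> ?b = (\<lambda>g'. if g' = g then f g else \<zero>\<^bsub>A\<^esub>)" using fA by auto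
    have "f g \<odot>\<^bsub>T\<^esub> \<one>\<^bsub>R\<^esub> = \<zero>\<^bsub>T\<^esub>" by (simp add: T_smult z T_zero)
    then have "frag_of (\<zero>\<^bsub>T\<^esub>, ?b) - \<eta> (\<lambda>g'. if g' = g then f g else \<zero>\<^bsub>A\<^esub>) \<in> tp.TK q"
      using tp.TK_smult[OF fA one_T b, of g] eq by simp
    from tp.TK_diff[OF tp.TK_zero_left[OF b] this] show ?thesis by simp
  qed
  have part: "(\<lambda>g. if g \<in> S then f g else \<zero>\<^bsub>A\<^esub>) \<in> carrier (F q)" if "finite S" "S \<subseteq> res_gens A T q" for S
    using that fA by (auto simp: res_module_def intro: finite_subset[of _ S])
  have all: "\<eta> (\<lambda>g. if g \<in> S then f g else \<zero>\<^bsub>A\<^esub>) \<in> tp.TK q" if "finite S" "S \<subseteq> res_gens A T q" for S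
    using that
  proof (induction S rule: finite_induct)
    case empty
    have "\<zero>\<^bsub>F q\<^esub> = (\<lambda>_. \<zero>\<^bsub>A\<^esub>)" by (simp add: res_module_def)
    then show ?case using tp.TK_zero_right[OF one_T, of q] by simp
  next
    case (insert s S)
    let ?h = "\<lambda>g. if g \<in> S then f g else \<zero>\<^bsub>A\<^esub>" and ?k = "\<lambda>g. if g = s then f s else \<zero>\<^bsub>A\<^esub>"
    have k: "?k \<in> carrier (F q)" using part[of "{s}"] insert.prems by (simp cong: if_cong)
    have eq: "(\<lambda>g. if g \<in> insert s S then f g else \<zero>\<^bsub>A\<^esub>) = (\<lambda>g. ?k g \<oplus>\<^bsub>A\<^esub> ?h g)"
      using insert.hyps fA by (intro ext) simp
    have "\<eta> (\<lambda>g. ?k g \<oplus>\<^bsub>A\<^esub> ?h g) - \<eta> ?k - \<eta> ?h \<in> tp.TK q"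
      using TK_eta_add[OF k part[OF insert.hyps(1)]] insert.prems by simp
    moreover have "\<eta> ?k \<in> tp.TK q" "\<eta> ?h \<in> tp.TK q" using single insert by auto
    ultimately have "\<eta> (\<lambda>g. ?k g \<oplus>\<^bsub>A\<^esub> ?h g) - \<eta> ?k - \<eta> ?h + \<eta> ?h + \<eta> ?k \<in> tp.TK q"
      using tp.TK_add by blast
    then show ?case unfolding eq by simp
  qed
  have "(\<lambda>g. if g \<in> {g. f g \<noteq> \<zero>\<^bsub>A\<^esub>} then f g else \<zero>\<^bsub>A\<^esub>) = f" by auto
  then show ?thesis using all[OF fin sub] by (simp only:)
qed

lemma tensor_map_eta:
  assumes "f \<in> carrier (F (Suc q))"
  shows "tensor_map A T (F q) (res_diff A T q) (tp.cls (Suc q) (\<eta> f)) = tp.cls q (\<eta> (res_diff A T q f))"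
  by (simp add: tm.tensor_map_cls)

text \<open>A cycle of degree \<open>Suc p\<close> is the class of some \<open>1 \<otimes> f\<close>
  where the boundary of \<open>f\<close> has coefficients in \<open>aug_ideal\<close>. By
  \<open>acyclic_on_split\<close>, \<open>f\<close> is a boundary up to a summand over
  \<open>aug_ideal\<close>, and that summand dies in the tensor product.\<close>

theorem Tor_trivial:
  assumes acyc: "acyclic_on aug_ideal" and "q > 0"
  shows "trivial_group (Tor A T T q)"
proof -
  obtain p where q: "q = Suc p" using \<open>q > 0\<close> gr0_implies_Suc by blast
  let ?C = "\<lambda>q. tensor A T (F q)" and ?d = "\<lambda>q. tensor_map A T (F q) (res_diff A T q)"
  let ?K = "(?C (Suc p))\<lparr>carrier := kernel (?C (Suc p)) (?C p) (?d p)\<rparr>"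
  interpret hom: group_hom "?C (Suc p)" "?C p" "?d p"
    using tp.group_tensor tm.tensor_map_hom by (simp add: group_hom_def group_hom_axioms_def)
  interpret hom': group_hom "?C (Suc (Suc p))" "?C (Suc p)" "?d (Suc p)"
    using tp.group_tensor tm.tensor_map_hom by (simp add: group_hom_def group_hom_axioms_def)
  interpret K: group ?K by (rule hom.subgroup_kernel[THEN subgroup.subgroup_is_group]) (rule tp.group_tensor)
  have "?d (Suc p) ` carrier (?C (Suc (Suc p))) = carrier ?K"
  proof
    show "?d (Suc p) ` carrier (?C (Suc (Suc p))) \<subseteq> carrier ?K"
    proof
      fix k assume "k \<in> ?d (Suc p) ` carrier (?C (Suc (Suc p)))"
      then obtain c where c: "c \<in> carrier (tp.FG (Suc (Suc p)))" "k = ?d (Suc p) (tp.cls (Suc (Suc p)) c)"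
        by (auto simp: tp.carrier_tensor simp del: carrier_free_Abelian_group_iff)
      obtain f where f: "f \<in> carrier (F (Suc (Suc p)))" "tp.cls (Suc (Suc p)) c = tp.cls (Suc (Suc p)) (\<eta> f)"
        using tensor_representative[OF c(1)] by (auto simp: tp.cls_eq_iff)
      have k: "k = tp.cls (Suc p) (\<eta> (res_diff A T (Suc p) f))" using c f tensor_map_eta by simp
      have df: "res_diff A T (Suc p) f \<in> carrier (F (Suc p))" by (rule res_diff_closed[OF f(1)])
      have "?d p k = tp.cls p (\<eta> (res_diff A T p (res_diff A T (Suc p) f)))"
        using k tensor_map_eta[OF df] by simp
      moreover have "res_diff A T p (res_diff A T (Suc p) f) = \<zero>\<^bsub>F p\<^esub>"
        using res_cycle_diff[OF f(1)] by (simp add: res_cycle_def res_module_def)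
      ultimately have "?d p k = \<one>\<^bsub>?C p\<^esub>"
        using tp.TK_zero_right[OF one_T, of p] by (simp add: tp.one_tensor tp.cls_TK_iff)
      moreover have "k \<in> carrier (?C (Suc p))"
        unfolding k tp.carrier_tensor using df one_T by (intro imageI) simp
      ultimately show "k \<in> carrier ?K" by (simp add: kernel_def)
    qed
    show "carrier ?K \<subseteq> ?d (Suc p) ` carrier (?C (Suc (Suc p)))"
    proof
      fix k assume "k \<in> carrier ?K"
      then have k: "k \<in> carrier (?C (Suc p))" "?d p k = tp.TK p" by (auto simp: kernel_def tp.one_tensor)
      then obtain c where c: "c \<in> carrier (tp.FG (Suc p))" "k = tp.cls (Suc p) c"
        by (auto simp: tp.carrier_tensor simp del: carrier_free_Abelian_group_iff)
      obtain f where f: "f \<in> carrier (F (Suc p))" "tp.cls (Suc p) c = tp.cls (Suc p) (\<eta> f)"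
        using tensor_representative[OF c(1)] by (auto simp: tp.cls_eq_iff)
      have df: "res_diff A T p f \<in> carrier (F p)" by (rule res_diff_closed[OF f(1)])
      have "\<eta> (res_diff A T p f) \<in> tp.TK p"
        using k(2) c(2) f tensor_map_eta[OF f(1)] by (simp add: tp.cls_TK_iff)
      then have "\<And>g. res_diff A T p f g \<in> aug_ideal"
        using aug_zero_of_TK[OF df] res_val[OF df] by blast
      then obtain y z where y: "y \<in> coeff_part aug_ideal (Suc p)"
        and z: "z \<in> carrier (F (Suc (Suc p)))" and fyz: "f = (\<lambda>g. y g \<oplus>\<^bsub>A\<^esub> res_diff A T (Suc p) z g)"
        by (rule acyclic_on_split[OF acyc f(1)])
      have dz: "res_diff A T (Suc p) z \<in> carrier (F (Suc p))" by (rule res_diff_closed[OF z])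
      have "\<eta> y \<in> tp.TK (Suc p)"
        using TK_of_aug_zero[OF coeff_partD(1)[OF y]] coeff_partD(2)[OF y] by blast
      moreover have "\<eta> f - \<eta> y - \<eta> (res_diff A T (Suc p) z) \<in> tp.TK (Suc p)"
        unfolding fyz by (rule TK_eta_add[OF coeff_partD(1)[OF y] dz])
      ultimately have "\<eta> f - \<eta> y - \<eta> (res_diff A T (Suc p) z) + \<eta> y \<in> tp.TK (Suc p)"
        using tp.TK_add by blast
      then have "tp.cls (Suc p) (\<eta> f) = tp.cls (Suc p) (\<eta> (res_diff A T (Suc p) z))"
        by (simp add: tp.cls_eq_iff)
      then have "k = ?d (Suc p) (tp.cls (Suc (Suc p)) (\<eta> z))"
        using c(2) f(2) tensor_map_eta[OF z] by simp
      moreover have "tp.cls (Suc (Suc p)) (\<eta> z) \<in> carrier (?C (Suc (Suc p)))"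
        unfolding tp.carrier_tensor using z one_T by (intro imageI) simp
      ultimately show "k \<in> ?d (Suc p) ` carrier (?C (Suc (Suc p)))" by blast
    qed
  qed
  then have "Tor A T T q = ?K Mod carrier ?K" by (simp add: Tor_def q)
  then show ?thesis using K.trivial_factor_group_self by simp
qed

end

section \<open>Brauer diagrams\<close>

lemma in_nodes [simp]: "Lft i \<in> nodes n \<longleftrightarrow> i < n" "Rgt i \<in> nodes n \<longleftrightarrow> i < n"
  by (auto simp: nodes_def)

lemma finite_nodes [simp]: "finite (nodes n)"
  by (simp add: nodes_def)

lemma finite_Brauer: "finite (Brauer n)"
  by (rule finite_subset[of _ "Pow (Pow (nodes n))"]) (auto simp: Brauer_def)

lemma Brauer_edgeE:
  assumes "x \<in> Brauer n" "e \<in> x"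
  obtains u v where "e = {u, v}" "u \<noteq> v" "u \<in> nodes n" "v \<in> nodes n"
  using assms by (auto simp: Brauer_def card_2_iff)

lemma Brauer_edgeD:
  assumes "x \<in> Brauer n" "{u, v} \<in> x"
  shows "u \<noteq> v" "u \<in> nodes n" "v \<in> nodes n"
  using Brauer_edgeE[OF assms] by (metis doubleton_eq_iff)+

lemma Brauer_edge_unique: "\<lbrakk>x \<in> Brauer n; e \<in> x; e' \<in> x; v \<in> e; v \<in> e'\<rbrakk> \<Longrightarrow> e = e'"
  unfolding Brauer_def by blast

lemma Brauer_partner_unique:
  assumes "x \<in> Brauer n" "{u, v} \<in> x" "{u, w} \<in> x"
  shows "v = w"
  using Brauer_edge_unique[OF assms, of u] by (auto simp: doubleton_eq_iff)

lemma Brauer_partner: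
  assumes "x \<in> Brauer n" "u \<in> nodes n"
  obtains v where "{u, v} \<in> x" "v \<noteq> u" "v \<in> nodes n"
proof -
  obtain e where "e \<in> x" "u \<in> e" using assms by (auto simp: Brauer_def)
  then show thesis using Brauer_edgeE[OF assms(1) \<open>e \<in> x\<close>] that by (metis insertE insert_commute singletonD)
qed

text \<open>The edges of \<open>x\<close> already cover every node, so \<open>y\<close> has no room
  for another one. Hence a product is identified as soon as one inclusion of edge sets is
  known.\<close>

lemma Brauer_subset_eq:
  assumes "x \<in> Brauer n" "y \<in> Brauer n" "x \<subseteq> y"
  shows "x = y"
proof
  show "y \<subseteq> x"
  proof
    fix e assume e: "e \<in> y"
    then obtain u v where uv: "e = {u, v}" "u \<in> nodes n" using Brauer_edgeE[OF assms(2)] by metis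
    then obtain w where "{u, w} \<in> x" using Brauer_partner[OF assms(1)] by metis
    then show "e \<in> x" using Brauer_partner_unique[OF assms(2)] uv e assms(3) by blast
  qed
qed (rule assms(3))

section \<open>Closed sets and components\<close>

definition edge_closed :: "diagram \<Rightarrow> node set \<Rightarrow> bool" where
  "edge_closed x P \<longleftrightarrow> (\<forall>u v. {u, v} \<in> x \<longrightarrow> u \<in> P \<longrightarrow> v \<in> P)"

text \<open>The edges inside \<open>P\<close> partition it into pairs. Both the count of outer nodes
  in a component and the parity argument for planarity rest on this.\<close>

lemma card_edge_closed:
  assumes x: "x \<in> Brauer n" and P: "P \<subseteq> nodes n" "edge_closed x P"
  shows "card P = 2 * card {e \<in> x. e \<subseteq> P}"
proof -
  have fin: "finite P" by (rule finite_subset[OF P(1) finite_nodes])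
  have U: "\<Union>{e \<in> x. e \<subseteq> P} = P"
  proof
    show "P \<subseteq> \<Union>{e \<in> x. e \<subseteq> P}"
    proof
      fix u assume u: "u \<in> P"
      then obtain v where "{u, v} \<in> x" using Brauer_partner[OF x] P(1) by blast
      then show "u \<in> \<Union>{e \<in> x. e \<subseteq> P}" using P(2) u by (force simp: edge_closed_def)
    qed
  qed auto
  have "2 * card {e \<in> x. e \<subseteq> P} = card (\<Union>{e \<in> x. e \<subseteq> P})"
  proof (rule card_partition)
    show "finite {e \<in> x. e \<subseteq> P}" using fin by (auto intro: finite_subset[of _ "Pow P"])
    show "finite (\<Union>{e \<in> x. e \<subseteq> P})" unfolding U by (rule fin)
    show "card c = 2" if "c \<in> {e \<in> x. e \<subseteq> P}" for c using that x by (auto simp: Brauer_def)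
    show "c \<inter> c' = {}" if "c \<in> {e \<in> x. e \<subseteq> P}" "c' \<in> {e \<in> x. e \<subseteq> P}" "c \<noteq> c'" for c c'
      using Brauer_edge_unique[OF x] that by blast
  qed
  then show ?thesis unfolding U by simp
qed

text \<open>A connected graph on \<open>k\<close> vertices has at least \<open>k - 1\<close> edges (parallel edges are distinguished by
  their tags): send each vertex other than the root to an edge towards a vertex that is closer to the root.\<close>

lemma card_component_le:
  fixes ends :: "'t \<Rightarrow> 'v set"
  assumes "finite T"
  defines "E \<equiv> {(a, b). \<exists>t\<in>T. ends t = {a, b}}"
  shows "card (E\<^sup>* `` {r}) \<le> Suc (card {t \<in> T. ends t \<subseteq> E\<^sup>* `` {r}})"
proof -
  let ?P = "E\<^sup>* `` {r}"
  define dist where "dist w = (LEAST k. (r, w) \<in> E ^^ k)" for w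
  have parent: "\<exists>t w'. t \<in> T \<and> ends t = {w', w} \<and> w' \<in> ?P \<and> dist w' < dist w" if w: "w \<in> ?P - {r}" for w
  proof -
    have "\<exists>k. (r, w) \<in> E ^^ k" using w by (auto simp: rtrancl_power)
    then have d: "(r, w) \<in> E ^^ dist w" unfolding dist_def by (rule LeastI_ex)
    then obtain k where k: "dist w = Suc k" using w by (cases "dist w") auto
    then obtain w' where w': "(r, w') \<in> E ^^ k" "(w', w) \<in> E" using d by auto
    have "dist w' \<le> k" unfolding dist_def by (rule Least_le) (rule w'(1))
    moreover have "w' \<in> ?P" using w'(1) relpow_imp_rtrancl by blast
    moreover obtain t where "t \<in> T" "ends t = {w', w}" using w'(2) by (auto simp: E_def)
    ultimately show ?thesis using k by (intro exI[of _ t] exI[of _ w']) simp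
  qed
  then obtain t where t: "\<And>w. w \<in> ?P - {r} \<Longrightarrow> t w \<in> T \<and> (\<exists>w'. ends (t w) = {w', w} \<and> w' \<in> ?P \<and> dist w' < dist w)"
    by metis
  have "inj_on t (?P - {r})"
  proof (rule inj_onI, rule ccontr)
    fix v w assume vw: "v \<in> ?P - {r}" "w \<in> ?P - {r}" "t v = t w" "v \<noteq> w"
    obtain v' w' where "ends (t v) = {v', v}" "dist v' < dist v" "ends (t w) = {w', w}" "dist w' < dist w"
      using t[OF vw(1)] t[OF vw(2)] by blast
    \<comment> \<open>If \<open>v\<close> and \<open>w\<close> were sent to the same edge, each
      would be closer to the root than the other.\<close>
    then show False using vw(3,4) by (auto simp: doubleton_eq_iff)
  qed
  moreover have "t ` (?P - {r}) \<subseteq> {t \<in> T. ends t \<subseteq> ?P}" using t by fastforce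
  ultimately have "card (?P - {r}) \<le> card {t \<in> T. ends t \<subseteq> ?P}"
    using assms(1) by (intro card_inj_on_le) auto
  \<comment> \<open>An infinite component has \<open>card\<close> equal to 0, where the bound is
    trivial.\<close>
  then show ?thesis by (cases "finite ?P") (auto simp: card_Diff_singleton)
qed

section \<open>Connectivity in the concatenated graph\<close>

definition edge_rel :: "diagram \<Rightarrow> node rel" where
  "edge_rel x = {(u, v). {u, v} \<in> x}"

lemma inj_in_first: "inj in_first" and inj_in_second: "inj in_second"
  by (rule injI, rename_tac u v, case_tac u; case_tac v; simp)+

lemma inj_image_doubleton:
  assumes "inj h" "h ` e = {u, v}"
  obtains a b where "e = {a, b}" "u = h a" "v = h b"
proof -
  obtain a b where ab: "a \<in> e" "b \<in> e" "u = h a" "v = h b" using assms(2) by blast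
  moreover have "h ` e = h ` {a, b}" using assms(2) ab by simp
  ultimately show thesis using that inj_image_eq_iff[OF assms(1)] by metis
qed

text \<open>In this form the steps along \<open>x\<close> and along \<open>y\<close> can be told
  apart (\<open>connected_induct\<close>), and the whole graph can be relabelled along an injection
  (\<open>column_component\<close>).\<close>

lemma connected_rel_eq:
  "connected_rel x y =
    (map_prod in_first in_first ` edge_rel x \<union> map_prod in_second in_second ` edge_rel y)\<^sup>*"
proof -
  have "{(u, v). {u, v} \<in> ((`) h) ` x} = map_prod h h ` edge_rel x" if h: "inj h"
    for h :: "node \<Rightarrow> gnode" and x
  proof (intro equalityI subsetI)
    fix p assume "p \<in> {(u, v). {u, v} \<in> ((`) h) ` x}"
    then obtain u v e where p: "p = (u, v)" and e: "h ` e = {u, v}" "e \<in> x" by (cases p) (metis case_prodD imageE mem_Collect_eq)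
    from inj_image_doubleton[OF h e(1)] obtain a b where "e = {a, b}" "u = h a" "v = h b" .
    then show "p \<in> map_prod h h ` edge_rel x"
      using e(2) p by (intro image_eqI[of _ _ "(a, b)"]) (auto simp: edge_rel_def)
  next
    fix p assume "p \<in> map_prod h h ` edge_rel x"
    then obtain a b where "p = (h a, h b)" "{a, b} \<in> x" by (auto simp: edge_rel_def)
    moreover from this have "h ` {a, b} \<in> ((`) h) ` x" by (rule_tac imageI)
    ultimately show "p \<in> {(u, v). {u, v} \<in> ((`) h) ` x}" by simp
  qed
  from this[OF inj_in_first, of x] this[OF inj_in_second, of y]
  have "{(u, v). {u, v} \<in> ((`) in_first) ` x \<union> ((`) in_second) ` y} =
    map_prod in_first in_first ` edge_rel x \<union> map_prod in_second in_second ` edge_rel y"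
    by (auto simp only: Un_iff split_def mem_Collect_eq set_eq_iff)
  then show ?thesis by (simp add: connected_rel_def)
qed

lemma connected_refl [simp]: "(u, u) \<in> connected_rel x y"
  by (simp add: connected_rel_def)

lemma connected_trans: "\<lbrakk>(u, v) \<in> connected_rel x y; (v, w) \<in> connected_rel x y\<rbrakk> \<Longrightarrow> (u, w) \<in> connected_rel x y"
  unfolding connected_rel_def by (rule rtrancl_trans)

lemma sym_connected_rel: "sym (connected_rel x y)"
  unfolding connected_rel_def by (intro sym_rtrancl symI) (simp add: insert_commute)

lemma connected_sym: "(u, v) \<in> connected_rel x y \<Longrightarrow> (v, u) \<in> connected_rel x y"
  using sym_connected_rel by (rule symD)

lemma connected_first: "{u, v} \<in> x \<Longrightarrow> (in_first u, in_first v) \<in> connected_rel x y"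
  unfolding connected_rel_eq by (rule r_into_rtrancl) (auto simp: edge_rel_def map_prod_def split_def image_iff)

lemma connected_second: "{u, v} \<in> y \<Longrightarrow> (in_second u, in_second v) \<in> connected_rel x y"
  unfolding connected_rel_eq by (rule r_into_rtrancl) (auto simp: edge_rel_def map_prod_def split_def image_iff)

lemma connected_induct [consumes 1, case_names refl first second]:
  assumes "(p, q) \<in> connected_rel x y" "Q p"
    and "\<And>u v. \<lbrakk>(p, in_first u) \<in> connected_rel x y; {u, v} \<in> x; Q (in_first u)\<rbrakk> \<Longrightarrow> Q (in_first v)"
    and "\<And>u v. \<lbrakk>(p, in_second u) \<in> connected_rel x y; {u, v} \<in> y; Q (in_second u)\<rbrakk> \<Longrightarrow> Q (in_second v)"
  shows "Q q"
  using assms(1) unfolding connected_rel_eq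
proof (induction rule: rtrancl_induct)
  case (step q r)
  then show ?case using assms(3,4) unfolding connected_rel_eq by (auto simp: edge_rel_def)
qed (rule assms(2))

definition component :: "diagram \<Rightarrow> diagram \<Rightarrow> gnode \<Rightarrow> gnode set" where
  "component x y p = connected_rel x y `` {p}"

lemma component_iff: "q \<in> component x y p \<longleftrightarrow> (p, q) \<in> connected_rel x y"
  by (simp add: component_def)

definition gnodes :: "nat \<Rightarrow> gnode set" where
  "gnodes n = GLeft ` {..<n} \<union> GMid ` {..<n} \<union> GRight ` {..<n}"

lemma in_gnodes [simp]:
  "GLeft i \<in> gnodes n \<longleftrightarrow> i < n" "GMid i \<in> gnodes n \<longleftrightarrow> i < n" "GRight i \<in> gnodes n \<longleftrightarrow> i < n"
  by (auto simp: gnodes_def)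

lemma embeddings_in_gnodes [simp]:
  "in_first u \<in> gnodes n \<longleftrightarrow> u \<in> nodes n" "in_second u \<in> gnodes n \<longleftrightarrow> u \<in> nodes n"
  "outer u \<in> gnodes n \<longleftrightarrow> u \<in> nodes n"
  by (cases u; simp)+

lemma component_subset:
  assumes "x \<in> Brauer n" "y \<in> Brauer n" "p \<in> gnodes n"
  shows "component x y p \<subseteq> gnodes n"
proof
  fix q assume "q \<in> component x y p"
  then have "(p, q) \<in> connected_rel x y" by (simp add: component_iff)
  then show "q \<in> gnodes n"
    using assms Brauer_edgeD by (induction rule: connected_induct) auto
qed

lemma component_edge_closed:
  "edge_closed x {v \<in> nodes n. in_first v \<in> component x y p}" if "x \<in> Brauer n"
  using Brauer_edgeD[OF that] connected_trans[OF _ connected_first]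
  unfolding edge_closed_def component_iff by blast

lemma component_edge_closed':
  "edge_closed y {v \<in> nodes n. in_second v \<in> component x y p}" if "y \<in> Brauer n"
  using Brauer_edgeD[OF that] connected_trans[OF _ connected_second]
  unfolding edge_closed_def component_iff by blast

lemma card_nodes_preimage:
  "card {v \<in> nodes n. in_first v \<in> P} = card {i. i < n \<and> GLeft i \<in> P} + card {i. i < n \<and> GMid i \<in> P}"
  "card {v \<in> nodes n. in_second v \<in> P} = card {i. i < n \<and> GMid i \<in> P} + card {i. i < n \<and> GRight i \<in> P}"
  "card {v \<in> nodes n. outer v \<in> P} = card {i. i < n \<and> GLeft i \<in> P} + card {i. i < n \<and> GRight i \<in> P}"
proof -
  have *: "card (Lft ` I \<union> Rgt ` J) = card I + card J" if "finite I" "finite J" for I J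
    using that by (subst card_Un_disjoint) (auto simp: card_image inj_on_def)
  have "{v \<in> nodes n. in_first v \<in> P} = Lft ` {i. i < n \<and> GLeft i \<in> P} \<union> Rgt ` {i. i < n \<and> GMid i \<in> P}"
    "{v \<in> nodes n. in_second v \<in> P} = Lft ` {i. i < n \<and> GMid i \<in> P} \<union> Rgt ` {i. i < n \<and> GRight i \<in> P}"
    "{v \<in> nodes n. outer v \<in> P} = Lft ` {i. i < n \<and> GLeft i \<in> P} \<union> Rgt ` {i. i < n \<and> GRight i \<in> P}"
    by (auto simp: nodes_def)
  then show
    "card {v \<in> nodes n. in_first v \<in> P} = card {i. i < n \<and> GLeft i \<in> P} + card {i. i < n \<and> GMid i \<in> P}"
    "card {v \<in> nodes n. in_second v \<in> P} = card {i. i < n \<and> GMid i \<in> P} + card {i. i < n \<and> GRight i \<in> P}"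
    "card {v \<in> nodes n. outer v \<in> P} = card {i. i < n \<and> GLeft i \<in> P} + card {i. i < n \<and> GRight i \<in> P}"
    by (simp_all add: *)
qed

lemma card_gnodes_subset:
  assumes "P \<subseteq> gnodes n"
  shows "card P = card {i. i < n \<and> GLeft i \<in> P} + card {i. i < n \<and> GMid i \<in> P} + card {i. i < n \<and> GRight i \<in> P}"
proof -
  have "P = GLeft ` {i. i < n \<and> GLeft i \<in> P} \<union> GMid ` {i. i < n \<and> GMid i \<in> P} \<union> GRight ` {i. i < n \<and> GRight i \<in> P}"
    using assms by (auto simp: gnodes_def)
  then have "card P = card (GLeft ` {i. i < n \<and> GLeft i \<in> P} \<union> GMid ` {i. i < n \<and> GMid i \<in> P} \<union> GRight ` {i. i < n \<and> GRight i \<in> P})"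
    by simp
  also have "\<dots> = card {i. i < n \<and> GLeft i \<in> P} + card {i. i < n \<and> GMid i \<in> P} + card {i. i < n \<and> GRight i \<in> P}"
    by (subst card_Un_disjoint; (subst card_Un_disjoint)?) (auto simp: card_image inj_on_def)
  finally show ?thesis .
qed

text \<open>Middle nodes have degree \<open>2\<close> and outer nodes degree \<open>1\<close>, so comparing the numbers of vertices and
  edges of a component bounds its number of outer nodes by \<open>2\<close>, and this number is even.\<close>

lemma card_outer_component:
  assumes x: "x \<in> Brauer n" and y: "y \<in> Brauer n" and u: "u \<in> nodes n"
  shows "card {v \<in> nodes n. outer v \<in> component x y (outer u)} = 2"
proof -
  let ?P = "component x y (outer u)"
  \<comment> \<open>The tags keep an edge of \<open>x\<close> and an edge of \<open>y\<close> apart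
    when they join the same two middle nodes.\<close>
  define T where "T = Inl ` x \<union> Inr ` y"
  define ends where "ends = case_sum ((`) in_first) ((`) in_second)"
  have fin: "finite x" "finite y"
    using x y by (auto simp: Brauer_def intro!: finite_subset[of _ "Pow (nodes n)"])
  have P: "?P \<subseteq> gnodes n" using component_subset[OF x y] u by simp
  have "{(a, b). \<exists>t\<in>T. ends t = {a, b}} = {(u, v). {u, v} \<in> ((`) in_first) ` x \<union> ((`) in_second) ` y}"
  proof -
    have "(\<exists>t\<in>T. ends t = S) \<longleftrightarrow> S \<in> ((`) in_first) ` x \<union> ((`) in_second) ` y" for S
      by (simp add: T_def ends_def bex_Un image_iff eq_commute[of S])
    then show ?thesis by simp
  qed
  then have "card ?P \<le> Suc (card {t \<in> T. ends t \<subseteq> ?P})"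
    using card_component_le[of T ends "outer u"] fin unfolding component_def connected_rel_def
    by (simp add: T_def)
  also have "{t \<in> T. ends t \<subseteq> ?P} \<subseteq> Inl ` {e \<in> x. e \<subseteq> {v \<in> nodes n. in_first v \<in> ?P}}
      \<union> Inr ` {e \<in> y. e \<subseteq> {v \<in> nodes n. in_second v \<in> ?P}}"
  proof
    fix t assume t: "t \<in> {t \<in> T. ends t \<subseteq> ?P}"
    show "t \<in> Inl ` {e \<in> x. e \<subseteq> {v \<in> nodes n. in_first v \<in> ?P}}
      \<union> Inr ` {e \<in> y. e \<subseteq> {v \<in> nodes n. in_second v \<in> ?P}}"
    proof (cases t)
      case (Inl e)
      then have "e \<in> x" "in_first ` e \<subseteq> ?P" using t by (auto simp: T_def ends_def)
      moreover from this have "e \<subseteq> nodes n" using x by (simp add: Brauer_def)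
      ultimately show ?thesis unfolding Inl by blast
    next
      case (Inr e)
      then have "e \<in> y" "in_second ` e \<subseteq> ?P" using t by (auto simp: T_def ends_def)
      moreover from this have "e \<subseteq> nodes n" using y by (simp add: Brauer_def)
      ultimately show ?thesis unfolding Inr by blast
    qed
  qed
  then have "card {t \<in> T. ends t \<subseteq> ?P} \<le> card (Inl ` {e \<in> x. e \<subseteq> {v \<in> nodes n. in_first v \<in> ?P}}
      \<union> Inr ` {e \<in> y. e \<subseteq> {v \<in> nodes n. in_second v \<in> ?P}} :: (node set + node set) set)"
    using fin by (intro card_mono finite_UnI finite_imageI) simp_all
  also have "\<dots> = card {e \<in> x. e \<subseteq> {v \<in> nodes n. in_first v \<in> ?P}} + card {e \<in> y. e \<subseteq> {v \<in> nodes n. in_second v \<in> ?P}}"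
    using fin by (subst card_Un_disjoint) (auto simp: card_image)
  finally have le: "card ?P \<le> Suc (card {e \<in> x. e \<subseteq> {v \<in> nodes n. in_first v \<in> ?P}}
      + card {e \<in> y. e \<subseteq> {v \<in> nodes n. in_second v \<in> ?P}})" by simp
  \<comment> \<open>Here \<open>l\<close>, \<open>m\<close>, \<open>r\<close> count the left, middle
    and right nodes of the component, and \<open>a\<close>, \<open>b\<close> its edges in
    \<open>x\<close> and \<open>y\<close>. Doubling the last inequality gives \<open>l + r\<close>
    \<le> 2, and \<open>l + r + 2 * m = 2 * (a + b)\<close> makes \<open>l + r\<close> even.\<close>
  have arith: "l + r = 2" if "l + m = 2 * a" "m + r = 2 * b" "l + r > 0" "l + m + r \<le> Suc (a + b)"
    for l m r a b :: nat
  proof -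
    have "l + r \<le> 2" using that by linarith
    moreover have "l + r + 2 * m = (l + m) + (m + r)" by simp
    then have "l + r + 2 * m = 2 * (a + b)" unfolding that(1,2) by simp
    moreover from this have "even (l + r)" by (metis even_add dvd_triv_left)
    ultimately show ?thesis using that(3) by (cases "l + r = 1") auto
  qed
  have "card {v \<in> nodes n. in_first v \<in> ?P} = 2 * card {e \<in> x. e \<subseteq> {v \<in> nodes n. in_first v \<in> ?P}}"
    by (rule card_edge_closed[OF x _ component_edge_closed[OF x]]) auto
  moreover have "card {v \<in> nodes n. in_second v \<in> ?P} = 2 * card {e \<in> y. e \<subseteq> {v \<in> nodes n. in_second v \<in> ?P}}"
    by (rule card_edge_closed[OF y _ component_edge_closed'[OF y]]) auto
  moreover have "card {v \<in> nodes n. outer v \<in> ?P} > 0"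
    using u by (subst card_gt_0_iff) (auto simp: component_iff)
  ultimately show ?thesis
    using le unfolding card_gnodes_subset[OF P] card_nodes_preimage by (rule arith)
qed

lemma comp_diagram_iff:
  "{u, v} \<in> comp_diagram n x y \<longleftrightarrow>
    u \<in> nodes n \<and> v \<in> nodes n \<and> u \<noteq> v \<and> (outer u, outer v) \<in> connected_rel x y"
  unfolding comp_diagram_def using connected_sym by (auto simp: doubleton_eq_iff)

text \<open>By \<open>card_outer_component\<close> the component of an outer node contains exactly
  one further outer node, which is its partner.\<close>

lemma comp_Brauer:
  assumes x: "x \<in> Brauer n" and y: "y \<in> Brauer n"
  shows "comp_diagram n x y \<in> Brauer n"
  unfolding Brauer_def
proof (intro CollectI conjI ballI)
  fix e assume "e \<in> comp_diagram n x y"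
  then show "e \<subseteq> nodes n" "card e = 2" by (auto simp: comp_diagram_def card_2_iff)
next
  fix v assume v: "v \<in> nodes n"
  let ?Q = "{w \<in> nodes n. outer w \<in> component x y (outer v)}"
  have "v \<in> ?Q" using v by (simp add: component_iff)
  moreover obtain a b where ab: "?Q = {a, b}" "a \<noteq> b" using card_outer_component[OF x y v] by (auto simp: card_2_iff)
  ultimately obtain w where w: "?Q = {v, w}" "w \<noteq> v" by (metis insertE insert_commute singletonD)
  show "\<exists>!e. e \<in> comp_diagram n x y \<and> v \<in> e"
  proof (rule ex1I)
    have "w \<in> ?Q" using w by simp
    then show "{v, w} \<in> comp_diagram n x y \<and> v \<in> {v, w}"
      using v w(2) by (auto simp: comp_diagram_iff component_iff)
  next
    fix e assume "e \<in> comp_diagram n x y \<and> v \<in> e"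
    then obtain z where z: "e = {v, z}" "{v, z} \<in> comp_diagram n x y"
      by (auto simp: comp_diagram_def insert_commute intro: connected_sym)
    then have "z \<in> ?Q" "z \<noteq> v" by (auto simp: comp_diagram_iff component_iff)
    then show "e = {v, w}" using w z by auto
  qed
qed


section \<open>Planarity of the composite\<close>

abbreviation precede_count :: "nat \<Rightarrow> node set \<Rightarrow> node \<Rightarrow> nat" where
  "precede_count n Q v \<equiv> card {w \<in> Q. boundary_pos n w < boundary_pos n v}"

lemma boundary_pos_inj: "\<lbrakk>u \<in> nodes n; v \<in> nodes n; boundary_pos n u = boundary_pos n v\<rbrakk> \<Longrightarrow> u = v"
  by (cases u; cases v; simp)

lemma planarD:
  assumes "planar n x" "{a, b} \<in> x" "{c, d} \<in> x" "boundary_pos n a < boundary_pos n c"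
    "boundary_pos n c < boundary_pos n b" "boundary_pos n b < boundary_pos n d"
  shows False
  using assms unfolding planar_def crossing_def by blast

text \<open>The two counts differ by the number of nodes of \<open>Q\<close> strictly between
  \<open>a\<close> and \<open>b\<close>. By planarity no edge leaves this interval across the edge
  from \<open>a\<close> to \<open>b\<close>, so these nodes are matched among themselves.\<close>

lemma even_precede_count_less:
  assumes x: "x \<in> Brauer n" "planar n x" and Q: "Q \<subseteq> nodes n" "edge_closed x Q"
    and e: "{a, b} \<in> x" "a \<notin> Q" and less: "boundary_pos n a < boundary_pos n b"
  shows "even (precede_count n Q a) \<longleftrightarrow> even (precede_count n Q b)"
proof -
  let ?B = "{w \<in> Q. boundary_pos n a < boundary_pos n w \<and> boundary_pos n w < boundary_pos n b}"
  have fin: "finite Q" by (rule finite_subset[OF Q(1) finite_nodes])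
  have ab: "a \<in> nodes n" "b \<in> nodes n" using Brauer_edgeD[OF x(1) e(1)] by auto
  have b: "b \<notin> Q" using e Q(2) by (auto simp: edge_closed_def insert_commute)
  have "edge_closed x ?B"
    unfolding edge_closed_def
  proof (intro allI impI)
    fix w w' assume ww: "{w, w'} \<in> x" "w \<in> ?B"
    then have w': "w' \<in> Q" using Q(2) by (auto simp: edge_closed_def)
    then have ne: "boundary_pos n w' \<noteq> boundary_pos n a" "boundary_pos n w' \<noteq> boundary_pos n b"
      using boundary_pos_inj[of w' n a] boundary_pos_inj[of w' n b] ab b e(2) Q(1) by auto
    have "\<not> boundary_pos n w' < boundary_pos n a"
      using planarD[OF x(2) _ e(1), of w' w] ww by (auto simp: insert_commute)
    moreover have "\<not> boundary_pos n b < boundary_pos n w'"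
      using planarD[OF x(2) e(1) ww(1)] ww by auto
    ultimately show "w' \<in> ?B" using w' ne by auto
  qed
  moreover have "?B \<subseteq> nodes n" using Q(1) by blast
  ultimately have "even (card ?B)" using card_edge_closed[OF x(1)] by (metis (no_types, lifting) dvd_triv_left)
  moreover have "{w \<in> Q. boundary_pos n w < boundary_pos n b} = {w \<in> Q. boundary_pos n w < boundary_pos n a} \<union> ?B"
  proof (intro equalityI subsetI)
    fix w assume w: "w \<in> {w \<in> Q. boundary_pos n w < boundary_pos n b}"
    then have "boundary_pos n w \<noteq> boundary_pos n a" using boundary_pos_inj[of w n a] ab e(2) Q(1) by blast
    then show "w \<in> {w \<in> Q. boundary_pos n w < boundary_pos n a} \<union> ?B" using w by simp linarith
  qed (use less in auto)
  moreover have "card ({w \<in> Q. boundary_pos n w < boundary_pos n a} \<union> ?B) = precede_count n Q a + card ?B"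
  proof (rule card_Un_disjoint)
    show "finite {w \<in> Q. boundary_pos n w < boundary_pos n a}" "finite ?B"
      by (rule finite_subset[OF _ fin], blast)+
  qed (simp add: disjoint_iff)
  ultimately show ?thesis by simp
qed

lemma even_precede_count:
  assumes x: "x \<in> Brauer n" "planar n x" and Q: "Q \<subseteq> nodes n" "edge_closed x Q"
    and e: "{a, b} \<in> x" "a \<notin> Q"
  shows "even (precede_count n Q a) \<longleftrightarrow> even (precede_count n Q b)"
proof -
  have ab: "a \<in> nodes n" "b \<in> nodes n" "a \<noteq> b" using Brauer_edgeD[OF x(1) e(1)] by auto
  have b: "b \<notin> Q" using e Q(2) by (auto simp: edge_closed_def insert_commute)
  consider "boundary_pos n a < boundary_pos n b" | "boundary_pos n b < boundary_pos n a"
    using boundary_pos_inj[OF ab(1,2)] ab(3) by linarith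
  then show ?thesis
    using even_precede_count_less[OF x Q e] even_precede_count_less[OF x Q, of b a] e b
    by cases (auto simp: insert_commute)
qed

text \<open>The middle column is the right column of the first factor, read upwards, and the left
  column of the second, read downwards. The nodes before a middle node \<open>i\<close> in the two
  orders are therefore the left nodes and all middle nodes other than \<open>i\<close>. For a right
  node the second factor counts the whole middle column where the composite counts the whole left
  column.\<close>

lemma precede_count_preimage:
  fixes P :: "gnode set"
  assumes "i < n"
  defines "l \<equiv> card {j. j < n \<and> GLeft j \<in> P}" and "m \<equiv> card {j. j < n \<and> GMid j \<in> P}"
  shows "precede_count n {v \<in> nodes n. in_first v \<in> P} (Lft i) = precede_count n {v \<in> nodes n. outer v \<in> P} (Lft i)"
    and "GMid i \<notin> P \<Longrightarrow> precede_count n {v \<in> nodes n. in_first v \<in> P} (Rgt i)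
      + precede_count n {v \<in> nodes n. in_second v \<in> P} (Lft i) = l + m"
    and "precede_count n {v \<in> nodes n. in_second v \<in> P} (Rgt i) + l
      = precede_count n {v \<in> nodes n. outer v \<in> P} (Rgt i) + m"
proof -
  have *: "card (Lft ` I \<union> Rgt ` J) = card I + card J" if "finite I" "finite J" for I J
    using that by (subst card_Un_disjoint) (auto simp: card_image inj_on_def)
  have left: "{w \<in> {v \<in> nodes n. h v \<in> P}. boundary_pos n w < boundary_pos n (Lft i)} = Lft ` {j. j < i \<and> h (Lft j) \<in> P}"
    for h :: "node \<Rightarrow> gnode"
    using assms(1) by (auto simp: nodes_def)
  have right: "{w \<in> {v \<in> nodes n. h v \<in> P}. boundary_pos n w < boundary_pos n (Rgt i)}
      = Lft ` {j. j < n \<and> h (Lft j) \<in> P} \<union> Rgt ` {j. i < j \<and> j < n \<and> h (Rgt j) \<in> P}"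
    for h :: "node \<Rightarrow> gnode"
    using assms(1) by (auto simp: nodes_def)
  show "precede_count n {v \<in> nodes n. in_first v \<in> P} (Lft i) = precede_count n {v \<in> nodes n. outer v \<in> P} (Lft i)"
    unfolding left by simp
  show "precede_count n {v \<in> nodes n. in_second v \<in> P} (Rgt i) + l
      = precede_count n {v \<in> nodes n. outer v \<in> P} (Rgt i) + m"
    unfolding right by (simp add: * l_def m_def)
  assume "GMid i \<notin> P"
  then have "{j. j < n \<and> GMid j \<in> P} = {j. j < i \<and> GMid j \<in> P} \<union> {j. i < j \<and> j < n \<and> GMid j \<in> P}"
    using assms(1) by auto (metis linorder_neqE_nat)
  then have "m = card {j. j < i \<and> GMid j \<in> P} + card {j. i < j \<and> j < n \<and> GMid j \<in> P}"
    unfolding m_def by (simp only:) (rule card_Un_disjoint; force)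
  then show "precede_count n {v \<in> nodes n. in_first v \<in> P} (Rgt i)
      + precede_count n {v \<in> nodes n. in_second v \<in> P} (Lft i) = l + m"
    unfolding left right by (simp add: * l_def card_image inj_on_def)
qed

text \<open>The side of a component \<open>P\<close> on which a node of the concatenated graph lies is the parity of the
  number of nodes of \<open>P\<close> that precede it, and the three natural orders (on the boundaries of the two
  factors and of the composite) determine the same parities up to a constant on the middle column.  Since
  the factors are planar, the side is constant along each edge outside \<open>P\<close>.\<close>

lemma even_precede_count_connected:
  assumes x: "x \<in> Brauer n" "planar n x" and y: "y \<in> Brauer n" "planar n y"
    and uv: "(outer u, outer v) \<in> connected_rel x y" "u \<in> nodes n" "v \<in> nodes n"
    and u: "outer u \<notin> component x y p"
  shows "even (precede_count n {w \<in> nodes n. outer w \<in> component x y p} u)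
     \<longleftrightarrow> even (precede_count n {w \<in> nodes n. outer w \<in> component x y p} v)"
proof -
  let ?P = "component x y p"
  let ?X = "{w \<in> nodes n. in_first w \<in> ?P}" and ?Y = "{w \<in> nodes n. in_second w \<in> ?P}"
    and ?O = "{w \<in> nodes n. outer w \<in> ?P}"
  define l where "l = card {j. j < n \<and> GLeft j \<in> ?P}"
  define m where "m = card {j. j < n \<and> GMid j \<in> ?P}"
  define side where "side q \<longleftrightarrow> even (case q of GLeft i \<Rightarrow> precede_count n ?O (Lft i)
    | GMid i \<Rightarrow> precede_count n ?X (Rgt i) | GRight i \<Rightarrow> precede_count n ?O (Rgt i))" for q
  have side_first: "side (in_first w) \<longleftrightarrow> even (precede_count n ?X w)" if "w \<in> nodes n" for w
    using that precede_count_preimage(1)[of _ n ?P] by (cases w) (auto simp: side_def)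
  \<comment> \<open>The shift \<open>l + m\<close> is the same for all nodes of \<open>y\<close>, so
    it cancels along an edge of \<open>y\<close>.\<close>
  have side_second: "side (in_second w) \<longleftrightarrow> even (precede_count n ?Y w + l + m)"
    if "w \<in> nodes n" "in_second w \<notin> ?P" for w
  proof (cases w)
    case (Lft i)
    have "even a \<longleftrightarrow> even (b + l + m)" if "a + b = l + m" for a b
      using that by (metis add.assoc even_add)
    from this[OF precede_count_preimage(2)[of i n ?P, folded l_def m_def]] show ?thesis
      using that by (simp add: side_def Lft)
  next
    case (Rgt i)
    have "even a \<longleftrightarrow> even (b + l + m)" if "b + l = a + m" for a b
      unfolding that by auto
    from this[OF precede_count_preimage(3)[of i n ?P, folded l_def m_def]] show ?thesis
      using that by (simp add: side_def Rgt)
  qed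
  have "(outer u, outer v) \<in> connected_rel x y" by fact
  then have "outer v \<notin> ?P \<and> (side (outer u) \<longleftrightarrow> side (outer v))"
  proof (induction rule: connected_induct)
    case refl
    show ?case using u by simp
  next
    case (first a b)
    have "edge_closed x ?X" by (rule component_edge_closed[OF x(1)])
    moreover have ab: "a \<in> nodes n" "b \<in> nodes n" using Brauer_edgeD[OF x(1) first(2)] by auto
    moreover have "in_first b \<notin> ?P"
      using first connected_trans[OF _ connected_first, of p b x y a] by (auto simp: component_iff insert_commute)
    ultimately show ?case
      using even_precede_count[OF x, of ?X a b] first by (auto simp: side_first)
  next
    case (second a b)
    have "edge_closed y ?Y" by (rule component_edge_closed'[OF y(1)])
    moreover have ab: "a \<in> nodes n" "b \<in> nodes n" using Brauer_edgeD[OF y(1) second(2)] by auto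
    moreover have "in_second b \<notin> ?P"
      using second connected_trans[OF _ connected_second, of p b x y a] by (auto simp: component_iff insert_commute)
    ultimately show ?case
      using even_precede_count[OF y, of ?Y a b] second by (auto simp: side_second)
  qed
  then show ?thesis using uv(2,3) by (cases u; cases v) (auto simp: side_def)
qed

text \<open>If the edges \<open>{a, b}\<close> and \<open>{c, d}\<close> crossed, then
  \<open>c\<close> would be preceded by \<open>a\<close> alone and \<open>d\<close> by both
  \<open>a\<close> and \<open>b\<close>. These are the only outer nodes of their component, so
  \<open>c\<close> and \<open>d\<close> would lie on different sides of it although they are
  connected.\<close>

lemma comp_planar:
  assumes x: "x \<in> Brauer n" "planar n x" and y: "y \<in> Brauer n" "planar n y"
  shows "planar n (comp_diagram n x y)"
  unfolding planar_def crossing_def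
proof safe
  let ?pos = "boundary_pos n"
  fix a b c d
  assume ab: "{a, b} \<in> comp_diagram n x y" and cd: "{c, d} \<in> comp_diagram n x y"
    and pos: "?pos a < ?pos c" "?pos c < ?pos b" "?pos b < ?pos d"
  let ?O = "{w \<in> nodes n. outer w \<in> component x y (outer a)}"
  have a: "a \<in> nodes n" "b \<in> nodes n" "a \<noteq> b" "{a, b} \<subseteq> ?O"
    using ab by (auto simp: comp_diagram_iff component_iff)
  have O: "?O = {a, b}"
  proof (rule sym, rule card_subset_eq)
    show "card {a, b} = card ?O" using card_outer_component[OF x(1) y(1) a(1)] a(3) by simp
  qed (use a in auto)
  have c: "c \<in> nodes n" "d \<in> nodes n" "(outer c, outer d) \<in> connected_rel x y"
    using cd by (auto simp: comp_diagram_iff)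
  have "c \<notin> ?O" unfolding O using pos by auto
  then have "outer c \<notin> component x y (outer a)" using c(1) by simp
  then have "even (precede_count n ?O c) \<longleftrightarrow> even (precede_count n ?O d)"
    using even_precede_count_connected[OF x y c(3,1,2)] by blast
  moreover have "{w \<in> {a, b}. ?pos w < ?pos c} = {a}" "{w \<in> {a, b}. ?pos w < ?pos d} = {a, b}"
    using pos by auto
  ultimately show False unfolding O using a(3) by simp
qed

lemma TL_diagramsD:
  assumes "x \<in> TL_diagrams n" shows "x \<in> Brauer n" "planar n x"
  using assms by (auto simp: TL_diagrams_def)

lemma comp_TL: "\<lbrakk>x \<in> TL_diagrams n; y \<in> TL_diagrams n\<rbrakk> \<Longrightarrow> comp_diagram n x y \<in> TL_diagrams n"
  using comp_Brauer comp_planar by (auto simp: TL_diagrams_def)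

section \<open>Associativity\<close>

text \<open>Elimination of the vertices outside \<open>K\<close>. Composition of diagrams is an
  instance: the middle column is eliminated (\<open>column_rel_comp\<close>).\<close>

definition contract :: "'v set \<Rightarrow> 'v rel \<Rightarrow> 'v rel" where
  "contract K E = {(u, v). u \<in> K \<and> v \<in> K \<and> u \<noteq> v \<and> (u, v) \<in> E\<^sup>*}"

lemma rtrancl_closed: "\<lbrakk>(u, v) \<in> E\<^sup>*; E \<subseteq> V \<times> V; u \<in> V\<rbrakk> \<Longrightarrow> v \<in> V"
  by (induction rule: rtrancl_induct) auto

text \<open>The two graphs meet only in \<open>K\<close>, so a path of the union passes between them
  only there. Contracting \<open>E\<close> onto \<open>K\<close> before gluing, as one bracketing of
  a triple product does, is then compared with gluing everything at once.\<close>

locale glued_graphs =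
  fixes E F :: "'v rel" and VE VF K :: "'v set"
  assumes E: "E \<subseteq> VE \<times> VE" and F: "F \<subseteq> VF \<times> VF" and K: "VE \<inter> VF \<subseteq> K" "K \<subseteq> VE"
begin

abbreviation "H \<equiv> contract K E \<union> F"

lemma contract_rtrancl_subset: "H\<^sup>* \<subseteq> (E \<union> F)\<^sup>*"
proof -
  have "contract K E \<subseteq> (E \<union> F)\<^sup>*" using rtrancl_mono[of E "E \<union> F"] by (auto simp: contract_def)
  then show ?thesis by (intro rtrancl_subset_rtrancl) auto
qed

lemma contract_rtrancl_iff:
  assumes u: "u \<in> K \<union> VF" and v: "v \<in> K \<union> VF"
  shows "(u, v) \<in> H\<^sup>* \<longleftrightarrow> (u, v) \<in> (E \<union> F)\<^sup>*"
proof
  have contract: "(s, w) \<in> H\<^sup>*" if "s \<in> K" "w \<in> K" "(s, w) \<in> E\<^sup>*" for s w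
    using that by (cases "s = w") (auto simp: contract_def)
  assume "(u, v) \<in> (E \<union> F)\<^sup>*"
  \<comment> \<open>Invariant along the path: \<open>s\<close> is the last vertex already reached in
    the contracted graph, and since \<open>s\<close> the path has used only \<open>E\<close>. An
    edge of \<open>F\<close> can follow only at a vertex of \<open>K\<close>, where the pending
    piece becomes an edge of the contraction.\<close>
  then have "\<exists>s\<in>K \<union> VF. (u, s) \<in> H\<^sup>* \<and> (s = v \<or> s \<in> K \<and> (s, v) \<in> E\<^sup>*)"
  proof (induction rule: rtrancl_induct)
    case base
    show ?case using u by blast
  next
    case (step w w')
    then obtain s where s: "s \<in> K \<union> VF" "(u, s) \<in> H\<^sup>*" "s = w \<or> s \<in> K \<and> (s, w) \<in> E\<^sup>*" by blast
    from step(2) show ?case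
    proof
      assume e: "(w, w') \<in> E"
      then have "s \<in> K" using s E K by auto
      moreover have "(s, w') \<in> E\<^sup>*" using s(3) e by (auto intro: rtrancl.rtrancl_into_rtrancl)
      ultimately show ?thesis using s by blast
    next
      assume f: "(w, w') \<in> F"
      have "(u, w) \<in> H\<^sup>*"
        using s(3)
      proof
        assume *: "s \<in> K \<and> (s, w) \<in> E\<^sup>*"
        then have "w \<in> VE" using rtrancl_closed[OF _ E] K by blast
        then have "w \<in> K" using f F K by blast
        then show ?thesis using contract * s(2) by (meson rtrancl_trans)
      qed (use s in simp)
      then have "(u, w') \<in> H\<^sup>*" using f by (meson UnI2 rtrancl.rtrancl_into_rtrancl)
      then show ?thesis using f F by blast
    qed
  qed
  then obtain s where s: "s \<in> K \<union> VF" "(u, s) \<in> H\<^sup>*" "s = v \<or> s \<in> K \<and> (s, v) \<in> E\<^sup>*" by blast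
  from s(3) show "(u, v) \<in> H\<^sup>*"
  proof
    assume *: "s \<in> K \<and> (s, v) \<in> E\<^sup>*"
    then have "v \<in> VE" using rtrancl_closed[OF _ E] K by blast
    then have "v \<in> K" using v K by blast
    then show ?thesis using contract * s(2) by (meson rtrancl_trans)
  qed (use s in simp)
qed (use contract_rtrancl_subset in blast)

text \<open>Here \<open>P\<close> consists of the eliminated vertices and \<open>Q\<close> of the
  shared ones. A component of the union inside \<open>P \<union> Q\<close> that avoids
  \<open>Q\<close> is a component of \<open>E\<close> alone. One that meets \<open>Q\<close> is
  determined by its trace on \<open>K \<union> VF\<close>, which is a component of \<open>H\<close>
  inside \<open>Q\<close>.\<close>

lemma card_closed_components:
  assumes sym: "sym E" "sym F" and fin: "finite VE"
  defines "P \<equiv> VE - K" and "Q \<equiv> VE \<inter> VF"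
  shows "card {C. \<exists>v\<in>P. C = E\<^sup>* `` {v} \<and> C \<subseteq> P} + card {C. \<exists>v\<in>Q. C = H\<^sup>* `` {v} \<and> C \<subseteq> Q}
    = card {C. \<exists>v\<in>P \<union> Q. C = (E \<union> F)\<^sup>* `` {v} \<and> C \<subseteq> P \<union> Q}"
proof -
  let ?G = "(E \<union> F)\<^sup>*"
  define S1 where "S1 = {C. \<exists>v\<in>P. C = ?G `` {v} \<and> C \<subseteq> P}"
  define S2 where "S2 = {C. \<exists>v\<in>Q. C = ?G `` {v} \<and> C \<subseteq> P \<union> Q}"
  have finPQ: "finite P" "finite Q" using fin by (auto simp: P_def Q_def)
  have symG: "sym ?G" using sym by (intro sym_rtrancl sym_Un)
  have eqG: "?G `` {v} = ?G `` {w}" if "w \<in> ?G `` {v}" for v w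
    using that symD[OF symG, of v w] by (auto intro: rtrancl_trans)
  have EG: "E\<^sup>* `` {v} \<subseteq> ?G `` {v}" for v using rtrancl_mono[of E "E \<union> F"] by auto
  have comp_E: "E\<^sup>* `` {v} = ?G `` {v}" if "E\<^sup>* `` {v} \<subseteq> P" for v
  proof
    show "?G `` {v} \<subseteq> E\<^sup>* `` {v}"
    proof
      fix w assume "w \<in> ?G `` {v}"
      then have "(v, w) \<in> ?G" by simp
      then show "w \<in> E\<^sup>* `` {v}"
      proof (induction rule: rtrancl_induct)
        case (step w w')
        then have "w \<notin> VF" using that K(1) by (auto simp: P_def)
        then have "(w, w') \<in> E" using step(2) F by blast
        then show ?case using step(3) by (auto intro: rtrancl.rtrancl_into_rtrancl)
      qed simp
    qed
  qed (rule EG)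
  have 1: "{C. \<exists>v\<in>P. C = E\<^sup>* `` {v} \<and> C \<subseteq> P} = S1"
    unfolding S1_def using comp_E EG by (metis (no_types, lifting) subset_trans)
  have VG: "?G `` {v} \<subseteq> VE \<union> VF" if "v \<in> VE \<union> VF" for v
    using that rtrancl_closed[of v _ "E \<union> F" "VE \<union> VF"] E F by blast
  have VH: "H\<^sup>* `` {v} \<subseteq> K \<union> VF" if "v \<in> K \<union> VF" for v
    using that rtrancl_closed[of v _ H "K \<union> VF"] F by (force simp: contract_def)
  have QK: "Q \<subseteq> K \<union> VF" by (auto simp: Q_def)
  have GH: "?G `` {v} \<inter> (K \<union> VF) = H\<^sup>* `` {v}" if "v \<in> Q" for v
    using contract_rtrancl_iff[of v] VH[of v] that QK by blast
  have sub: "?G `` {v} \<subseteq> P \<union> Q \<longleftrightarrow> H\<^sup>* `` {v} \<subseteq> Q" if "v \<in> Q" for v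
    unfolding GH[OF that, symmetric] using VG[of v] that K unfolding P_def Q_def by blast
  have "{C. \<exists>v\<in>Q. C = H\<^sup>* `` {v} \<and> C \<subseteq> Q} = (\<lambda>v. H\<^sup>* `` {v}) ` {v \<in> Q. H\<^sup>* `` {v} \<subseteq> Q}"
    by blast
  also have "\<dots> = (\<lambda>v. ?G `` {v} \<inter> (K \<union> VF)) ` {v \<in> Q. ?G `` {v} \<subseteq> P \<union> Q}"
    by (rule image_cong) (simp_all only: GH sub mem_Collect_eq cong: conj_cong)
  also have "\<dots> = (\<lambda>C. C \<inter> (K \<union> VF)) ` S2"
    unfolding S2_def by blast
  finally have "{C. \<exists>v\<in>Q. C = H\<^sup>* `` {v} \<and> C \<subseteq> Q} = (\<lambda>C. C \<inter> (K \<union> VF)) ` S2" .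
  moreover have "inj_on (\<lambda>C. C \<inter> (K \<union> VF)) S2"
  proof (rule inj_onI)
    fix C D assume C: "C \<in> S2" and D: "D \<in> S2" and eq: "C \<inter> (K \<union> VF) = D \<inter> (K \<union> VF)"
    obtain v w where v: "v \<in> Q" "C = ?G `` {v}" and w: "D = ?G `` {w}" using C D by (auto simp: S2_def)
    have "v \<in> D" using v eq QK by blast
    then show "C = D" using eqG v w by blast
  qed
  ultimately have 2: "card {C. \<exists>v\<in>Q. C = H\<^sup>* `` {v} \<and> C \<subseteq> Q} = card S2" by (simp add: card_image)
  have "{C. \<exists>v\<in>P \<union> Q. C = ?G `` {v} \<and> C \<subseteq> P \<union> Q} = S1 \<union> S2"
  proof (intro equalityI subsetI)
    fix C assume "C \<in> {C. \<exists>v\<in>P \<union> Q. C = ?G `` {v} \<and> C \<subseteq> P \<union> Q}"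
    then obtain v where v: "v \<in> P \<union> Q" "C = ?G `` {v}" "C \<subseteq> P \<union> Q" by blast
    show "C \<in> S1 \<union> S2"
    proof (cases "C \<inter> Q = {}")
      case True
      then have "C \<subseteq> P" "v \<in> C" using v by auto
      then have "C \<in> S1" using v unfolding S1_def by blast
      then show ?thesis by simp
    next
      case False
      then obtain w where "w \<in> Q" "w \<in> C" by blast
      then have "C \<in> S2" using v eqG[of w v] unfolding S2_def by blast
      then show ?thesis by simp
    qed
  qed (auto simp: S1_def S2_def)
  moreover have "S1 \<inter> S2 = {}"
  proof -
    have "v \<in> ?G `` {v}" for v by simp
    moreover have "P \<inter> Q = {}" using K by (auto simp: P_def Q_def)
    ultimately show ?thesis unfolding S1_def S2_def by blast
  qed
  moreover have "finite S1" "finite S2"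
    using finPQ by (auto simp: S1_def S2_def intro: finite_subset[of _ "(\<lambda>v. ?G `` {v}) ` (P \<union> Q)"])
  ultimately show ?thesis unfolding 1 2 by (simp add: card_Un_disjoint)
qed

end

text \<open>Vertices are pairs of a column and a height. The three factors of a triple product thus
  form a single graph on the columns 0 to 3, in which the bracketing is no longer visible.\<close>

fun column_node :: "nat \<Rightarrow> nat \<Rightarrow> node \<Rightarrow> nat \<times> nat" where
  "column_node a b (Lft i) = (a, i)"
| "column_node a b (Rgt i) = (b, i)"

fun column_gnode :: "nat \<Rightarrow> nat \<Rightarrow> nat \<Rightarrow> gnode \<Rightarrow> nat \<times> nat" where
  "column_gnode a b c (GLeft i) = (a, i)"
| "column_gnode a b c (GMid i) = (b, i)"
| "column_gnode a b c (GRight i) = (c, i)"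

definition column_rel :: "nat \<Rightarrow> nat \<Rightarrow> diagram \<Rightarrow> (nat \<times> nat) rel" where
  "column_rel a b x = map_prod (column_node a b) (column_node a b) ` edge_rel x"

lemma column_gnode_simps:
  "column_gnode a b c (in_first u) = column_node a b u"
  "column_gnode a b c (in_second u) = column_node b c u"
  "column_gnode a b c (outer u) = column_node a c u"
  by (cases u; simp)+

lemma inj_column_gnode: "distinct [a, b, c] \<Longrightarrow> inj (column_gnode a b c)"
  by (rule injI, rename_tac u v, case_tac u; case_tac v; auto)

lemma inj_column_node: "a \<noteq> b \<Longrightarrow> inj (column_node a b)"
  by (rule injI, rename_tac u v, case_tac u; case_tac v; auto)

lemma column_rel_iff:
  "(p, q) \<in> column_rel a b x \<longleftrightarrow> (\<exists>u v. {u, v} \<in> x \<and> p = column_node a b u \<and> q = column_node a b v)"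
proof
  assume "(p, q) \<in> column_rel a b x"
  then obtain e where "e \<in> edge_rel x" "(p, q) = map_prod (column_node a b) (column_node a b) e"
    unfolding column_rel_def by (rule imageE)
  then show "\<exists>u v. {u, v} \<in> x \<and> p = column_node a b u \<and> q = column_node a b v"
    by (cases e) (simp add: edge_rel_def, blast)
next
  assume "\<exists>u v. {u, v} \<in> x \<and> p = column_node a b u \<and> q = column_node a b v"
  then obtain u v where "(u, v) \<in> edge_rel x" "p = column_node a b u" "q = column_node a b v"
    by (auto simp: edge_rel_def)
  then show "(p, q) \<in> column_rel a b x" unfolding column_rel_def by (intro image_eqI[of _ _ "(u, v)"]) simp_all
qed

lemma sym_column_rel: "sym (column_rel a b x)"
proof (rule symI)
  fix p q assume "(p, q) \<in> column_rel a b x"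
  then obtain u v where "{v, u} \<in> x" "p = column_node a b u" "q = column_node a b v"
    unfolding column_rel_iff by (subst (asm) insert_commute) blast
  then show "(q, p) \<in> column_rel a b x" unfolding column_rel_iff by blast
qed

lemma column_rel_subset:
  assumes "x \<in> Brauer n" shows "column_rel a b x \<subseteq> ({a, b} \<times> {..<n}) \<times> ({a, b} \<times> {..<n})"
proof -
  have "column_node a b u \<in> {a, b} \<times> {..<n}" if "u \<in> nodes n" for u using that by (cases u) auto
  then show ?thesis
    using Brauer_edgeD(2,3)[OF assms] by (intro subrelI) (simp only: column_rel_iff, metis SigmaI)
qed

lemma rtrancl_map_prod:
  assumes "inj h"
  shows "(map_prod h h ` r)\<^sup>* `` {h u} = h ` (r\<^sup>* `` {u})"
proof (intro equalityI subsetI)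
  fix w assume "w \<in> (map_prod h h ` r)\<^sup>* `` {h u}"
  then have "(h u, w) \<in> (map_prod h h ` r)\<^sup>*" by simp
  then show "w \<in> h ` (r\<^sup>* `` {u})"
  proof (induction rule: rtrancl_induct)
    case (step v w)
    then obtain p q where "(p, q) \<in> r" "v = h p" "w = h q" by auto
    then show ?case using step(3) assms by (auto simp: inj_eq intro!: imageI intro: rtrancl.rtrancl_into_rtrancl)
  qed auto
next
  fix w assume "w \<in> h ` (r\<^sup>* `` {u})"
  then obtain v where v: "w = h v" "(u, v) \<in> r\<^sup>*" by auto
  from v(2) have "(h u, h v) \<in> (map_prod h h ` r)\<^sup>*"
  proof (induction rule: rtrancl_induct)
    case (step v w)
    then have "(h v, h w) \<in> map_prod h h ` r" by force
    then show ?case using step(3) by (rule rtrancl.rtrancl_into_rtrancl[rotated])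
  qed simp
  then show "w \<in> (map_prod h h ` r)\<^sup>* `` {h u}" using v by simp
qed

lemma column_rel_Un:
  "column_rel a b x \<union> column_rel b c y = map_prod (column_gnode a b c) (column_gnode a b c) `
     (map_prod in_first in_first ` edge_rel x \<union> map_prod in_second in_second ` edge_rel y)"
  unfolding column_rel_def image_Un image_comp map_prod_compose[symmetric]
  by (simp add: comp_def column_gnode_simps)

lemma column_component:
  assumes "distinct [a, b, c]"
  shows "(column_rel a b x \<union> column_rel b c y)\<^sup>* `` {column_gnode a b c p}
    = column_gnode a b c ` (connected_rel x y `` {p})"
  unfolding column_rel_Un connected_rel_eq by (rule rtrancl_map_prod[OF inj_column_gnode[OF assms]])

lemma column_connected_iff:
  assumes "distinct [a, b, c]"
  shows "(column_gnode a b c p, column_gnode a b c q) \<in> (column_rel a b x \<union> column_rel b c y)\<^sup>*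
    \<longleftrightarrow> (p, q) \<in> connected_rel x y"
  using column_component[OF assms, of x y p] inj_image_mem_iff[OF inj_column_gnode[OF assms], of q "connected_rel x y `` {p}"]
  by auto

lemma loops_column:
  assumes d: "distinct [a, b, c]" and x: "x \<in> Brauer n" and y: "y \<in> Brauer n"
  shows "loops n x y = card {C. \<exists>v\<in>{b} \<times> {..<n}. C = (column_rel a b x \<union> column_rel b c y)\<^sup>* `` {v} \<and> C \<subseteq> {b} \<times> {..<n}}"
proof -
  let ?h = "column_gnode a b c"
  let ?L = "{C. (\<exists>i<n. C = connected_rel x y `` {GMid i}) \<and> C \<subseteq> range GMid}"
  have sub: "?h ` (connected_rel x y `` {GMid i}) \<subseteq> {b} \<times> {..<n} \<longleftrightarrow> connected_rel x y `` {GMid i} \<subseteq> range GMid"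
    if "i < n" for i
  proof -
    have "connected_rel x y `` {GMid i} \<subseteq> gnodes n"
      using component_subset[OF x y, of "GMid i"] that by (simp add: component_def)
    moreover have "?h p \<in> {b} \<times> {..<n} \<longleftrightarrow> p \<in> range GMid" if "p \<in> gnodes n" for p
      using that d by (cases p) auto
    ultimately show ?thesis by blast
  qed
  have comp: "(column_rel a b x \<union> column_rel b c y)\<^sup>* `` {(b, i)} = ?h ` (connected_rel x y `` {GMid i})" for i
    using column_component[OF d, of x y "GMid i"] by simp
  have "{C. \<exists>v\<in>{b} \<times> {..<n}. C = (column_rel a b x \<union> column_rel b c y)\<^sup>* `` {v} \<and> C \<subseteq> {b} \<times> {..<n}}
    = {C. \<exists>i<n. C = ?h ` (connected_rel x y `` {GMid i}) \<and> C \<subseteq> {b} \<times> {..<n}}"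
    using comp by auto
  also have "\<dots> = {C. \<exists>i<n. C = ?h ` (connected_rel x y `` {GMid i}) \<and> connected_rel x y `` {GMid i} \<subseteq> range GMid}"
    using sub by blast
  also have "\<dots> = ((`) ?h) ` ?L"
    by blast
  finally have eq: "{C. \<exists>v\<in>{b} \<times> {..<n}. C = (column_rel a b x \<union> column_rel b c y)\<^sup>* `` {v} \<and> C \<subseteq> {b} \<times> {..<n}}
    = ((`) ?h) ` ?L" .
  have "inj ((`) ?h)" using inj_column_gnode[OF d] by (intro injI) (simp only: inj_image_eq_iff)
  then have "inj_on ((`) ?h) ?L" by (rule inj_on_subset) simp
  then show ?thesis unfolding loops_def eq by (rule card_image[symmetric])
qed

lemma column_rel_comp:
  assumes "distinct [a, b, c]"
  shows "column_rel a c (comp_diagram n x y) = contract ({a, c} \<times> {..<n}) (column_rel a b x \<union> column_rel b c y)"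
proof -
  let ?h = "column_node a c"
  have inj: "?h u = ?h v \<longleftrightarrow> u = v" for u v using inj_column_node[of a c] assms by (auto simp: inj_eq)
  have conn: "(?h u, ?h v) \<in> (column_rel a b x \<union> column_rel b c y)\<^sup>* \<longleftrightarrow> (outer u, outer v) \<in> connected_rel x y" for u v
    using column_connected_iff[OF assms, of "outer u" "outer v"] by (simp add: column_gnode_simps)
  have K: "p \<in> {a, c} \<times> {..<n} \<longleftrightarrow> (\<exists>u\<in>nodes n. p = ?h u)" for p
  proof
    assume "p \<in> {a, c} \<times> {..<n}"
    then obtain i where "i < n" "p = ?h (Lft i) \<or> p = ?h (Rgt i)" by auto
    then show "\<exists>u\<in>nodes n. p = ?h u" by (auto intro: bexI[of _ "Lft i"] bexI[of _ "Rgt i"] simp del: column_node.simps)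
  next
    assume "\<exists>u\<in>nodes n. p = ?h u"
    then obtain u where "u \<in> nodes n" "p = ?h u" by blast
    then show "p \<in> {a, c} \<times> {..<n}" by (cases u) auto
  qed
  show ?thesis
  proof (intro equalityI subsetI)
    fix p assume "p \<in> column_rel a c (comp_diagram n x y)"
    then obtain u v where "{u, v} \<in> comp_diagram n x y" "p = (?h u, ?h v)"
      by (cases p) (auto simp only: column_rel_iff)
    then show "p \<in> contract ({a, c} \<times> {..<n}) (column_rel a b x \<union> column_rel b c y)"
      unfolding contract_def K by (auto simp: comp_diagram_iff conn inj)
  next
    fix p assume "p \<in> contract ({a, c} \<times> {..<n}) (column_rel a b x \<union> column_rel b c y)"
    then have p: "fst p \<in> {a, c} \<times> {..<n}" "snd p \<in> {a, c} \<times> {..<n}" "fst p \<noteq> snd p"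
      "(fst p, snd p) \<in> (column_rel a b x \<union> column_rel b c y)\<^sup>*"
      by (simp_all add: contract_def split_beta)
    then obtain u v where uv: "u \<in> nodes n" "v \<in> nodes n" "fst p = ?h u" "snd p = ?h v" using K by metis
    have "p = (?h u, ?h v)" by (simp only: uv(3,4)[symmetric] prod.collapse)
    moreover have "u \<noteq> v" using p(3) unfolding uv(3,4) by blast
    moreover have "(outer u, outer v) \<in> connected_rel x y" using p(4) unfolding uv(3,4) conn .
    ultimately show "p \<in> column_rel a c (comp_diagram n x y)"
      unfolding column_rel_def by (intro image_eqI[of _ _ "(u, v)"]) (simp_all add: edge_rel_def comp_diagram_iff uv(1,2))
  qed
qed

context
  fixes n x y z assumes x: "x \<in> Brauer n" and y: "y \<in> Brauer n" and z: "z \<in> Brauer n"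
begin

private abbreviation cols :: "nat set \<Rightarrow> (nat \<times> nat) set" where "cols S \<equiv> S \<times> {..<n}"

private lemma glued_left: "glued_graphs (column_rel 0 1 x \<union> column_rel 1 2 y) (column_rel 2 3 z)
    (cols {0, 1, 2}) (cols {2, 3}) (cols {0, 2})"
  using column_rel_subset[OF x, of 0 1] column_rel_subset[OF y, of 1 2] column_rel_subset[OF z, of 2 3]
  by unfold_locales (blast | auto)+

private lemma glued_right: "glued_graphs (column_rel 1 2 y \<union> column_rel 2 3 z) (column_rel 0 1 x)
    (cols {1, 2, 3}) (cols {0, 1}) (cols {1, 3})"
  using column_rel_subset[OF x, of 0 1] column_rel_subset[OF y, of 1 2] column_rel_subset[OF z, of 2 3]
  by unfold_locales (blast | auto)+

private lemma triple_Un: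
  "column_rel 1 2 y \<union> column_rel 2 3 z \<union> column_rel 0 1 x = column_rel 0 1 x \<union> column_rel 1 2 y \<union> column_rel 2 3 z"
  by blast

text \<open>Both sides record which nodes of the columns 0 and 3 are connected in the four-column
  graph; one eliminates column 1 first, the other column 2.\<close>

lemma comp_assoc: "comp_diagram n (comp_diagram n x y) z = comp_diagram n x (comp_diagram n y z)"
proof -
  let ?G = "(column_rel 0 1 x \<union> column_rel 1 2 y \<union> column_rel 2 3 z)\<^sup>*"
  have out: "column_node 0 3 u \<in> cols {0, 3}" if "u \<in> nodes n" for u using that by (cases u) auto
  have "(outer u, outer v) \<in> connected_rel (comp_diagram n x y) z \<longleftrightarrow> (column_node 0 3 u, column_node 0 3 v) \<in> ?G"
    if "u \<in> nodes n" "v \<in> nodes n" for u v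
    using column_connected_iff[of 0 2 3 "outer u" "outer v" "comp_diagram n x y" z]
      glued_graphs.contract_rtrancl_iff[OF glued_left, of "column_node 0 3 u" "column_node 0 3 v"]
      out[OF that(1)] out[OF that(2)] column_rel_comp[of 0 1 2 n x y]
    by (auto simp: column_gnode_simps)
  moreover have "(outer u, outer v) \<in> connected_rel x (comp_diagram n y z) \<longleftrightarrow> (column_node 0 3 u, column_node 0 3 v) \<in> ?G"
    if "u \<in> nodes n" "v \<in> nodes n" for u v
    using column_connected_iff[of 0 1 3 "outer u" "outer v" x "comp_diagram n y z"]
      glued_graphs.contract_rtrancl_iff[OF glued_right, of "column_node 0 3 u" "column_node 0 3 v"]
      out[OF that(1)] out[OF that(2)] column_rel_comp[of 1 2 3 n y z] triple_Un
    by (auto simp: column_gnode_simps Un_commute)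
  ultimately show ?thesis unfolding comp_diagram_def[of n "comp_diagram n x y"] comp_diagram_def[of n x "comp_diagram n y z"]
    by blast
qed

text \<open>Both sums count the components of the four-column graph that stay inside the columns 1
  and 2.\<close>

lemma loops_assoc:
  "loops n x y + loops n (comp_diagram n x y) z = loops n y z + loops n x (comp_diagram n y z)"
proof -
  let ?G = "(column_rel 0 1 x \<union> column_rel 1 2 y \<union> column_rel 2 3 z)\<^sup>*"
  let ?N = "card {C. \<exists>v\<in>cols {1, 2}. C = ?G `` {v} \<and> C \<subseteq> cols {1, 2}}"
  have sets: "cols {0, 1, 2} - cols {0, 2} = cols {1}" "cols {0, 1, 2} \<inter> cols {2, 3} = cols {2}"
    "cols {1, 2, 3} - cols {1, 3} = cols {2}" "cols {1, 2, 3} \<inter> cols {0, 1} = cols {1}"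
    "cols {1} \<union> cols {2} = cols {1, 2}" "cols {2} \<union> cols {1} = cols {1, 2}"
    by auto
  have d: "distinct [0, 1, 2 :: nat]" "distinct [0, 2, 3 :: nat]" "distinct [1, 2, 3 :: nat]" "distinct [0, 1, 3 :: nat]"
    by simp_all
  have sym: "sym (column_rel a b u \<union> column_rel c d v)" for a b c d u v
    by (intro sym_Un sym_column_rel)
  have fin: "finite (cols S)" if "finite S" for S :: "nat set" using that by simp
  have "loops n x y + loops n (comp_diagram n x y) z = ?N"
    unfolding loops_column[OF d(1) x y] loops_column[OF d(2) comp_Brauer[OF x y] z] column_rel_comp[OF d(1)]
    using glued_graphs.card_closed_components[OF glued_left sym sym_column_rel fin, unfolded sets] by simp
  moreover have "loops n y z + loops n x (comp_diagram n y z) = ?N"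
    unfolding loops_column[OF d(3) y z] loops_column[OF d(4) x comp_Brauer[OF y z]] column_rel_comp[OF d(3)]
      Un_commute[of "column_rel 0 1 x" "contract K E" for K E]
    using glued_graphs.card_closed_components[OF glued_right sym sym_column_rel fin, unfolded sets triple_Un] by simp
  ultimately show ?thesis by simp
qed

end

section \<open>Units, idempotents and left cups\<close>

lemma boundary_pos_less:
  "boundary_pos n (Lft i) < boundary_pos n (Lft j) \<longleftrightarrow> i < j"
  "\<lbrakk>i < n; j < n\<rbrakk> \<Longrightarrow> boundary_pos n (Lft i) < boundary_pos n (Rgt j)"
  "\<lbrakk>i < n; j < n\<rbrakk> \<Longrightarrow> \<not> boundary_pos n (Rgt i) < boundary_pos n (Lft j)"
  "\<lbrakk>i < n; j < n\<rbrakk> \<Longrightarrow> boundary_pos n (Rgt i) < boundary_pos n (Rgt j) \<longleftrightarrow> j < i"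
  by auto

definition pairing :: "nat \<Rightarrow> (node \<Rightarrow> node) \<Rightarrow> diagram" where
  "pairing n f = {{v, f v} | v. v \<in> nodes n}"

locale node_involution =
  fixes n :: nat and f :: "node \<Rightarrow> node"
  assumes closed: "v \<in> nodes n \<Longrightarrow> f v \<in> nodes n" and involution: "v \<in> nodes n \<Longrightarrow> f (f v) = v"
    and no_fixpoint: "v \<in> nodes n \<Longrightarrow> f v \<noteq> v"
begin

lemma pairing_iff: "{u, v} \<in> pairing n f \<longleftrightarrow> u \<in> nodes n \<and> v = f u"
  using closed involution by (auto simp: pairing_def doubleton_eq_iff)

lemma pairing_Brauer: "pairing n f \<in> Brauer n"
  unfolding Brauer_def
proof (intro CollectI conjI ballI)
  fix e assume "e \<in> pairing n f"
  then show "e \<subseteq> nodes n" "card e = 2"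
    using closed no_fixpoint by (auto simp: pairing_def card_2_iff)
next
  fix v assume v: "v \<in> nodes n"
  show "\<exists>!e. e \<in> pairing n f \<and> v \<in> e"
  proof (rule ex1I[of _ "{v, f v}"])
    fix e assume e: "e \<in> pairing n f \<and> v \<in> e"
    then obtain w where "w \<in> nodes n" "e = {w, f w}" by (auto simp: pairing_def)
    then show "e = {v, f v}" using e involution by auto
  qed (use v in \<open>auto simp: pairing_def\<close>)
qed

lemma pairing_TL:
  assumes "\<And>u w. \<lbrakk>u \<in> nodes n; w \<in> nodes n; boundary_pos n u < boundary_pos n w;
    boundary_pos n w < boundary_pos n (f u); boundary_pos n (f u) < boundary_pos n (f w)\<rbrakk> \<Longrightarrow> False"
  shows "pairing n f \<in> TL_diagrams n"
  using assms pairing_Brauer unfolding TL_diagrams_def planar_def crossing_def by (auto simp: pairing_iff)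

end

section \<open>The identity diagram\<close>

fun flip :: "node \<Rightarrow> node" where
  "flip (Lft i) = Rgt i"
| "flip (Rgt i) = Lft i"

lemma id_diagram_pairing: "id_diagram n = pairing n flip"
proof -
  have "id_diagram n = (\<lambda>i. {Lft i, Rgt i}) ` {..<n}" by (auto simp: id_diagram_def)
  also have "\<dots> = pairing n flip"
  proof (intro equalityI subsetI)
    fix e assume "e \<in> pairing n flip"
    then obtain v where "v \<in> nodes n" "e = {v, flip v}" by (auto simp: pairing_def)
    then show "e \<in> (\<lambda>i. {Lft i, Rgt i}) ` {..<n}" by (cases v) (auto simp: insert_commute)
  next
    fix e assume "e \<in> (\<lambda>i. {Lft i, Rgt i}) ` {..<n}"
    then obtain i where "i < n" "e = {Lft i, flip (Lft i)}" by auto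
    then show "e \<in> pairing n flip" unfolding pairing_def by (intro CollectI exI[of _ "Lft i"]) simp
  qed
  finally show ?thesis .
qed

interpretation flip: node_involution n flip for n
  by (unfold_locales; case_tac v; simp)

lemma id_diagram_iff: "{u, v} \<in> id_diagram n \<longleftrightarrow> u \<in> nodes n \<and> v = flip u"
  unfolding id_diagram_pairing by (rule flip.pairing_iff)

lemma id_TL: "id_diagram n \<in> TL_diagrams n"
  unfolding id_diagram_pairing
proof (rule flip.pairing_TL)
  fix u w assume "u \<in> nodes n" "w \<in> nodes n" "boundary_pos n u < boundary_pos n w"
    "boundary_pos n w < boundary_pos n (flip u)" "boundary_pos n (flip u) < boundary_pos n (flip w)"
  then show False by (cases u; cases w) auto
qed

text \<open>The product of two adjacent Temperley-Lieb generators, if \<open>a\<close>, \<open>b\<close>, \<open>c\<close> are successive positions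
  in either direction.\<close>

definition zigzag_map :: "nat \<Rightarrow> nat \<Rightarrow> nat \<Rightarrow> node \<Rightarrow> node" where
  "zigzag_map a b c v = (case v of
     Lft i \<Rightarrow> if i = a then Lft b else if i = b then Lft a else if i = c then Rgt a else Rgt i
   | Rgt i \<Rightarrow> if i = b then Rgt c else if i = c then Rgt b else if i = a then Lft c else Lft i)"

definition zigzag :: "nat \<Rightarrow> nat \<Rightarrow> nat \<Rightarrow> nat \<Rightarrow> diagram" where
  "zigzag n a b c = pairing n (zigzag_map a b c)"

lemma zigzag_involution:
  assumes "a < n" "b < n" "c < n" "distinct [a, b, c]"
  shows "node_involution n (zigzag_map a b c)"
proof
  fix v assume "v \<in> nodes n"
  then show "zigzag_map a b c v \<in> nodes n" "zigzag_map a b c (zigzag_map a b c v) = v" "zigzag_map a b c v \<noteq> v"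
    using assms by (cases v; auto simp: zigzag_map_def)+
qed

lemma zigzag_TL:
  assumes "a < n" "c < n" "b = Suc a \<and> c = Suc b \<or> a = Suc b \<and> b = Suc c"
  shows "zigzag n a b c \<in> TL_diagrams n"
  unfolding zigzag_def
proof (rule node_involution.pairing_TL[OF zigzag_involution])
  show "a < n" "b < n" "c < n" "distinct [a, b, c]" using assms by auto
  fix u w assume *: "u \<in> nodes n" "w \<in> nodes n" "boundary_pos n u < boundary_pos n w"
    "boundary_pos n w < boundary_pos n (zigzag_map a b c u)"
    "boundary_pos n (zigzag_map a b c u) < boundary_pos n (zigzag_map a b c w)"
  from assms(3) show False
  proof
    assume "b = Suc a \<and> c = Suc b"
    then show False
      using * assms(1,2) by (cases u; cases w)
        (simp_all add: zigzag_map_def boundary_pos_less del: boundary_pos.simps split: if_split_asm)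
  next
    assume "a = Suc b \<and> b = Suc c"
    then show False
      using * assms(1,2) by (cases u; cases w)
        (simp_all add: zigzag_map_def boundary_pos_less del: boundary_pos.simps split: if_split_asm)
  qed
qed

section \<open>Products that return one of their factors\<close>

lemma comp_left_absorb:
  assumes "x \<in> Brauer n" "y \<in> Brauer n"
    and "\<And>u v. {u, v} \<in> y \<Longrightarrow> (outer u, outer v) \<in> connected_rel x y"
  shows "comp_diagram n x y = y"
proof (rule Brauer_subset_eq[symmetric, OF assms(2) comp_Brauer[OF assms(1,2)]], rule subsetI)
  fix e assume e: "e \<in> y"
  then obtain u v where "e = {u, v}" "u \<noteq> v" "u \<in> nodes n" "v \<in> nodes n" by (rule Brauer_edgeE[OF assms(2)])
  then show "e \<in> comp_diagram n x y" using assms(3) e by (auto simp: comp_diagram_iff)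
qed

lemma comp_right_absorb:
  assumes "x \<in> Brauer n" "y \<in> Brauer n"
    and "\<And>u v. {u, v} \<in> x \<Longrightarrow> (outer u, outer v) \<in> connected_rel x y"
  shows "comp_diagram n x y = x"
proof (rule Brauer_subset_eq[symmetric, OF assms(1) comp_Brauer[OF assms(1,2)]], rule subsetI)
  fix e assume e: "e \<in> x"
  then obtain u v where "e = {u, v}" "u \<noteq> v" "u \<in> nodes n" "v \<in> nodes n" by (rule Brauer_edgeE[OF assms(1)])
  then show "e \<in> comp_diagram n x y" using assms(3) e by (auto simp: comp_diagram_iff)
qed

lemma loops_eq_0:
  assumes "\<And>i. i < n \<Longrightarrow> \<exists>p. (p, GMid i) \<in> connected_rel x y \<and> p \<notin> range GMid"
  shows "loops n x y = 0"
proof -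
  have "\<not> connected_rel x y `` {GMid i} \<subseteq> range GMid" if "i < n" for i
    using assms[OF that] connected_sym by blast
  then have "{C. (\<exists>i<n. C = connected_rel x y `` {GMid i}) \<and> C \<subseteq> range GMid} = {}" by blast
  then show ?thesis unfolding loops_def by simp
qed

context
  fixes n x assumes x: "x \<in> Brauer n"
begin

private lemma id_left_connected: "i < n \<Longrightarrow> (GLeft i, GMid i) \<in> connected_rel (id_diagram n) x"
  using connected_first[of "Lft i" "Rgt i" "id_diagram n" x] by (simp add: id_diagram_iff)

private lemma id_right_connected: "i < n \<Longrightarrow> (GRight i, GMid i) \<in> connected_rel x (id_diagram n)"
  using connected_second[of "Rgt i" "Lft i" "id_diagram n" x] by (simp add: id_diagram_iff)

lemma comp_id_left: "comp_diagram n (id_diagram n) x = x"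
proof (rule comp_left_absorb[OF TL_diagramsD(1)[OF id_TL] x])
  fix u v assume uv: "{u, v} \<in> x"
  have "(outer w, in_second w) \<in> connected_rel (id_diagram n) x" if "w \<in> nodes n" for w
    using that id_left_connected by (cases w) auto
  then show "(outer u, outer v) \<in> connected_rel (id_diagram n) x"
    using connected_second[OF uv] Brauer_edgeD[OF x uv] connected_trans connected_sym by meson
qed

lemma comp_id_right: "comp_diagram n x (id_diagram n) = x"
proof (rule comp_right_absorb[OF x TL_diagramsD(1)[OF id_TL]])
  fix u v assume uv: "{u, v} \<in> x"
  have "(outer w, in_first w) \<in> connected_rel x (id_diagram n)" if "w \<in> nodes n" for w
    using that id_right_connected by (cases w) auto
  then show "(outer u, outer v) \<in> connected_rel x (id_diagram n)"
    using connected_first[OF uv] Brauer_edgeD[OF x uv] connected_trans connected_sym by meson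
qed

lemma loops_id_left: "loops n (id_diagram n) x = 0"
  using id_left_connected by (intro loops_eq_0) (metis gnode.distinct(1) rangeE)

lemma loops_id_right: "loops n x (id_diagram n) = 0"
  using id_right_connected by (intro loops_eq_0) (metis gnode.distinct(5) rangeE)

end

text \<open>A left-to-left edge of \<open>x\<close> lies outside the middle column and so survives
  every multiplication from the right. This makes the diagrams with prescribed left cups span right
  ideals.\<close>

lemma left_edge_comp:
  assumes "x \<in> Brauer n" "{Lft i, Lft j} \<in> x"
  shows "{Lft i, Lft j} \<in> comp_diagram n x y"
  using connected_first[OF assms(2), of y] Brauer_edgeD[OF assms] by (simp add: comp_diagram_iff)

context
  fixes n a b c d
  assumes abc: "a < n" "b < n" "c < n" "distinct [a, b, c]" and d: "d \<in> Brauer n"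
begin

private lemma zz: "zigzag n a b c \<in> Brauer n"
  unfolding zigzag_def by (rule node_involution.pairing_Brauer[OF zigzag_involution[OF abc]])

private lemma zz_iff: "{u, v} \<in> zigzag n a b c \<longleftrightarrow> u \<in> nodes n \<and> v = zigzag_map a b c u"
  unfolding zigzag_def by (rule node_involution.pairing_iff[OF zigzag_involution[OF abc]])

private lemma zz_connected:
  "\<lbrakk>i < n; i \<notin> {a, b, c}\<rbrakk> \<Longrightarrow> (GLeft i, GMid i) \<in> connected_rel (zigzag n a b c) d"
  "(GLeft c, GMid a) \<in> connected_rel (zigzag n a b c) d"
  "(GMid b, GMid c) \<in> connected_rel (zigzag n a b c) d"
  using connected_first[of "Lft i" "Rgt i" "zigzag n a b c" d]
    connected_first[of "Lft c" "Rgt a" "zigzag n a b c" d]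
    connected_first[of "Rgt b" "Rgt c" "zigzag n a b c" d] abc
  by (auto simp: zz_iff zigzag_map_def)

lemma zigzag_edge: "{Lft a, Lft b} \<in> comp_diagram n (zigzag n a b c) d"
  by (rule left_edge_comp[OF zz]) (use abc in \<open>simp add: zz_iff zigzag_map_def\<close>)

lemma zigzag_preserves:
  assumes "{Lft i, Lft j} \<in> d" "i \<notin> {a, b, c}" "j \<notin> {a, b, c}"
  shows "{Lft i, Lft j} \<in> comp_diagram n (zigzag n a b c) d"
proof -
  have ij: "i < n" "j < n" "i \<noteq> j" using Brauer_edgeD[OF d assms(1)] by auto
  have "(GMid i, GMid j) \<in> connected_rel (zigzag n a b c) d" using connected_second[OF assms(1)] by simp
  then have "(GLeft i, GLeft j) \<in> connected_rel (zigzag n a b c) d"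
    using zz_connected(1) ij assms(2,3) connected_trans connected_sym by meson
  then show ?thesis using ij by (simp add: comp_diagram_iff)
qed

context
  assumes cup: "{Lft a, Lft b} \<in> d"
begin

text \<open>The strand from the left node \<open>c\<close> runs to the middle node \<open>a\<close>,
  along the cup of \<open>d\<close> to \<open>b\<close>, and back along the right-hand edge of the
  zigzag to \<open>c\<close>.\<close>

private lemma zz_mid:
  "(GLeft c, GMid a) \<in> connected_rel (zigzag n a b c) d"
  "(GLeft c, GMid b) \<in> connected_rel (zigzag n a b c) d"
  "(GLeft c, GMid c) \<in> connected_rel (zigzag n a b c) d"
proof -
  have ab: "(GMid a, GMid b) \<in> connected_rel (zigzag n a b c) d" using connected_second[OF cup] by simp
  show "(GLeft c, GMid a) \<in> connected_rel (zigzag n a b c) d" by (rule zz_connected(2))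
  then show b: "(GLeft c, GMid b) \<in> connected_rel (zigzag n a b c) d" using ab by (rule connected_trans)
  show "(GLeft c, GMid c) \<in> connected_rel (zigzag n a b c) d" by (rule connected_trans[OF b zz_connected(3)])
qed

text \<open>Pulling the strand through \<open>a\<close>, \<open>b\<close>, \<open>c\<close> straight
  shows that the zigzag acts as the identity on everything except the cup \<open>{a, b}\<close>, and
  it supplies that cup itself.\<close>

lemma comp_zigzag: "comp_diagram n (zigzag n a b c) d = d"
proof (rule comp_left_absorb[OF zz d])
  fix u v assume uv: "{u, v} \<in> d"
  show "(outer u, outer v) \<in> connected_rel (zigzag n a b c) d"
  proof (cases "{u, v} = {Lft a, Lft b}")
    case True
    have "{Lft a, Lft b} \<in> zigzag n a b c" using abc by (simp add: zz_iff zigzag_map_def)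
    then show ?thesis using connected_first[of u v "zigzag n a b c" d] True
      by (auto simp: doubleton_eq_iff)
  next
    case False
    have *: "w \<noteq> Lft a \<and> w \<noteq> Lft b" if "w \<in> {u, v}" for w
      using Brauer_edge_unique[OF d uv cup that] False by auto
    have "(outer w, in_second w) \<in> connected_rel (zigzag n a b c) d" if "w \<in> nodes n" "w \<in> {u, v}" for w
    proof (cases w)
      case (Lft i)
      then show ?thesis using that *[OF that(2)] zz_connected(1)[of i] zz_mid(3) by (cases "i = c") auto
    qed simp
    then show ?thesis
      using connected_second[OF uv] Brauer_edgeD[OF d uv] connected_trans connected_sym by (meson insertCI)
  qed
qed

text \<open>Every middle node is connected to a left node. With no loop there is no power of
  \<delta>, which is why the retractions work for arbitrary \<delta>.\<close>

lemma loops_zigzag: "loops n (zigzag n a b c) d = 0"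
proof (rule loops_eq_0)
  fix i assume "i < n"
  then have "(GLeft (if i \<in> {a, b, c} then c else i), GMid i) \<in> connected_rel (zigzag n a b c) d"
    using zz_mid zz_connected(1) by auto
  then show "\<exists>p. (p, GMid i) \<in> connected_rel (zigzag n a b c) d \<and> p \<notin> range GMid" by blast
qed

end

end

section \<open>Left cups\<close>

abbreviation left_cup :: "nat \<Rightarrow> diagram \<Rightarrow> bool" where
  "left_cup i x \<equiv> {Lft i, Lft (Suc i)} \<in> x"

text \<open>By planarity the partner of \<open>Lft (Suc i)\<close> is trapped between
  \<open>i\<close> and \<open>j\<close> unless \<open>j = Suc i\<close>, which gives a shorter edge
  on the left.\<close>

lemma innermost_left_cup:
  assumes x: "x \<in> Brauer n" "planar n x"
  shows "\<lbrakk>{Lft i, Lft j} \<in> x; i < j\<rbrakk> \<Longrightarrow> \<exists>k. Suc k < n \<and> left_cup k x"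
proof (induction "j - i" arbitrary: i j rule: less_induct)
  case less
  note e = less.prems(1)
  have ij: "i < n" "j < n" using Brauer_edgeD[OF x(1) e] by auto
  show ?case
  proof (cases "j = Suc i")
    case True
    then show ?thesis using e ij by blast
  next
    case False
    obtain v where v: "{Lft (Suc i), v} \<in> x" "v \<in> nodes n"
      using Brauer_partner[OF x(1), of "Lft (Suc i)"] ij less.prems(2) by auto
    have ne: "v \<noteq> Lft i" "v \<noteq> Lft j" "v \<noteq> Lft (Suc i)"
      using Brauer_partner_unique[OF x(1), of "Lft i" "Lft j" "Lft (Suc i)"]
        Brauer_partner_unique[OF x(1), of "Lft j" "Lft i" "Lft (Suc i)"] e v(1) False less.prems(2)
        Brauer_edgeD(1)[OF x(1) v(1)] by (auto simp: insert_commute)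
    show ?thesis
    proof (cases v)
      case (Lft k)
      have "\<not> k < i"
        using planarD[OF x(2), of v "Lft (Suc i)" "Lft i" "Lft j"] v(1) e Lft less.prems(2) False
        by (auto simp: insert_commute)
      moreover have "\<not> j < k"
        using planarD[OF x(2) e v(1)] Lft less.prems(2) False by auto
      ultimately have "Suc i < k" "k < j" using ne Lft by auto
      then show ?thesis using less.hyps[of k "Suc i"] v(1) Lft by auto
    next
      case (Rgt k)
      then show ?thesis
        using planarD[OF x(2) e v(1)] less.prems(2) False ij v(2)
        by (simp add: boundary_pos_less del: boundary_pos.simps)
    qed
  qed
qed

lemma strict_mono_below_id:
  fixes s :: "nat \<Rightarrow> nat"
  assumes "\<And>i. i < n \<Longrightarrow> s i < n" "\<And>i j. \<lbrakk>i < j; j < n\<rbrakk> \<Longrightarrow> s i < s j" "i < n"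
  shows "s i = i"
proof -
  have le: "s i + k \<le> s (i + k)" if "i + k < n" for i k
    using that
  proof (induction k)
    case (Suc k)
    then show ?case using assms(2)[of "i + k" "i + Suc k"] by simp
  qed simp
  have "s i + (n - 1 - i) < n" using le[of i "n - 1 - i"] assms(1)[of "n - 1"] assms(3) by simp
  then show ?thesis using le[of 0 i] assms(3) by simp
qed

text \<open>Without left-to-left edges every left node is joined to a right node. By planarity this
  map \<open>s\<close> is strictly increasing, and the identity is the only such map from
  \<open>{..<n}\<close> to itself.\<close>

lemma TL_not_id_left_cup:
  assumes x: "x \<in> TL_diagrams n" and "x \<noteq> id_diagram n"
  shows "\<exists>k. Suc k < n \<and> left_cup k x"
proof (rule ccontr)
  note xB = TL_diagramsD[OF x]
  assume "\<not> ?thesis"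
  then have no: "{Lft i, Lft j} \<notin> x" for i j
    using innermost_left_cup[OF xB, of i j] innermost_left_cup[OF xB, of j i] Brauer_edgeD(1)[OF xB(1), of "Lft i" "Lft j"]
    by (cases i j rule: linorder_cases) (auto simp: insert_commute)
  have "\<exists>j<n. {Lft i, Rgt j} \<in> x" if "i < n" for i
  proof -
    have "Lft i \<in> nodes n" using that by simp
    then obtain v where "{Lft i, v} \<in> x" "v \<in> nodes n" using Brauer_partner[OF xB(1)] by metis
    then show ?thesis using no by (cases v) auto
  qed
  then obtain s where s: "\<And>i. i < n \<Longrightarrow> s i < n" "\<And>i. i < n \<Longrightarrow> {Lft i, Rgt (s i)} \<in> x" by metis
  have "s i < s j" if "i < j" "j < n" for i j
  proof (rule ccontr)
    assume "\<not> s i < s j"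
    moreover have "s i \<noteq> s j"
      using Brauer_partner_unique[OF xB(1), of "Rgt (s i)" "Lft i" "Lft j"] s(2)[of i] s(2)[of j] that
      by (auto simp: insert_commute)
    ultimately show False
      using planarD[OF xB(2) s(2)[of i] s(2)[of j]] s(1)[of i] s(1)[of j] that
      by (simp add: boundary_pos_less del: boundary_pos.simps)
  qed
  then have "s i = i" if "i < n" for i using strict_mono_below_id[of n s i] s(1) that by blast
  then have "id_diagram n \<subseteq> x" using s(2) by (auto simp: id_diagram_def)
  then show False using Brauer_subset_eq[OF TL_diagramsD(1)[OF id_TL] xB(1)] assms(2) by simp
qed

lemma left_cup_not_id: "Suc k < n \<Longrightarrow> left_cup k x \<Longrightarrow> x \<noteq> id_diagram n"
  by (auto simp: id_diagram_iff)

lemma has_ll_or_rr_iff: "x \<in> TL_diagrams n \<Longrightarrow> has_ll_or_rr x \<longleftrightarrow> x \<noteq> id_diagram n"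
  using TL_not_id_left_cup[of x n] by (auto simp: has_ll_or_rr_def id_diagram_iff)

text \<open>A left cup of \<open>x\<close> would persist in the product. This is what makes the
  coefficient of the identity diagram multiplicative (\<open>TL_mult_id\<close>).\<close>

lemma comp_eq_id:
  assumes x: "x \<in> TL_diagrams n" and y: "y \<in> TL_diagrams n" and "comp_diagram n x y = id_diagram n"
  shows "x = id_diagram n \<and> y = id_diagram n"
proof -
  have "x = id_diagram n"
  proof (rule ccontr)
    assume "x \<noteq> id_diagram n"
    then obtain k where "Suc k < n" "left_cup k x" using TL_not_id_left_cup[OF x] by blast
    then have "left_cup k (comp_diagram n x y)" using left_edge_comp[OF TL_diagramsD(1)[OF x]] by blast
    then show False using left_cup_not_id[OF \<open>Suc k < n\<close>] assms(3) by blast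
  qed
  then show ?thesis using assms(3) comp_id_left[OF TL_diagramsD(1)[OF y]] by simp
qed

section \<open>Left-to-right connections in products\<close>

lemma has_lr_id: "0 < n \<Longrightarrow> has_lr (id_diagram n)"
  unfolding has_lr_def by (intro exI[of _ 0]) (simp add: id_diagram_iff)

text \<open>Follow the path from the left column to the right one: if \<open>x\<close> had no such
  connection, it could not leave the left column, and if \<open>y\<close> had none, it could not
  reach the right column. Hence \<open>I0\<close> is a two-sided ideal.\<close>

lemma has_lr_comp:
  assumes "has_lr (comp_diagram n x y)"
  shows "has_lr x" "has_lr y"
proof -
  obtain i j where "(outer (Lft i), outer (Rgt j)) \<in> connected_rel x y"
    using assms by (auto simp: has_lr_def comp_diagram_iff)
  then have c: "(GLeft i, GRight j) \<in> connected_rel x y" by simp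
  show "has_lr x"
  proof (rule ccontr)
    assume no: "\<not> has_lr x"
    from c have "GRight j \<in> range GLeft"
    proof (induction rule: connected_induct)
      case (first u v)
      then show ?case using no by (cases u; cases v) (auto simp: has_lr_def)
    next
      case (second u v)
      then show ?case by (cases u) auto
    qed simp
    then show False by auto
  qed
  show "has_lr y"
  proof (rule ccontr)
    assume no: "\<not> has_lr y"
    from c have "GRight j \<notin> range GRight"
    proof (induction rule: connected_induct)
      case (first u v)
      then show ?case by (cases v) auto
    next
      case (second u v)
      then show ?case using no by (cases u; cases v) (auto simp: has_lr_def)
    qed auto
    then show False by auto
  qed
qed

section \<open>The Temperley-Lieb algebra\<close>

lemma (in abelian_monoid) finsum_swap:
  assumes "finite A" "finite B" "\<And>x y. \<lbrakk>x \<in> A; y \<in> B\<rbrakk> \<Longrightarrow> f x y \<in> carrier G"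
  shows "(\<Oplus>x\<in>A. \<Oplus>y\<in>B. f x y) = (\<Oplus>y\<in>B. \<Oplus>x\<in>A. f x y)"
  using assms(1,3)
proof (induction A rule: finite_induct)
  case (insert a A)
  then have "(\<Oplus>x\<in>insert a A. \<Oplus>y\<in>B. f x y) = (\<Oplus>y\<in>B. f a y) \<oplus> (\<Oplus>y\<in>B. \<Oplus>x\<in>A. f x y)"
    by (subst finsum_insert) (auto intro!: finsum_closed)
  also have "\<dots> = (\<Oplus>y\<in>B. f a y \<oplus> (\<Oplus>x\<in>A. f x y))"
    using insert.prems by (intro finsum_addf[symmetric]) (auto intro!: finsum_closed)
  also have "\<dots> = (\<Oplus>y\<in>B. \<Oplus>x\<in>insert a A. f x y)"
    using insert by (intro finsum_cong') (auto intro!: finsum_closed)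
  finally show ?case .
qed simp

locale temperley_lieb = R: cring R for R :: "('r, 's) ring_scheme" (structure) +
  fixes \<delta> :: 'r and n :: nat
  assumes \<delta>: "\<delta> \<in> carrier R" and n: "n > 0"
begin

abbreviation "D \<equiv> TL_diagrams n"
abbreviation "TLA \<equiv> TL R \<delta> n"

lemma finite_D [simp]: "finite D"
  by (rule finite_subset[OF _ finite_Brauer[of n]]) (auto simp: TL_diagrams_def)

definition structure_const :: "diagram \<Rightarrow> diagram \<Rightarrow> diagram \<Rightarrow> 'r" where
  "structure_const x y d = (if comp_diagram n x y = d then \<delta> [^] loops n x y else \<zero>)"

lemma structure_const_closed [simp]: "structure_const x y d \<in> carrier R"
  using \<delta> by (simp add: structure_const_def)

lemma TL_carrier_iff: "f \<in> carrier TLA \<longleftrightarrow> (\<forall>d\<in>D. f d \<in> carrier R) \<and> (\<forall>d. d \<notin> D \<longrightarrow> f d = \<zero>)"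
  by (auto simp: TL_def)

lemma TL_val: "f \<in> carrier TLA \<Longrightarrow> f d \<in> carrier R"
  by (cases "d \<in> D") (auto simp: TL_carrier_iff)

lemma TL_zero: "\<zero>\<^bsub>TLA\<^esub> = (\<lambda>_. \<zero>)" and TL_one: "\<one>\<^bsub>TLA\<^esub> = (\<lambda>d. if d = id_diagram n then \<one> else \<zero>)"
  and TL_add: "f \<oplus>\<^bsub>TLA\<^esub> g = (\<lambda>d. f d \<oplus> g d)"
  by (simp_all add: TL_def)

lemma TL_mult:
  assumes f: "f \<in> carrier TLA" and g: "g \<in> carrier TLA"
  shows "(f \<otimes>\<^bsub>TLA\<^esub> g) d = (\<Oplus>x\<in>D. f x \<otimes> (\<Oplus>y\<in>D. g y \<otimes> structure_const x y d))"
proof -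
  note v = TL_val[OF f] TL_val[OF g]
  have "(f \<otimes>\<^bsub>TLA\<^esub> g) d = (\<Oplus>x\<in>D. \<Oplus>y\<in>D. if comp_diagram n x y = d then \<delta> [^] loops n x y \<otimes> (f x \<otimes> g y) else \<zero>)"
    by (simp add: TL_def)
  also have "\<dots> = (\<Oplus>x\<in>D. \<Oplus>y\<in>D. f x \<otimes> (g y \<otimes> structure_const x y d))"
    using v \<delta> by (intro R.finsum_cong' refl) (auto simp: structure_const_def R.m_ac intro!: R.finsum_closed)
  also have "\<dots> = (\<Oplus>x\<in>D. f x \<otimes> (\<Oplus>y\<in>D. g y \<otimes> structure_const x y d))"
    using v by (intro R.finsum_cong' refl R.finsum_rdistr[symmetric]) (auto intro!: R.finsum_closed)
  finally show ?thesis .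
qed

lemma finsum_structure_const:
  assumes "x \<in> D" "y \<in> D" "\<And>d. d \<in> D \<Longrightarrow> \<phi> d \<in> carrier R"
  shows "(\<Oplus>d\<in>D. structure_const x y d \<otimes> \<phi> d) = \<delta> [^] loops n x y \<otimes> \<phi> (comp_diagram n x y)"
proof -
  have c: "comp_diagram n x y \<in> D" using comp_TL assms by blast
  have "(\<Oplus>d\<in>D. structure_const x y d \<otimes> \<phi> d)
      = (\<Oplus>d\<in>D. if comp_diagram n x y = d then \<delta> [^] loops n x y \<otimes> \<phi> d else \<zero>)"
    using assms \<delta> by (intro R.finsum_cong' refl) (auto simp: structure_const_def)
  also have "\<dots> = \<delta> [^] loops n x y \<otimes> \<phi> (comp_diagram n x y)"
    using assms \<delta> c by (intro R.finsum_singleton) auto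
  finally show ?thesis .
qed

lemma finsum_D_mult_right:
  "\<lbrakk>\<And>x. x \<in> D \<Longrightarrow> F x \<in> carrier R; a \<in> carrier R\<rbrakk> \<Longrightarrow> (\<Oplus>x\<in>D. F x) \<otimes> a = (\<Oplus>x\<in>D. F x \<otimes> a)"
  by (rule R.finsum_ldistr) auto

lemma finsum_D_mult_left:
  "\<lbrakk>\<And>x. x \<in> D \<Longrightarrow> F x \<in> carrier R; a \<in> carrier R\<rbrakk> \<Longrightarrow> a \<otimes> (\<Oplus>x\<in>D. F x) = (\<Oplus>x\<in>D. a \<otimes> F x)"
  by (rule R.finsum_rdistr) auto

lemma finsum_D_cong: "\<lbrakk>\<And>x. x \<in> D \<Longrightarrow> F x = G x; \<And>x. x \<in> D \<Longrightarrow> G x \<in> carrier R\<rbrakk> \<Longrightarrow> (\<Oplus>x\<in>D. F x) = (\<Oplus>x\<in>D. G x)"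
  by (rule R.finsum_cong') auto

lemma finsum_D_closed: "(\<And>x. x \<in> D \<Longrightarrow> F x \<in> carrier R) \<Longrightarrow> (\<Oplus>x\<in>D. F x) \<in> carrier R"
  by (rule R.finsum_closed) auto

text \<open>Extending a function on diagrams to a linear functional turns associativity into an identity of
  triple sums without an inner sum over the intermediate product.\<close>

lemma finsum_TL_mult:
  assumes f: "f \<in> carrier TLA" and g: "g \<in> carrier TLA" and \<phi>: "\<And>d. d \<in> D \<Longrightarrow> \<phi> d \<in> carrier R"
  shows "(\<Oplus>d\<in>D. (f \<otimes>\<^bsub>TLA\<^esub> g) d \<otimes> \<phi> d)
    = (\<Oplus>x\<in>D. f x \<otimes> (\<Oplus>y\<in>D. g y \<otimes> (\<delta> [^] loops n x y \<otimes> \<phi> (comp_diagram n x y))))"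
proof -
  note v = TL_val[OF f] TL_val[OF g]
  let ?c = structure_const
  have "(\<Oplus>d\<in>D. (f \<otimes>\<^bsub>TLA\<^esub> g) d \<otimes> \<phi> d) = (\<Oplus>d\<in>D. \<Oplus>x\<in>D. f x \<otimes> (\<Oplus>y\<in>D. g y \<otimes> (?c x y d \<otimes> \<phi> d)))"
    using v \<phi> by (intro finsum_D_cong)
      (auto simp: TL_mult[OF f g] finsum_D_mult_right finsum_D_closed R.m_assoc intro!: finsum_D_cong)
  also have "\<dots> = (\<Oplus>x\<in>D. \<Oplus>d\<in>D. f x \<otimes> (\<Oplus>y\<in>D. g y \<otimes> (?c x y d \<otimes> \<phi> d)))"
    using v \<phi> by (intro R.finsum_swap) (auto intro!: finsum_D_closed)
  also have "\<dots> = (\<Oplus>x\<in>D. f x \<otimes> (\<Oplus>y\<in>D. \<Oplus>d\<in>D. g y \<otimes> (?c x y d \<otimes> \<phi> d)))"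
  proof (rule finsum_D_cong)
    fix x assume x: "x \<in> D"
    have "(\<Oplus>d\<in>D. f x \<otimes> (\<Oplus>y\<in>D. g y \<otimes> (?c x y d \<otimes> \<phi> d))) = f x \<otimes> (\<Oplus>d\<in>D. \<Oplus>y\<in>D. g y \<otimes> (?c x y d \<otimes> \<phi> d))"
      using v \<phi> by (intro finsum_D_mult_left[symmetric]) (auto intro!: finsum_D_closed)
    also have "(\<Oplus>d\<in>D. \<Oplus>y\<in>D. g y \<otimes> (?c x y d \<otimes> \<phi> d)) = (\<Oplus>y\<in>D. \<Oplus>d\<in>D. g y \<otimes> (?c x y d \<otimes> \<phi> d))"
      using v \<phi> by (intro R.finsum_swap) auto
    finally show "(\<Oplus>d\<in>D. f x \<otimes> (\<Oplus>y\<in>D. g y \<otimes> (?c x y d \<otimes> \<phi> d))) = f x \<otimes> (\<Oplus>y\<in>D. \<Oplus>d\<in>D. g y \<otimes> (?c x y d \<otimes> \<phi> d))" .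
  qed (use v \<phi> in \<open>auto intro!: finsum_D_closed R.m_closed\<close>)
  also have "\<dots> = (\<Oplus>x\<in>D. f x \<otimes> (\<Oplus>y\<in>D. g y \<otimes> (\<delta> [^] loops n x y \<otimes> \<phi> (comp_diagram n x y))))"
  proof -
    have "(\<Oplus>d\<in>D. g y \<otimes> (?c x y d \<otimes> \<phi> d)) = g y \<otimes> (\<delta> [^] loops n x y \<otimes> \<phi> (comp_diagram n x y))"
      if "x \<in> D" "y \<in> D" for x y
    proof -
      have "(\<Oplus>d\<in>D. g y \<otimes> (?c x y d \<otimes> \<phi> d)) = g y \<otimes> (\<Oplus>d\<in>D. ?c x y d \<otimes> \<phi> d)"
        using v \<phi> by (intro finsum_D_mult_left[symmetric]) auto
      then show ?thesis using finsum_structure_const[OF that \<phi>] by simp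
    qed
    then show ?thesis
      using v \<phi> \<delta> comp_TL by (intro finsum_D_cong arg_cong2[where f = "(\<otimes>)"] refl) (auto intro!: finsum_D_closed R.m_closed)
  qed
  finally show ?thesis .
qed

lemma TL_mult_closed:
  assumes f: "f \<in> carrier TLA" and g: "g \<in> carrier TLA"
  shows "f \<otimes>\<^bsub>TLA\<^esub> g \<in> carrier TLA"
  unfolding TL_carrier_iff
proof (intro conjI ballI allI impI)
  note v = TL_val[OF f] TL_val[OF g]
  show "(f \<otimes>\<^bsub>TLA\<^esub> g) d \<in> carrier R" for d
    unfolding TL_mult[OF f g] using v by (intro finsum_D_closed R.m_closed) auto
  fix d assume d: "d \<notin> D"
  have "(f \<otimes>\<^bsub>TLA\<^esub> g) d = (\<Oplus>x\<in>D. \<zero>)"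
    unfolding TL_mult[OF f g]
  proof (rule finsum_D_cong)
    fix x assume x: "x \<in> D"
    have "(\<Oplus>y\<in>D. g y \<otimes> structure_const x y d) = (\<Oplus>y\<in>D. \<zero>)"
      using comp_TL[OF x] d v by (intro finsum_D_cong) (auto simp: structure_const_def)
    then show "f x \<otimes> (\<Oplus>y\<in>D. g y \<otimes> structure_const x y d) = \<zero>" using v by simp
  qed auto
  then show "(f \<otimes>\<^bsub>TLA\<^esub> g) d = \<zero>" by simp
qed

lemma TL_mult_assoc:
  assumes f: "f \<in> carrier TLA" and g: "g \<in> carrier TLA" and h: "h \<in> carrier TLA"
  shows "(f \<otimes>\<^bsub>TLA\<^esub> g) \<otimes>\<^bsub>TLA\<^esub> h = f \<otimes>\<^bsub>TLA\<^esub> (g \<otimes>\<^bsub>TLA\<^esub> h)"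
proof
  fix d
  note v = TL_val[OF f] TL_val[OF g] TL_val[OF h]
  let ?c = structure_const
  have "((f \<otimes>\<^bsub>TLA\<^esub> g) \<otimes>\<^bsub>TLA\<^esub> h) d = (\<Oplus>w\<in>D. (f \<otimes>\<^bsub>TLA\<^esub> g) w \<otimes> (\<Oplus>z\<in>D. h z \<otimes> ?c w z d))"
    by (rule TL_mult[OF TL_mult_closed[OF f g] h])
  also have "\<dots> = (\<Oplus>x\<in>D. f x \<otimes> (\<Oplus>y\<in>D. g y \<otimes> (\<delta> [^] loops n x y \<otimes> (\<Oplus>z\<in>D. h z \<otimes> ?c (comp_diagram n x y) z d))))"
    using v by (intro finsum_TL_mult[OF f g]) (auto intro!: finsum_D_closed)
  also have "\<dots> = (\<Oplus>x\<in>D. f x \<otimes> (\<Oplus>y\<in>D. g y \<otimes> (\<Oplus>z\<in>D. h z \<otimes> (\<delta> [^] loops n y z \<otimes> ?c x (comp_diagram n y z) d))))"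
  proof (intro finsum_D_cong arg_cong2[where f = "(\<otimes>)"] refl)
    fix x y assume x: "x \<in> D" and y: "y \<in> D"
    \<comment> \<open>For each triple of diagrams the two bracketings give the same diagram by
      \<open>comp_assoc\<close> and the same total exponent of \<delta> by
      \<open>loops_assoc\<close>.\<close>
    have "\<delta> [^] loops n x y \<otimes> ?c (comp_diagram n x y) z d = \<delta> [^] loops n y z \<otimes> ?c x (comp_diagram n y z) d"
      if z: "z \<in> D" for z
      using comp_assoc[of x n y z] loops_assoc[of x n y z] TL_diagramsD(1)[OF x] TL_diagramsD(1)[OF y] TL_diagramsD(1)[OF z] \<delta>
      by (simp add: structure_const_def R.nat_pow_mult)
    then have "\<delta> [^] loops n x y \<otimes> (h z \<otimes> ?c (comp_diagram n x y) z d) = h z \<otimes> (\<delta> [^] loops n y z \<otimes> ?c x (comp_diagram n y z) d)"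
      if z: "z \<in> D" for z
      using that v \<delta> by (metis R.m_lcomm R.nat_pow_closed structure_const_closed)
    then show "\<delta> [^] loops n x y \<otimes> (\<Oplus>z\<in>D. h z \<otimes> ?c (comp_diagram n x y) z d)
      = (\<Oplus>z\<in>D. h z \<otimes> (\<delta> [^] loops n y z \<otimes> ?c x (comp_diagram n y z) d))"
      using v \<delta> by (subst finsum_D_mult_left) (auto intro!: finsum_D_cong)
  qed (use v \<delta> in \<open>auto intro!: finsum_D_closed R.m_closed\<close>)
  also have "\<dots> = (\<Oplus>x\<in>D. f x \<otimes> (\<Oplus>w\<in>D. (g \<otimes>\<^bsub>TLA\<^esub> h) w \<otimes> ?c x w d))"
    using v TL_val[OF TL_mult_closed[OF g h]]
    by (intro finsum_D_cong arg_cong2[where f = "(\<otimes>)"] refl finsum_TL_mult[OF g h, symmetric])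
      (auto intro!: finsum_D_closed R.m_closed)
  also have "\<dots> = (f \<otimes>\<^bsub>TLA\<^esub> (g \<otimes>\<^bsub>TLA\<^esub> h)) d"
    by (rule TL_mult[OF f TL_mult_closed[OF g h], symmetric])
  finally show "((f \<otimes>\<^bsub>TLA\<^esub> g) \<otimes>\<^bsub>TLA\<^esub> h) d = (f \<otimes>\<^bsub>TLA\<^esub> (g \<otimes>\<^bsub>TLA\<^esub> h)) d" .
qed

section \<open>Basis elements and the ring axioms\<close>

definition basis :: "diagram \<Rightarrow> diagram \<Rightarrow> 'r" where
  "basis x = (\<lambda>d. if d = x then \<one> else \<zero>)"

lemma basis_closed: "x \<in> D \<Longrightarrow> basis x \<in> carrier TLA"
  by (auto simp: basis_def TL_carrier_iff)

lemma basis_mult: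
  assumes x: "x \<in> D" and f: "f \<in> carrier TLA"
  shows "(basis x \<otimes>\<^bsub>TLA\<^esub> f) d = (\<Oplus>y\<in>D. f y \<otimes> structure_const x y d)"
proof -
  have "(basis x \<otimes>\<^bsub>TLA\<^esub> f) d = (\<Oplus>x'\<in>D. if x = x' then (\<Oplus>y\<in>D. f y \<otimes> structure_const x' y d) else \<zero>)"
    unfolding TL_mult[OF basis_closed[OF x] f] using TL_val[OF f]
    by (intro finsum_D_cong) (auto simp: basis_def finsum_D_closed)
  also have "\<dots> = (\<Oplus>y\<in>D. f y \<otimes> structure_const x y d)"
    using TL_val[OF f] x by (intro R.finsum_singleton) (auto simp: finsum_D_closed)
  finally show ?thesis .
qed

lemma TL_one_basis: "\<one>\<^bsub>TLA\<^esub> = basis (id_diagram n)"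
  by (simp add: TL_one basis_def)

lemma finsum_D_delta:
  assumes "F x \<in> carrier R" "\<And>y. y \<in> D \<Longrightarrow> y \<noteq> x \<Longrightarrow> F y = \<zero>" "x \<notin> D \<Longrightarrow> F x = \<zero>"
  shows "(\<Oplus>y\<in>D. F y) = F x"
proof (cases "x \<in> D")
  case True
  have F: "F y \<in> carrier R" if "y \<in> D" for y using assms(1,2) that by (cases "y = x") auto
  have "(\<Oplus>y\<in>D. F y) = (\<Oplus>y\<in>D. if x = y then F y else \<zero>)" using assms(2) F by (intro finsum_D_cong) auto
  also have "\<dots> = F x" using True F by (intro R.finsum_singleton) auto
  finally show ?thesis .
next
  case False
  then have "(\<Oplus>y\<in>D. F y) = (\<Oplus>y\<in>D. \<zero>)" using assms(2) by (intro finsum_D_cong) auto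
  then show ?thesis using assms(3) False by simp
qed

lemma TL_ring: "ring TLA"
proof (rule ringI)
  show "abelian_group TLA"
  proof (rule abelian_groupI)
    fix f assume f: "f \<in> carrier TLA"
    show "\<exists>g\<in>carrier TLA. g \<oplus>\<^bsub>TLA\<^esub> f = \<zero>\<^bsub>TLA\<^esub>"
      using f TL_val[OF f] by (intro bexI[of _ "\<lambda>d. \<ominus> f d"]) (auto simp: TL_add TL_zero TL_carrier_iff R.l_neg)
    show "\<zero>\<^bsub>TLA\<^esub> \<oplus>\<^bsub>TLA\<^esub> f = f" using TL_val[OF f] by (simp add: TL_add TL_zero)
  next
    fix f g h assume "f \<in> carrier TLA" "g \<in> carrier TLA" "h \<in> carrier TLA"
    note v = this[THEN TL_val]
    show "f \<oplus>\<^bsub>TLA\<^esub> g \<oplus>\<^bsub>TLA\<^esub> h = f \<oplus>\<^bsub>TLA\<^esub> (g \<oplus>\<^bsub>TLA\<^esub> h)" using v by (simp add: TL_add R.a_assoc)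
  next
    fix f g assume fg: "f \<in> carrier TLA" "g \<in> carrier TLA"
    note v = fg[THEN TL_val]
    show "f \<oplus>\<^bsub>TLA\<^esub> g = g \<oplus>\<^bsub>TLA\<^esub> f" using v by (simp add: TL_add R.a_comm)
    show "f \<oplus>\<^bsub>TLA\<^esub> g \<in> carrier TLA" using fg by (auto simp: TL_add TL_carrier_iff)
  qed (auto simp: TL_zero TL_carrier_iff)
  show "Group.monoid TLA"
  proof (rule monoidI)
    show "\<one>\<^bsub>TLA\<^esub> \<in> carrier TLA" unfolding TL_one_basis by (rule basis_closed[OF id_TL])
    fix f assume f: "f \<in> carrier TLA"
    show "\<one>\<^bsub>TLA\<^esub> \<otimes>\<^bsub>TLA\<^esub> f = f"
    proof
      fix d
      have id: "structure_const (id_diagram n) y d = (if y = d then \<one> else \<zero>)" if "y \<in> D" for y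
        using comp_id_left[of y n] loops_id_left[of y n] TL_diagramsD(1)[OF that] by (auto simp: structure_const_def)
      have "(\<Oplus>y\<in>D. f y \<otimes> structure_const (id_diagram n) y d) = (\<Oplus>y\<in>D. if y = d then f y else \<zero>)"
        using TL_val[OF f] by (intro finsum_D_cong) (auto simp: id)
      also have "\<dots> = f d" using f TL_val[OF f] finsum_D_delta[of "\<lambda>y. if y = d then f y else \<zero>" d]
        by (auto simp: TL_carrier_iff)
      finally show "(\<one>\<^bsub>TLA\<^esub> \<otimes>\<^bsub>TLA\<^esub> f) d = f d"
        unfolding TL_one_basis basis_mult[OF id_TL f] .
    qed
    show "f \<otimes>\<^bsub>TLA\<^esub> \<one>\<^bsub>TLA\<^esub> = f"
    proof
      fix d
      have id: "structure_const x (id_diagram n) d = (if x = d then \<one> else \<zero>)" if "x \<in> D" for x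
        using comp_id_right[of x n] loops_id_right[of x n] TL_diagramsD(1)[OF that] by (auto simp: structure_const_def)
      have "(\<Oplus>y\<in>D. basis (id_diagram n) y \<otimes> structure_const x y d) = (if x = d then \<one> else \<zero>)" if x: "x \<in> D" for x
        using finsum_D_delta[of "\<lambda>y. basis (id_diagram n) y \<otimes> structure_const x y d" "id_diagram n"] id[OF x] id_TL
        by (auto simp: basis_def)
      then have "(f \<otimes>\<^bsub>TLA\<^esub> \<one>\<^bsub>TLA\<^esub>) d = (\<Oplus>x\<in>D. if x = d then f x else \<zero>)"
        unfolding TL_one_basis TL_mult[OF f basis_closed[OF id_TL]] using TL_val[OF f]
        by (intro finsum_D_cong) auto
      also have "\<dots> = f d" using f TL_val[OF f] finsum_D_delta[of "\<lambda>y. if y = d then f y else \<zero>" d]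
        by (auto simp: TL_carrier_iff)
      finally show "(f \<otimes>\<^bsub>TLA\<^esub> \<one>\<^bsub>TLA\<^esub>) d = f d" .
    qed
  qed (simp_all add: TL_mult_closed TL_mult_assoc)
  fix f g h assume f: "f \<in> carrier TLA" and g: "g \<in> carrier TLA" and h: "h \<in> carrier TLA"
  note v = TL_val[OF f] TL_val[OF g] TL_val[OF h]
  have add: "f \<oplus>\<^bsub>TLA\<^esub> g \<in> carrier TLA" using f g by (auto simp: TL_add TL_carrier_iff)
  let ?c = structure_const
  show "(f \<oplus>\<^bsub>TLA\<^esub> g) \<otimes>\<^bsub>TLA\<^esub> h = f \<otimes>\<^bsub>TLA\<^esub> h \<oplus>\<^bsub>TLA\<^esub> g \<otimes>\<^bsub>TLA\<^esub> h"
  proof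
    fix d
    have "((f \<oplus>\<^bsub>TLA\<^esub> g) \<otimes>\<^bsub>TLA\<^esub> h) d = (\<Oplus>x\<in>D. f x \<otimes> (\<Oplus>y\<in>D. h y \<otimes> ?c x y d) \<oplus> g x \<otimes> (\<Oplus>y\<in>D. h y \<otimes> ?c x y d))"
      unfolding TL_mult[OF add h] using v
      by (intro finsum_D_cong) (auto simp: TL_add R.l_distr finsum_D_closed)
    also have "\<dots> = (f \<otimes>\<^bsub>TLA\<^esub> h) d \<oplus> (g \<otimes>\<^bsub>TLA\<^esub> h) d"
      unfolding TL_mult[OF f h] TL_mult[OF g h] using v by (intro R.finsum_addf) (auto intro!: finsum_D_closed R.m_closed)
    finally show "((f \<oplus>\<^bsub>TLA\<^esub> g) \<otimes>\<^bsub>TLA\<^esub> h) d = (f \<otimes>\<^bsub>TLA\<^esub> h \<oplus>\<^bsub>TLA\<^esub> g \<otimes>\<^bsub>TLA\<^esub> h) d" by (simp add: TL_add)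
  qed
  show "h \<otimes>\<^bsub>TLA\<^esub> (f \<oplus>\<^bsub>TLA\<^esub> g) = h \<otimes>\<^bsub>TLA\<^esub> f \<oplus>\<^bsub>TLA\<^esub> h \<otimes>\<^bsub>TLA\<^esub> g"
  proof
    fix d
    have "(\<Oplus>y\<in>D. (f \<oplus>\<^bsub>TLA\<^esub> g) y \<otimes> ?c x y d) = (\<Oplus>y\<in>D. f y \<otimes> ?c x y d \<oplus> g y \<otimes> ?c x y d)" for x
      using v by (intro finsum_D_cong) (auto simp: TL_add R.l_distr)
    moreover have "(\<Oplus>y\<in>D. f y \<otimes> ?c x y d \<oplus> g y \<otimes> ?c x y d) = (\<Oplus>y\<in>D. f y \<otimes> ?c x y d) \<oplus> (\<Oplus>y\<in>D. g y \<otimes> ?c x y d)" for x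
      using v by (intro R.finsum_addf) auto
    ultimately have "(h \<otimes>\<^bsub>TLA\<^esub> (f \<oplus>\<^bsub>TLA\<^esub> g)) d
        = (\<Oplus>x\<in>D. h x \<otimes> (\<Oplus>y\<in>D. f y \<otimes> ?c x y d) \<oplus> h x \<otimes> (\<Oplus>y\<in>D. g y \<otimes> ?c x y d))"
      unfolding TL_mult[OF h add] using v
      by (intro finsum_D_cong) (auto simp: R.r_distr finsum_D_closed)
    also have "\<dots> = (h \<otimes>\<^bsub>TLA\<^esub> f) d \<oplus> (h \<otimes>\<^bsub>TLA\<^esub> g) d"
      unfolding TL_mult[OF h f] TL_mult[OF h g] using v by (intro R.finsum_addf) (auto intro!: finsum_D_closed R.m_closed)
    finally show "(h \<otimes>\<^bsub>TLA\<^esub> (f \<oplus>\<^bsub>TLA\<^esub> g)) d = (h \<otimes>\<^bsub>TLA\<^esub> f \<oplus>\<^bsub>TLA\<^esub> h \<otimes>\<^bsub>TLA\<^esub> g) d" by (simp add: TL_add)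
  qed
qed

sublocale TL: ring TLA by (rule TL_ring)


text \<open>Everything modulo \<open>I\<^sub>0\<close> is determined by the coefficients of the diagrams with a left-to-right
  connection.\<close>

abbreviation "I0 \<equiv> TL_I0 R \<delta> n"

lemma I0_iff: "f \<in> I0 \<longleftrightarrow> f \<in> carrier TLA \<and> (\<forall>d. has_lr d \<longrightarrow> f d = \<zero>)"
  by (simp add: TL_I0_def)

lemma TL_uminus:
  assumes "f \<in> carrier TLA" shows "\<ominus>\<^bsub>TLA\<^esub> f = (\<lambda>d. \<ominus> f d)"
proof (rule TL.minus_equality)
  show "(\<lambda>d. \<ominus> f d) \<oplus>\<^bsub>TLA\<^esub> f = \<zero>\<^bsub>TLA\<^esub>" using TL_val[OF assms] by (simp add: TL_add TL_zero R.l_neg)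
  show "(\<lambda>d. \<ominus> f d) \<in> carrier TLA" using assms by (auto simp: TL_carrier_iff)
qed (rule assms)

lemma structure_const_lr:
  assumes "structure_const x y d \<noteq> \<zero>" "has_lr d"
  shows "has_lr x" "has_lr y"
  using assms has_lr_comp[of n x y] by (auto simp: structure_const_def split: if_splits)

lemma I0_ideal: "ideal I0 TLA"
proof (rule idealI[OF TL_ring])
  show "subgroup I0 (add_monoid TLA)"
  proof (rule TL.add.subgroupI)
    show "I0 \<noteq> {}" using TL.zero_closed by (auto simp: I0_iff TL_zero)
    show "\<ominus>\<^bsub>TLA\<^esub> f \<in> I0" if "f \<in> I0" for f
      using that TL.a_inv_closed[of f] by (auto simp: I0_iff TL_uminus)
    show "f \<oplus>\<^bsub>TLA\<^esub> g \<in> I0" if "f \<in> I0" "g \<in> I0" for f g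
      using that TL.a_closed[of f g] by (auto simp: I0_iff TL_add)
  qed (auto simp: I0_iff)
  fix f g assume f: "f \<in> I0" and g: "g \<in> carrier TLA"
  then have fc: "f \<in> carrier TLA" by (simp add: I0_iff)
  note v = TL_val[OF fc] TL_val[OF g]
  have "(g \<otimes>\<^bsub>TLA\<^esub> f) d = \<zero>" if d: "has_lr d" for d
  proof -
    have "(\<Oplus>y\<in>D. f y \<otimes> structure_const x y d) = (\<Oplus>y\<in>D. \<zero>)" for x
    proof (rule finsum_D_cong)
      fix y show "f y \<otimes> structure_const x y d = \<zero>"
        using structure_const_lr(2)[OF _ d, of x y] f v by (cases "structure_const x y d = \<zero>") (auto simp: I0_iff)
    qed auto
    then show ?thesis using v by (simp add: TL_mult[OF g fc])
  qed
  then show "g \<otimes>\<^bsub>TLA\<^esub> f \<in> I0" using TL_mult_closed[OF g fc] by (simp add: I0_iff)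
  have "(f \<otimes>\<^bsub>TLA\<^esub> g) d = \<zero>" if d: "has_lr d" for d
  proof -
    have "(\<Oplus>x\<in>D. f x \<otimes> (\<Oplus>y\<in>D. g y \<otimes> structure_const x y d)) = (\<Oplus>x\<in>D. \<zero>)"
    proof (rule finsum_D_cong)
      fix x
      show "f x \<otimes> (\<Oplus>y\<in>D. g y \<otimes> structure_const x y d) = \<zero>"
      proof (cases "has_lr x")
        case True
        then show ?thesis using f v by (simp add: I0_iff finsum_D_closed)
      next
        case False
        then have "structure_const x y d = \<zero>" for y using structure_const_lr(1)[OF _ d, of x y] by blast
        then show ?thesis using v by simp
      qed
    qed auto
    then show ?thesis by (simp add: TL_mult[OF fc g])
  qed
  then show "f \<otimes>\<^bsub>TLA\<^esub> g \<in> I0" using TL_mult_closed[OF fc g] by (simp add: I0_iff)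
qed

sublocale I0: ideal I0 TLA by (rule I0_ideal)

section \<open>The quotient algebra and its subgroups spanned by diagrams\<close>

abbreviation "A \<equiv> TLA Quot I0"
abbreviation proj where "proj f \<equiv> I0 +>\<^bsub>TLA\<^esub> f"

lemma A_ring: "ring A"
  by (rule I0.quotient_is_ring)

lemma A_carrier: "carrier A = proj ` carrier TLA"
  by (auto simp: FactRing_def A_RCOSETS_def')

lemma mem_proj_iff:
  assumes f: "f \<in> carrier TLA"
  shows "h \<in> proj f \<longleftrightarrow> h \<in> carrier TLA \<and> (\<forall>d. has_lr d \<longrightarrow> h d = f d)"
proof
  assume "h \<in> proj f"
  then obtain k where "k \<in> I0" "h = k \<oplus>\<^bsub>TLA\<^esub> f" by (auto simp: a_r_coset_def')
  then show "h \<in> carrier TLA \<and> (\<forall>d. has_lr d \<longrightarrow> h d = f d)"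
    using f TL_val[OF f] TL.a_closed[of k f] by (auto simp: I0_iff TL_add)
next
  assume h: "h \<in> carrier TLA \<and> (\<forall>d. has_lr d \<longrightarrow> h d = f d)"
  then have "h \<ominus>\<^bsub>TLA\<^esub> f \<in> I0"
    using f TL_val[OF f] TL.minus_closed[of h f] by (auto simp: I0_iff a_minus_def TL_add TL_uminus R.r_neg)
  moreover have "h = (h \<ominus>\<^bsub>TLA\<^esub> f) \<oplus>\<^bsub>TLA\<^esub> f" using h f by (simp add: a_minus_def TL.a_assoc TL.l_neg)
  ultimately show "h \<in> proj f" unfolding a_r_coset_def' by blast
qed

lemma proj_eq_iff:
  assumes "f \<in> carrier TLA" "g \<in> carrier TLA"
  shows "proj f = proj g \<longleftrightarrow> (\<forall>d. has_lr d \<longrightarrow> f d = g d)"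
proof
  assume "proj f = proj g"
  then have "f \<in> proj g" using mem_proj_iff[OF assms(1), of f] assms(1) by simp
  then show "\<forall>d. has_lr d \<longrightarrow> f d = g d" using mem_proj_iff[OF assms(2)] by blast
qed (simp add: set_eq_iff mem_proj_iff[OF assms(1)] mem_proj_iff[OF assms(2)])

lemma proj_hom: "proj \<in> ring_hom TLA A"
  by (rule I0.rcos_ring_hom)

lemma A_mult: "\<lbrakk>f \<in> carrier TLA; g \<in> carrier TLA\<rbrakk> \<Longrightarrow> proj f \<otimes>\<^bsub>A\<^esub> proj g = proj (f \<otimes>\<^bsub>TLA\<^esub> g)"
  and A_add: "\<lbrakk>f \<in> carrier TLA; g \<in> carrier TLA\<rbrakk> \<Longrightarrow> proj f \<oplus>\<^bsub>A\<^esub> proj g = proj (f \<oplus>\<^bsub>TLA\<^esub> g)"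
  and A_one: "\<one>\<^bsub>A\<^esub> = proj \<one>\<^bsub>TLA\<^esub>"
  using ring_hom_mult[OF proj_hom] ring_hom_add[OF proj_hom] ring_hom_one[OF proj_hom] by auto

lemma A_zero: "\<zero>\<^bsub>A\<^esub> = proj \<zero>\<^bsub>TLA\<^esub>"
  using ring_hom_zero[OF proj_hom TL_ring A_ring] by simp

lemma A_uminus: "f \<in> carrier TLA \<Longrightarrow> \<ominus>\<^bsub>A\<^esub> proj f = proj (\<ominus>\<^bsub>TLA\<^esub> f)"
proof -
  assume f: "f \<in> carrier TLA"
  interpret A: ring A by (rule A_ring)
  show ?thesis
    using f by (intro A.minus_equality) (auto simp: A_add A_zero A_carrier TL.l_neg)
qed

text \<open>The image in \<open>A\<close> of the span of \<open>S\<close>. Coefficients of diagrams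
  without a left-to-right connection are ignored, so testing a single representative is enough
  (\<open>proj_in_span_iff\<close>). These spans turn intersections and unions of sets into
  intersections and sums (\<open>diagram_span_Int\<close>,
  \<open>diagram_span_split\<close>).\<close>

definition diagram_span :: "diagram set \<Rightarrow> (diagram \<Rightarrow> 'r) set set" where
  "diagram_span S = {K \<in> carrier A. \<forall>f\<in>K. \<forall>d. has_lr d \<longrightarrow> f d \<noteq> \<zero> \<longrightarrow> d \<in> S}"

lemma proj_in_span_iff:
  "f \<in> carrier TLA \<Longrightarrow> proj f \<in> diagram_span S \<longleftrightarrow> (\<forall>d. has_lr d \<longrightarrow> f d \<noteq> \<zero> \<longrightarrow> d \<in> S)"
  by (auto simp: diagram_span_def A_carrier mem_proj_iff)

lemma diagram_span_subset: "diagram_span S \<subseteq> carrier A"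
  by (auto simp: diagram_span_def)

lemma diagram_spanE:
  assumes "K \<in> diagram_span S"
  obtains f where "f \<in> carrier TLA" "K = proj f" "\<forall>d. has_lr d \<longrightarrow> f d \<noteq> \<zero> \<longrightarrow> d \<in> S"
proof -
  obtain f where f: "f \<in> carrier TLA" "K = proj f" using assms diagram_span_subset by (auto simp: A_carrier)
  then show thesis using assms proj_in_span_iff[of f S] that by blast
qed

lemma diagram_span_mono: "S \<subseteq> S' \<Longrightarrow> diagram_span S \<subseteq> diagram_span S'"
  by (auto simp: diagram_span_def)

lemma diagram_span_Int: "diagram_span S \<inter> diagram_span S' = diagram_span (S \<inter> S')"
  by (auto simp: diagram_span_def)

lemma diagram_span_UNIV: "diagram_span UNIV = carrier A"
  by (auto simp: diagram_span_def)

lemma diagram_span_add: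
  "\<lbrakk>K \<in> diagram_span S; L \<in> diagram_span S\<rbrakk> \<Longrightarrow> K \<oplus>\<^bsub>A\<^esub> L \<in> diagram_span S"
proof -
  assume KL: "K \<in> diagram_span S" "L \<in> diagram_span S"
  obtain f where f: "f \<in> carrier TLA" "K = proj f" "\<forall>d. has_lr d \<longrightarrow> f d \<noteq> \<zero> \<longrightarrow> d \<in> S"
    using KL(1) by (rule diagram_spanE)
  obtain g where g: "g \<in> carrier TLA" "L = proj g" "\<forall>d. has_lr d \<longrightarrow> g d \<noteq> \<zero> \<longrightarrow> d \<in> S"
    using KL(2) by (rule diagram_spanE)
  have "\<forall>d. has_lr d \<longrightarrow> (f \<oplus>\<^bsub>TLA\<^esub> g) d \<noteq> \<zero> \<longrightarrow> d \<in> S"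
  proof (intro allI impI)
    fix d assume d: "has_lr d" "(f \<oplus>\<^bsub>TLA\<^esub> g) d \<noteq> \<zero>"
    then have "f d \<noteq> \<zero> \<or> g d \<noteq> \<zero>" by (auto simp: TL_add)
    then show "d \<in> S" using f(3) g(3) d(1) by blast
  qed
  then show ?thesis using f(1,2) g(1,2) by (simp add: A_add proj_in_span_iff TL.a_closed)
qed

lemma diagram_span_split:
  assumes "K \<in> diagram_span (S \<union> S')"
  shows "\<exists>L\<in>diagram_span S. \<exists>L'\<in>diagram_span S'. K = L \<oplus>\<^bsub>A\<^esub> L'"
proof -
  obtain f where f: "f \<in> carrier TLA" "K = proj f" "\<forall>d. has_lr d \<longrightarrow> f d \<noteq> \<zero> \<longrightarrow> d \<in> S \<union> S'"
    using assms by (rule diagram_spanE)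
  let ?g = "\<lambda>d. if d \<in> S then f d else \<zero>" and ?h = "\<lambda>d. if d \<in> S then \<zero> else f d"
  have g: "?g \<in> carrier TLA" "?h \<in> carrier TLA" using f(1) by (auto simp: TL_carrier_iff)
  have "?g \<oplus>\<^bsub>TLA\<^esub> ?h = f" using TL_val[OF f(1)] by (auto simp: TL_add)
  then have "K = proj ?g \<oplus>\<^bsub>A\<^esub> proj ?h" using f(2) by (simp only: A_add[OF g])
  moreover have "proj ?g \<in> diagram_span S" "proj ?h \<in> diagram_span S'"
    using f(3) g by (auto simp: proj_in_span_iff split: if_splits)
  ultimately show ?thesis by blast
qed

lemma finsum_D_nonzero:
  "(\<Oplus>x\<in>D. F x) \<noteq> \<zero> \<Longrightarrow> \<exists>x\<in>D. F x \<noteq> \<zero>"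
  by (metis R.add.finprod_one_eqI)

lemma diagram_span_mult_right:
  assumes K: "K \<in> diagram_span S" and L: "L \<in> carrier A"
    and S: "\<And>x y. \<lbrakk>x \<in> D; y \<in> D; x \<in> S\<rbrakk> \<Longrightarrow> comp_diagram n x y \<in> S"
  shows "K \<otimes>\<^bsub>A\<^esub> L \<in> diagram_span S"
proof -
  obtain f where f: "f \<in> carrier TLA" "K = proj f" "\<forall>d. has_lr d \<longrightarrow> f d \<noteq> \<zero> \<longrightarrow> d \<in> S"
    using K by (rule diagram_spanE)
  obtain g where g: "g \<in> carrier TLA" "L = proj g" using L by (auto simp: A_carrier)
  have "d \<in> S" if d: "has_lr d" and nz: "(f \<otimes>\<^bsub>TLA\<^esub> g) d \<noteq> \<zero>" for d
  proof -
    obtain x where x: "x \<in> D" "f x \<otimes> (\<Oplus>y\<in>D. g y \<otimes> structure_const x y d) \<noteq> \<zero>"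
      using finsum_D_nonzero nz unfolding TL_mult[OF f(1) g(1)] by blast
    then have "f x \<noteq> \<zero>" "(\<Oplus>y\<in>D. g y \<otimes> structure_const x y d) \<noteq> \<zero>"
      using TL_val[OF f(1)] TL_val[OF g(1)] by (auto simp: finsum_D_closed)
    then obtain y where y: "y \<in> D" "g y \<otimes> structure_const x y d \<noteq> \<zero>" using finsum_D_nonzero by blast
    then have c: "structure_const x y d \<noteq> \<zero>" using TL_val[OF g(1)] by auto
    then have "comp_diagram n x y = d" by (auto simp: structure_const_def split: if_splits)
    \<comment> \<open>The condition on \<open>f\<close> concerns only diagrams with a left-to-right
      connection; \<open>x\<close> has one because the product \<open>d\<close> has one.\<close>
    then show ?thesis using S[OF x(1) y(1)] f(3) structure_const_lr(1)[OF c d] \<open>f x \<noteq> \<zero>\<close> by blast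
  qed
  then show ?thesis
    using f(1,2) g by (simp add: A_mult proj_in_span_iff TL_mult_closed)
qed

lemma basis_mult_span:
  assumes t: "t \<in> D" and K: "K \<in> diagram_span S"
    and S: "\<And>y. \<lbrakk>y \<in> D; y \<in> S\<rbrakk> \<Longrightarrow> comp_diagram n t y \<in> S'"
  shows "proj (basis t) \<otimes>\<^bsub>A\<^esub> K \<in> diagram_span S'"
proof -
  obtain f where f: "f \<in> carrier TLA" "K = proj f" "\<forall>d. has_lr d \<longrightarrow> f d \<noteq> \<zero> \<longrightarrow> d \<in> S"
    using K by (rule diagram_spanE)
  have "d \<in> S'" if d: "has_lr d" and nz: "(basis t \<otimes>\<^bsub>TLA\<^esub> f) d \<noteq> \<zero>" for d
  proof -
    obtain y where y: "y \<in> D" "f y \<otimes> structure_const t y d \<noteq> \<zero>"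
      using finsum_D_nonzero nz unfolding basis_mult[OF t f(1)] by blast
    then have c: "structure_const t y d \<noteq> \<zero>" "f y \<noteq> \<zero>" using TL_val[OF f(1)] by auto
    then have "comp_diagram n t y = d" by (auto simp: structure_const_def split: if_splits)
    then show ?thesis using S[OF y(1)] f(3) structure_const_lr(2)[OF c(1) d] c(2) by blast
  qed
  then show ?thesis
    using f(1,2) basis_closed[OF t] by (simp add: A_mult proj_in_span_iff TL_mult_closed)
qed

lemma basis_mult_span_id:
  assumes t: "t \<in> D" and K: "K \<in> diagram_span S"
    and S: "\<And>y. \<lbrakk>y \<in> D; y \<in> S\<rbrakk> \<Longrightarrow> comp_diagram n t y = y \<and> loops n t y = 0"
  shows "proj (basis t) \<otimes>\<^bsub>A\<^esub> K = K"
proof -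
  obtain f where f: "f \<in> carrier TLA" "K = proj f" "\<forall>d. has_lr d \<longrightarrow> f d \<noteq> \<zero> \<longrightarrow> d \<in> S"
    using K by (rule diagram_spanE)
  have "(basis t \<otimes>\<^bsub>TLA\<^esub> f) d = f d" if d: "has_lr d" for d
  proof -
    have "(\<Oplus>y\<in>D. f y \<otimes> structure_const t y d) = (\<Oplus>y\<in>D. if y = d then f y else \<zero>)"
    proof (rule finsum_D_cong)
      fix y assume y: "y \<in> D"
      show "f y \<otimes> structure_const t y d = (if y = d then f y else \<zero>)"
      proof (cases "f y = \<zero> \<or> structure_const t y d = \<zero> \<and> y \<noteq> d")
        case True
        then show ?thesis using TL_val[OF f(1)] by auto
      next
        case False
        then have "has_lr y" using structure_const_lr(2)[OF _ d, of t y] d by blast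
        then have "comp_diagram n t y = y \<and> loops n t y = 0" using S[OF y] f(3) False by blast
        then show ?thesis using TL_val[OF f(1)] by (auto simp: structure_const_def)
      qed
    qed (use TL_val[OF f(1)] in auto)
    also have "\<dots> = f d"
      using f(1) TL_val[OF f(1)] finsum_D_delta[of "\<lambda>y. if y = d then f y else \<zero>" d]
      by (auto simp: TL_carrier_iff)
    finally show ?thesis unfolding basis_mult[OF t f(1)] .
  qed
  then show ?thesis
    using f(1,2) basis_closed[OF t] by (simp add: A_mult proj_eq_iff TL_mult_closed)
qed

section \<open>The augmentation\<close>

lemma triv_scalar_eq: "f \<in> carrier TLA \<Longrightarrow> triv_scalar R n f = f (id_diagram n)"
  unfolding triv_scalar_def using TL_val[of f] id_TL[of n] has_ll_or_rr_iff[OF id_TL, of n]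
  by (subst finsum_D_delta[of _ "id_diagram n"]) (auto simp: has_ll_or_rr_iff)

definition eps :: "(diagram \<Rightarrow> 'r) set \<Rightarrow> 'r" where
  "eps K = the_elem (triv_scalar R n ` K)"

text \<open>For \<open>n > 0\<close> the identity diagram has a left-to-right connection, so its
  coefficient is the same for all representatives of a coset.\<close>

lemma eps_proj:
  assumes f: "f \<in> carrier TLA" shows "eps (proj f) = f (id_diagram n)"
proof -
  have "triv_scalar R n h = f (id_diagram n)" if "h \<in> proj f" for h
    using that mem_proj_iff[OF f, of h] has_lr_id[OF n] by (auto simp: triv_scalar_eq)
  moreover have "f \<in> proj f" using mem_proj_iff[OF f] f by blast
  ultimately have "triv_scalar R n ` proj f = {f (id_diagram n)}"
    by (intro equalityI subsetI) (auto intro: rev_image_eqI)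
  then show ?thesis by (simp add: eps_def)
qed

lemma TL_mult_id:
  assumes f: "f \<in> carrier TLA" and g: "g \<in> carrier TLA"
  shows "(f \<otimes>\<^bsub>TLA\<^esub> g) (id_diagram n) = f (id_diagram n) \<otimes> g (id_diagram n)"
proof -
  note v = TL_val[OF f] TL_val[OF g]
  let ?i = "id_diagram n"
  have c: "structure_const x y ?i = (if x = ?i \<and> y = ?i then \<one> else \<zero>)" if "x \<in> D" "y \<in> D" for x y
    using comp_eq_id[OF that] comp_id_left[of ?i n] loops_id_left[of ?i n] TL_diagramsD(1)[OF id_TL]
    by (auto simp: structure_const_def)
  have "(\<Oplus>y\<in>D. g y \<otimes> structure_const x y ?i) = (if x = ?i then g ?i else \<zero>)" if "x \<in> D" for x
    using v id_TL c[OF that] by (subst finsum_D_delta[of _ ?i]) auto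
  then have "(f \<otimes>\<^bsub>TLA\<^esub> g) ?i = (\<Oplus>x\<in>D. if x = ?i then f x \<otimes> g ?i else \<zero>)"
    unfolding TL_mult[OF f g] using v by (intro finsum_D_cong) auto
  also have "\<dots> = f ?i \<otimes> g ?i" using v id_TL by (subst finsum_D_delta[of _ ?i]) auto
  finally show ?thesis .
qed

lemma eps_hom: "eps \<in> ring_hom A R"
proof (rule ring_hom_memI)
  fix K L assume "K \<in> carrier A" "L \<in> carrier A"
  then obtain f g where fg: "f \<in> carrier TLA" "K = proj f" "g \<in> carrier TLA" "L = proj g" by (auto simp: A_carrier)
  show "eps K \<in> carrier R" using fg TL_val by (simp add: eps_proj)
  show "eps (K \<otimes>\<^bsub>A\<^esub> L) = eps K \<otimes> eps L" using fg by (simp add: eps_proj A_mult TL_mult_closed TL_mult_id)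
  show "eps (K \<oplus>\<^bsub>A\<^esub> L) = eps K \<oplus> eps L" using fg by (simp add: eps_proj A_add) (simp add: TL_add)
next
  show "eps \<one>\<^bsub>A\<^esub> = \<one>" by (simp add: A_one eps_proj) (simp add: TL_one)
qed

lemma eps_surj: "eps ` carrier A = carrier R"
proof
  show "eps ` carrier A \<subseteq> carrier R" using ring_hom_closed[OF eps_hom] by blast
  show "carrier R \<subseteq> eps ` carrier A"
  proof
    fix r assume r: "r \<in> carrier R"
    let ?f = "\<lambda>d. if d = id_diagram n then r else \<zero>"
    have f: "?f \<in> carrier TLA" using r id_TL by (auto simp: TL_carrier_iff)
    then have "eps (proj ?f) = r" by (simp add: eps_proj)
    then show "r \<in> eps ` carrier A" unfolding A_carrier by (rule image_eqI[OF sym imageI[OF f]])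
  qed
qed

text \<open>\<open>eps\<close> reads off the coefficient of the identity, and the identity is the
  only diagram without a left cup. The augmentation ideal is thereby covered by the right ideals
  belonging to single cups.\<close>

lemma eps_kernel: "{K \<in> carrier A. eps K = \<zero>} = diagram_span {d. \<exists>i. Suc i < n \<and> left_cup i d}"
proof (intro equalityI subsetI)
  fix K assume "K \<in> {K \<in> carrier A. eps K = \<zero>}"
  then obtain f where f: "f \<in> carrier TLA" "K = proj f" "f (id_diagram n) = \<zero>" by (auto simp: A_carrier eps_proj)
  have "\<exists>i. Suc i < n \<and> left_cup i d" if "f d \<noteq> \<zero>" for d
  proof (rule TL_not_id_left_cup)
    show "d \<in> D" using that f(1) by (auto simp: TL_carrier_iff)
    show "d \<noteq> id_diagram n" using that f(3) by blast
  qed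
  then show "K \<in> diagram_span {d. \<exists>i. Suc i < n \<and> left_cup i d}"
    unfolding f(2) proj_in_span_iff[OF f(1)] by blast
next
  fix K assume "K \<in> diagram_span {d. \<exists>i. Suc i < n \<and> left_cup i d}"
  then obtain f where f: "f \<in> carrier TLA" "K = proj f"
    "\<forall>d. has_lr d \<longrightarrow> f d \<noteq> \<zero> \<longrightarrow> d \<in> {d. \<exists>i. Suc i < n \<and> left_cup i d}"
    by (rule diagram_spanE)
  have "f (id_diagram n) = \<zero>" using f(3) has_lr_id[OF n] left_cup_not_id by blast
  then show "K \<in> {K \<in> carrier A. eps K = \<zero>}" using f(1,2) by (simp add: A_carrier eps_proj)
qed

end

section \<open>Acyclicity of the augmentation ideal\<close>

context temperley_lieb
begin

abbreviation "triv \<equiv> triv_module R n"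

lemma triv_simps:
  "carrier triv = carrier R" "\<zero>\<^bsub>triv\<^esub> = \<zero>" "x \<oplus>\<^bsub>triv\<^esub> y = x \<oplus> y" "K \<odot>\<^bsub>triv\<^esub> x = eps K \<otimes> x"
  by (simp_all add: triv_module_def eps_def)

lemma augmented: "augmented_ring A triv R eps"
proof (intro augmented_ring.intro augmented_ring_axioms.intro left_module.intro left_module_axioms.intro)
  show "abelian_group triv"
  proof (rule abelian_groupI)
    fix x y z assume "x \<in> carrier triv" "y \<in> carrier triv" "z \<in> carrier triv"
    then show "x \<oplus>\<^bsub>triv\<^esub> y \<oplus>\<^bsub>triv\<^esub> z = x \<oplus>\<^bsub>triv\<^esub> (y \<oplus>\<^bsub>triv\<^esub> z)" by (simp add: triv_simps R.a_assoc)
  qed (auto simp: triv_simps intro: R.a_comm R.l_neg bexI[of _ "\<ominus> x" for x])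
qed (use eps_hom eps_surj in \<open>auto simp: triv_simps A_ring R.cring_axioms ring_hom_closed ring_hom_add ring_hom_mult
      ring_hom_one R.l_distr R.r_distr R.m_assoc\<close>)

sublocale aug: augmented_ring A triv R eps by (rule augmented)

lemma diagram_span_right_ideal:
  assumes "\<And>x y. \<lbrakk>x \<in> D; y \<in> D; x \<in> S\<rbrakk> \<Longrightarrow> comp_diagram n x y \<in> S"
  shows "aug.right_ideal (diagram_span S)"
proof (rule aug.right_idealI)
  show "\<zero>\<^bsub>A\<^esub> \<in> diagram_span S"
    unfolding A_zero by (subst proj_in_span_iff) (simp_all, simp add: TL_zero)
  show "\<ominus>\<^bsub>A\<^esub> K \<in> diagram_span S" if K: "K \<in> diagram_span S" for K
  proof -
    obtain f where f: "f \<in> carrier TLA" "K = proj f" "\<forall>d. has_lr d \<longrightarrow> f d \<noteq> \<zero> \<longrightarrow> d \<in> S"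
      using K by (rule diagram_spanE)
    have "\<forall>d. has_lr d \<longrightarrow> (\<ominus>\<^bsub>TLA\<^esub> f) d \<noteq> \<zero> \<longrightarrow> d \<in> S"
      using f(3) unfolding TL_uminus[OF f(1)] by (metis R.minus_zero)
    then show ?thesis
      unfolding f(2) A_uminus[OF f(1)] using f(1) by (simp add: proj_in_span_iff)
  qed
qed (use assms diagram_span_subset diagram_span_add diagram_span_mult_right in blast)+

lemma diagram_span_acts_zero:
  assumes "id_diagram n \<notin> S" "K \<in> diagram_span S" "x \<in> carrier triv"
  shows "K \<odot>\<^bsub>triv\<^esub> x = \<zero>\<^bsub>triv\<^esub>"
proof -
  obtain f where f: "f \<in> carrier TLA" "K = proj f" "\<forall>d. has_lr d \<longrightarrow> f d \<noteq> \<zero> \<longrightarrow> d \<in> S"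
    using assms(2) by (rule diagram_spanE)
  then have "eps K = \<zero>" using has_lr_id[OF n] assms(1) by (auto simp: eps_proj)
  then show ?thesis using assms(3) by (simp add: triv_simps)
qed

text \<open>The point where the quotient by \<open>I0\<close> matters: prescribed cups that overlap
  or exhaust the left column leave no diagram with a left-to-right connection, so their ideal
  vanishes.\<close>

lemma diagram_span_trivial:
  assumes "\<And>d. \<lbrakk>d \<in> D; has_lr d\<rbrakk> \<Longrightarrow> d \<notin> S"
  shows "diagram_span S = {\<zero>\<^bsub>A\<^esub>}"
proof (intro equalityI subsetI)
  fix K assume "K \<in> diagram_span S"
  then obtain f where f: "f \<in> carrier TLA" "K = proj f" "\<forall>d. has_lr d \<longrightarrow> f d \<noteq> \<zero> \<longrightarrow> d \<in> S"
    by (rule diagram_spanE)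
  have "f d = \<zero>" if "has_lr d" for d
    using f(1,3) assms[of d] that by (auto simp: TL_carrier_iff)
  then have "proj f = proj \<zero>\<^bsub>TLA\<^esub>" using f(1) by (simp add: proj_eq_iff) (simp add: TL_zero)
  then show "K \<in> {\<zero>\<^bsub>A\<^esub>}" using f(2) by (simp add: A_zero)
next
  fix K assume "K \<in> {\<zero>\<^bsub>A\<^esub>}"
  then show "K \<in> diagram_span S"
    by (simp add: A_zero proj_in_span_iff) (simp add: TL_zero)
qed

section \<open>Ideals of prescribed left cups\<close>

definition cups :: "nat set \<Rightarrow> diagram set" where
  "cups S = {d. \<forall>i\<in>S. left_cup i d}"

text \<open>Spans the intersection of the ideal of \<open>cups S\<close> with the sum of the ideals
  \<open>J\<^sub>i\<close> for \<open>i \<in> T\<close>, the shape that recurs in the Mayer-Vietoris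
  induction.\<close>

definition cups_meet :: "nat set \<Rightarrow> nat set \<Rightarrow> diagram set" where
  "cups_meet S T = {d \<in> cups S. \<exists>i\<in>T. left_cup i d}"

text \<open>Multiplication by a zigzag is a retraction that creates the cup \<open>i\<close>, provided that it does not
  disturb the cups already present.\<close>

lemma acyclic_cups_insert:
  assumes ac: "aug.acyclic_on (diagram_span (cups S))"
    and i: "Suc i < n" "c < n" "c = Suc (Suc i) \<or> i = Suc c"
    and S: "\<And>j. j \<in> S \<Longrightarrow> {j, Suc j} \<inter> {i, Suc i, c} = {}"
  shows "aug.acyclic_on (diagram_span (cups (insert i S)))"
proof -
  \<comment> \<open>Of the two ends of the new cup, \<open>b\<close> is the one next to the spare
    node \<open>c\<close>.\<close>
  obtain a b where ab: "{a, b} = {i, Suc i}" "b = Suc a \<and> c = Suc b \<or> a = Suc b \<and> b = Suc c"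
    using i(3) by (metis insert_commute)
  then have abc: "a < n" "b < n" "c < n" "distinct [a, b, c]" using i by (auto simp: doubleton_eq_iff)
  have eq: "{a, b, c} = {i, Suc i, c}" using ab(1) by auto
  let ?z = "zigzag n a b c"
  have z: "?z \<in> D" using zigzag_TL[OF abc(1,3) ab(2)] .
  have e: "{Lft a, Lft b} = {Lft i, Lft (Suc i)}" using ab(1) by (auto simp: doubleton_eq_iff)
  show ?thesis
  proof (rule aug.acyclic_on_retract[OF ac])
    show "diagram_span (cups (insert i S)) \<subseteq> diagram_span (cups S)"
      by (rule diagram_span_mono) (auto simp: cups_def)
    show "proj (basis ?z) \<in> carrier A" using basis_closed[OF z] by (auto simp: A_carrier)
    show "proj (basis ?z) \<otimes>\<^bsub>A\<^esub> K \<in> diagram_span (cups (insert i S))" if "K \<in> diagram_span (cups S)" for K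
    proof (rule basis_mult_span[OF z that])
      fix y assume y: "y \<in> D" "y \<in> cups S"
      have "left_cup j (comp_diagram n ?z y)" if "j \<in> S" for j
        using zigzag_preserves[OF abc TL_diagramsD(1)[OF y(1)], of j "Suc j"] S[OF that] y(2) that
        unfolding eq cups_def by blast
      then show "comp_diagram n ?z y \<in> cups (insert i S)"
        using zigzag_edge[OF abc TL_diagramsD(1)[OF y(1)]] e by (auto simp: cups_def)
    qed
    show "proj (basis ?z) \<otimes>\<^bsub>A\<^esub> K = K" if "K \<in> diagram_span (cups (insert i S))" for K
    proof (rule basis_mult_span_id[OF z that])
      fix y assume y: "y \<in> D" "y \<in> cups (insert i S)"
      then have "{Lft a, Lft b} \<in> y" using e by (simp add: cups_def)
      then show "comp_diagram n ?z y = y \<and> loops n ?z y = 0"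
        using comp_zigzag[OF abc TL_diagramsD(1)[OF y(1)]] loops_zigzag[OF abc TL_diagramsD(1)[OF y(1)]] by blast
    qed
  qed
qed

text \<open>If some diagram has all the cups in \<open>S\<close> and a left-to-right connection starting at \<open>p\<close>, then the
  cups can be created one by one, from the two ends towards \<open>p\<close>, so that each
  zigzag only meets cups that are still to be created.\<close>

lemma acyclic_cups:
  assumes S: "\<And>i. i \<in> S \<Longrightarrow> Suc i < n"
  shows "aug.acyclic_on (diagram_span (cups S))"
proof (cases "\<exists>d\<in>D. has_lr d \<and> d \<in> cups S")
  case False
  then have "diagram_span (cups S) = {\<zero>\<^bsub>A\<^esub>}" by (intro diagram_span_trivial) blast
  then show ?thesis using aug.acyclic_on_zero by simp
next
  case True
  then obtain d p q where d: "d \<in> D" "{Lft p, Rgt q} \<in> d" "d \<in> cups S" by (auto simp: has_lr_def)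
  note dB = TL_diagramsD(1)[OF d(1)]
  have p: "p < n" using Brauer_edgeD[OF dB d(2)] by simp
  have cup: "left_cup i d" if "i \<in> S" for i using d(3) that by (simp add: cups_def)
  have free: "i \<noteq> p" "Suc i \<noteq> p" if "i \<in> S" for i
    using Brauer_edge_unique[OF dB cup[OF that] d(2), of "Lft p"] by (auto simp: doubleton_eq_iff)
  have apart: "j \<noteq> Suc i" if "i \<in> S" "j \<in> S" for i j
    using Brauer_edge_unique[OF dB cup[OF that(1)] cup[OF that(2)], of "Lft j"] by (auto simp: doubleton_eq_iff)
  have left: "aug.acyclic_on (diagram_span (cups (S \<inter> {..<k})))" if "k \<le> p" for k
    using that
  proof (induction k)
    case 0
    have "cups {} = UNIV" by (simp add: cups_def)
    then show ?case using aug.acyclic_on_carrier diagram_span_UNIV by simp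
  next
    case (Suc k)
    show ?case
    proof (cases "k \<in> S")
      case True
      \<comment> \<open>Neither end of the cup is \<open>p\<close>, so the spare node
        \<open>k + 2\<close> is at most \<open>p\<close>. The cups created so far lie at smaller
        heights.\<close>
      have "Suc (Suc k) < n" using Suc.prems free[OF True] p by linarith
      moreover have "{j, Suc j} \<inter> {k, Suc k, Suc (Suc k)} = {}" if "j \<in> S \<inter> {..<k}" for j
        using that apart[of j k] True by auto
      ultimately have "aug.acyclic_on (diagram_span (cups (insert k (S \<inter> {..<k}))))"
        using Suc by (intro acyclic_cups_insert[of _ k "Suc (Suc k)"]) auto
      then show ?thesis using True by (simp add: lessThan_Suc)
    next
      case False
      then show ?thesis using Suc by (simp add: lessThan_Suc)
    qed
  qed
  \<comment> \<open>Now \<open>k\<close> counts nodes from the far end of the column; its last value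
    \<open>n - Suc p\<close> reaches down to \<open>Suc p\<close>.\<close>
  have "aug.acyclic_on (diagram_span (cups (S \<inter> ({..<p} \<union> {n - k..}))))" if "k < n - p" for k
    using that
  proof (induction k)
    case 0
    have "S \<inter> ({..<p} \<union> {n - 0..}) = S \<inter> {..<p}" using S by fastforce
    then show ?case using left[of p] by simp
  next
    case (Suc k)
    let ?i = "n - Suc k"
    have i: "n - k = Suc ?i" "p < ?i" "?i < n" using Suc.prems by auto
    have iv: "{?i..} = insert ?i {Suc ?i..}" by auto
    show ?case
    proof (cases "?i \<in> S")
      case True
      \<comment> \<open>The spare node \<open>c\<close> is at least \<open>p\<close>, whereas the
        cups created to the left of \<open>p\<close> end strictly before \<open>p\<close>, which
        belongs to no cup.\<close>
      obtain c where c: "?i = Suc c" using i(2) by (cases ?i) auto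
      have "{j, Suc j} \<inter> {?i, Suc ?i, c} = {}" if "j \<in> S \<inter> ({..<p} \<union> {n - k..})" for j
        using that apart[OF True, of j] free[of j] i c by auto
      then have "aug.acyclic_on (diagram_span (cups (insert ?i (S \<inter> ({..<p} \<union> {n - k..})))))"
        using Suc S[OF True] c i(3) by (intro acyclic_cups_insert[of _ ?i c]) auto
      moreover have "insert ?i (S \<inter> ({..<p} \<union> {n - k..})) = S \<inter> ({..<p} \<union> {?i..})"
        using True i(1) iv by auto
      ultimately show ?thesis by simp
    next
      case False
      then have "S \<inter> ({..<p} \<union> {n - k..}) = S \<inter> ({..<p} \<union> {?i..})" using i(1) iv by auto
      then show ?thesis using Suc by simp
    qed
  qed
  from this[of "n - Suc p"] have "aug.acyclic_on (diagram_span (cups (S \<inter> ({..<p} \<union> {Suc p..}))))"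
    using p by simp
  moreover have "S \<inter> ({..<p} \<union> {Suc p..}) = S" using free(1) by (auto simp: Suc_le_eq) (metis linorder_neqE_nat)
  ultimately show ?thesis by simp
qed

lemma cups_comp:
  "\<lbrakk>x \<in> D; y \<in> D; x \<in> cups S\<rbrakk> \<Longrightarrow> comp_diagram n x y \<in> cups S"
  "\<lbrakk>x \<in> D; y \<in> D; x \<in> cups_meet S T\<rbrakk> \<Longrightarrow> comp_diagram n x y \<in> cups_meet S T"
  using left_edge_comp[OF TL_diagramsD(1)] unfolding cups_def cups_meet_def by blast+

text \<open>Adding \<open>j\<close> to \<open>T\<close> adjoins the ideal of
  \<open>cups (insert j S)\<close>. Its intersection with the previous ideal has the same shape,
  with \<open>j\<close> moved into \<open>S\<close>, so the induction hypothesis must hold for all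
  \<open>S\<close>.\<close>

lemma acyclic_cups_meet:
  assumes "finite T" "\<And>i. i \<in> T \<Longrightarrow> Suc i < n" "\<And>i. i \<in> S \<Longrightarrow> Suc i < n"
  shows "aug.acyclic_on (diagram_span (cups_meet S T))"
  using assms
proof (induction T arbitrary: S rule: finite_induct)
  case empty
  have "diagram_span (cups_meet S {}) = {\<zero>\<^bsub>A\<^esub>}" by (rule diagram_span_trivial) (simp add: cups_meet_def)
  then show ?case using aug.acyclic_on_zero by simp
next
  case (insert j T)
  let ?U = "cups_meet S T" and ?V = "cups (insert j S)"
  have T: "\<And>i. i \<in> T \<Longrightarrow> Suc i < n" and j: "Suc j < n" using insert.prems by auto
  have Un: "cups_meet S (insert j T) = ?U \<union> ?V" and Int: "?U \<inter> ?V = cups_meet (insert j S) T"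
    by (auto simp: cups_meet_def cups_def)
  have id: "id_diagram n \<notin> ?U" "id_diagram n \<notin> ?V"
    using left_cup_not_id T j by (auto simp: cups_meet_def cups_def)
  show ?case
    unfolding Un
  proof (rule aug.acyclic_on_sum[where U = "diagram_span ?U" and V = "diagram_span ?V"])
    show "aug.acyclic_on (diagram_span ?U)" using insert.IH T insert.prems(2) by blast
    show "aug.acyclic_on (diagram_span ?V)" using acyclic_cups j insert.prems(2) by blast
    show "aug.acyclic_on (diagram_span ?U \<inter> diagram_span ?V)"
      unfolding diagram_span_Int Int using insert.IH[of "insert j S"] T j insert.prems(2) by blast
    show "aug.right_ideal (diagram_span ?U)" by (rule diagram_span_right_ideal) (rule cups_comp(2))
    show "aug.right_ideal (diagram_span ?V)" by (rule diagram_span_right_ideal) (rule cups_comp(1))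
    show "K \<odot>\<^bsub>triv\<^esub> x = \<zero>\<^bsub>triv\<^esub>" if "K \<in> diagram_span ?U" "x \<in> carrier triv" for K x
      by (rule diagram_span_acts_zero[OF id(1) that])
    show "K \<odot>\<^bsub>triv\<^esub> x = \<zero>\<^bsub>triv\<^esub>" if "K \<in> diagram_span ?V" "x \<in> carrier triv" for K x
      by (rule diagram_span_acts_zero[OF id(2) that])
    show "diagram_span ?U \<subseteq> diagram_span (?U \<union> ?V)" "diagram_span ?V \<subseteq> diagram_span (?U \<union> ?V)"
      by (rule diagram_span_mono, blast)+
  qed (rule diagram_span_add diagram_span_split; assumption)+
qed

lemma acyclic_aug_ideal: "aug.acyclic_on aug.aug_ideal"
proof -
  have fin: "finite {i. Suc i < n}" by (rule finite_subset[of _ "{..<n}"]) auto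
  have "{d. \<exists>i. Suc i < n \<and> left_cup i d} = cups_meet {} {i. Suc i < n}"
    by (simp add: cups_meet_def cups_def)
  then have "aug.aug_ideal = diagram_span (cups_meet {} {i. Suc i < n})" by (simp only: eps_kernel)
  then show ?thesis using acyclic_cups_meet[OF fin, of "{}"] by (simp only: mem_Collect_eq empty_iff)
qed

end

theorem theorem1p2:
  fixes R :: "('r, 's) ring_scheme" and \<delta> :: 'r and n q :: nat
  assumes "cring R" and "\<delta> \<in> carrier R" and "n > 0" and "q > 0"
  shows "trivial_group
    (Tor (TL R \<delta> n Quot TL_I0 R \<delta> n) (triv_module R n) (triv_module R n) q)"
proof -
  interpret temperley_lieb R \<delta> n
    using assms by (simp add: temperley_lieb_def temperley_lieb_axioms_def)
  show ?thesis by (rule aug.Tor_trivial[OF acyclic_aug_ideal \<open>q > 0\<close>])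
qed

end
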